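(* Let $b$ be a prime, $\alpha>1$, let $(\gamma_j)_{j\in\mathbb{N}}$ be positive reals defining product weights $\gamma_{\mathfrak{u}}=\prod_{j\in\mathfrak{u}}\gamma_j$ for finite $\mathfrak{u}\subset\mathbb{N}$, and let $0\le w_1\le w_2\le\cdots$ be integers. For $s,m\in\mathbb{N}$ and $N=b^m$ let $\boldsymbol{z}\in\mathbb{Z}^s$ be constructed by the reduced CBC construction (described in the context). Let $\delta\in(0,\frac{\alpha-1}{2}]$ and let $$c_{s,\alpha,\boldsymbol{\gamma},\delta,\boldsymbol{w}}=\left(2\sum_{\emptyset\ne\mathfrak{u}\subseteq[s]}\gamma_{\mathfrak{u}}^{\frac{1}{\alpha-2\delta}}\left(2\zeta\left(\tfrac{\alpha}{\alpha-2\delta}\right)\right)^{|\mathfrak{u}|}b^{\max_{j\in\mathfrak{u}}w_j}\right)^{\alpha/2-\delta},$$ which is the factor in the error bound $e_{N,s}(\boldsymbol{z})\le c_{s,\alpha,\boldsymbol{\gamma},\delta,\boldsymbol{w}}N^{-\alpha/2+\delta}$. 1. For all $s\in\mathbb{N}$, $$c_{s,\alpha,\boldsymbol{\gamma},\delta,\boldsymbol{w}}\le\left(2\prod_{j=1}^s\left(1+\gamma_j^{\frac{1}{\alpha-2\delta}}\,2\zeta\left(\tfrac{\alpha}{\alpha-2\delta}\right)b^{w_j}\right)\right)^{\alpha/2-\delta}.$$ 2. If $A:=\limsup_{s\to\infty}\frac{\sum_{j=1}^s\gamma_j^{1/(\alpha-2\delta)}b^{w_j}}{\log s}<\infty$,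 then for every $\eta>0$ there is $c_\eta>0$ such that $c_{s,\alpha,\boldsymbol{\gamma},\delta,\boldsymbol{w}}\le c_\eta\,2^{\alpha/2-\delta}s^{\zeta(\frac{\alpha}{\alpha-2\delta})(A+\eta)(\alpha-2\delta)}$ for all $s\in\mathbb{N}$. In particular, the integration problem is polynomially QMC-tractable with $\varepsilon$-exponent at most $\frac{2}{\alpha-2\delta}$ and $s$-exponent at most $2\zeta(\frac{\alpha}{\alpha-2\delta})A$. 3. If $B:=\sum_{j=1}^\infty\gamma_j^{1/(\alpha-2\delta)}b^{w_j}<\infty$, then $c_{s,\alpha,\boldsymbol{\gamma},\delta,\boldsymbol{w}}\le2^{\alpha/2-\delta}\mathrm{e}^{(\alpha-2\delta)\zeta(\frac{\alpha}{\alpha-2\delta})B}$ for all $s\in\mathbb{N}$. This implies that the integration problem is strongly polynomially QMC-tractable with $\varepsilon$-exponent at most $\frac{2}{\alpha-2\delta}$. 4. If $\lim_{s\to\infty}\frac1s\sum_{j=1}^s\gamma_jb^{w_j}=0$, then the integration problem is weakly QMC-tractable.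
   Context: Notation: $[s]=\{1,\ldots,s\}$, $\mathbb{Z}_*=\mathbb{Z}\setminus\{0\}$, $\zeta(x)=\sum_{n\ge1}n^{-x}$ for $x>1$, $\boldsymbol{x}_{\mathfrak{u}}=(x_j)_{j\in\mathfrak{u}}$. Weighted Korobov space: for $s\in\mathbb{N}$, $\mathcal{H}_s=\mathcal{H}(K_{s,\alpha,\boldsymbol{\gamma}})$ is the reproducing kernel Hilbert space of functions on $[0,1]^s$ with kernel $$K_{s,\alpha,\boldsymbol{\gamma}}(\boldsymbol{x},\boldsymbol{y})=1+\sum_{\emptyset\ne\mathfrak{u}\subseteq[s]}\gamma_{\mathfrak{u}}\sum_{\boldsymbol{h}_{\mathfrak{u}}\in\mathbb{Z}_*^{|\mathfrak{u}|}}\frac{\exp(2\pi\mathrm{i}\,\boldsymbol{h}_{\mathfrak{u}}\cdot(\boldsymbol{x}_{\mathfrak{u}}-\boldsymbol{y}_{\mathfrak{u}}))}{\prod_{j\in\mathfrak{u}}|h_j|^{\alpha}}.$$ Worst-case errors: for an $N$-element point set (multiset) $\mathcal{P}$ in $[0,1]^s$, $e_{N,s}(\mathcal{H}_s,\mathcal{P})=\sup_{\|f\|_{\mathcal{H}_s}\le1}\left|\int_{[0,1]^s}f(\boldsymbol{x})\,\mathrm{d}\boldsymbol{x}-\frac1N\sum_{\boldsymbol{x}\in\mathcal{P}}f(\boldsymbol{x})\right|$. For $\boldsymbol{z}\in\mathbb{Z}^s$, $e_{N,s}(\boldsymbol{z})$ denotes this error for the lattice point set $\{\frac{k}{N}\boldsymbol{z}\}$,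 $k=0,\ldots,N-1$ (componentwise fractional parts). It is known that $$e_{N,s}^2(\boldsymbol{z})=\sum_{\emptyset\ne\mathfrak{u}\subseteq[s]}\gamma_{\mathfrak{u}}\sum_{\boldsymbol{h}_{\mathfrak{u}}\in\mathcal{D}_{\mathfrak{u}}}\prod_{j\in\mathfrak{u}}|h_j|^{-\alpha},\qquad \mathcal{D}_{\mathfrak{u}}=\{\boldsymbol{h}_{\mathfrak{u}}\in\mathbb{Z}_*^{|\mathfrak{u}|}:\boldsymbol{h}_{\mathfrak{u}}\cdot\boldsymbol{z}_{\mathfrak{u}}\equiv0\pmod N\}.$$ Reduced CBC construction ($N=b^m$): put $\mathcal{Z}_{N,w_j}=\{z\in\{1,2,\ldots,b^{m-w_j}-1\}:\gcd(z,N)=1\}$ if $w_j<m$ and $\mathcal{Z}_{N,w_j}=\{1\}$ if $w_j\ge m$; $Y_j=b^{w_j}$. Set $z_1=1$. For $d=1,\ldots,s-1$ successively, given $z_1,\ldots,z_d$, choose $z_{d+1}\in\mathcal{Z}_{N,w_{d+1}}$ minimizing $e_{N,d+1}^2((Y_1z_1,\ldots,Y_dz_d,Y_{d+1}z_{d+1}))$ as a function of $z_{d+1}$. The output is $\boldsymbol{z}=(Y_1z_1,\ldots,Y_sz_s)$. Tractability: let $e(N,s)=\inf_{\mathcal{P}}e_{N,s}(\mathcal{H}_s,\mathcal{P})$ over all $N$-element point sets in $[0,1]^s$, $e(0,s)=\sup_{\|f\|_{\mathcal{H}_s}\le1}|\int_{[0,1]^s}f(\boldsymbol{x})\,\mathrm{d}\boldsymbol{x}|$,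 and $N_{\min}(\varepsilon,s)=\min\{N\in\mathbb{N}:e(N,s)\le\varepsilon\,e(0,s)\}$ for $\varepsilon\in(0,1)$, $s\in\mathbb{N}$. The integration problem (in the spaces $\mathcal{H}_s$, $s\in\mathbb{N}$) is: weakly QMC-tractable if $\lim_{s+\varepsilon^{-1}\to\infty}\frac{\log N_{\min}(\varepsilon,s)}{s+\varepsilon^{-1}}=0$; polynomially QMC-tractable if there are $c,p,q\ge0$ with $N_{\min}(\varepsilon,s)\le c\,s^q\varepsilon^{-p}$ for all $\varepsilon,s$; strongly polynomially QMC-tractable if this holds with $q=0$. Exponents are understood as infima: strong polynomial tractability has $\varepsilon$-exponent equal to the infimum of all $p$ for which the bound holds with $q=0$ (and some $c$); polynomial tractability with $\varepsilon$-exponent at most $p_0$ and $s$-exponent at most $q_0$ means that for all $p>p_0$, $q>q_0$ there is $c$ with $N_{\min}(\varepsilon,s)\le c\,s^q\varepsilon^{-p}$ for all $\varepsilon,s$. *)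

theory Defs
  imports "HOL-Analysis.Analysis" "HOL-Computational_Algebra.Primes" "HOL-Library.Multiset"
begin

definition zeta :: "real \<Rightarrow> real" where
  "zeta x = (\<Sum>n. 1 / real (Suc n) powr x)"


section \<open>Reproducing kernel Hilbert spaces\<close>

text \<open>
  Complex-valued functions on a set \<open>D\<close> are represented by total functions that vanish
  outside \<open>D\<close>, so that equality and the pointwise vector space operations are those of
  functions on \<open>D\<close>. Inner products are linear in the first argument; the values of \<open>ip\<close>
  outside the space \<open>H\<close> are irrelevant.
\<close>

definition function_space_on :: "'a set \<Rightarrow> ('a \<Rightarrow> complex) set \<Rightarrow> bool" where
  "function_space_on D H \<longleftrightarrow>
     (\<forall>f\<in>H. \<forall>x. x \<notin> D \<longrightarrow> f x = 0) \<and>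
     (\<lambda>x. 0) \<in> H \<and>
     (\<forall>f\<in>H. \<forall>g\<in>H. (\<lambda>x. f x + g x) \<in> H) \<and>
     (\<forall>c. \<forall>f\<in>H. (\<lambda>x. c * f x) \<in> H)"

definition inner_product_on ::
  "('a \<Rightarrow> complex) set \<Rightarrow> (('a \<Rightarrow> complex) \<Rightarrow> ('a \<Rightarrow> complex) \<Rightarrow> complex) \<Rightarrow> bool" where
  "inner_product_on H ip \<longleftrightarrow>
     (\<forall>f\<in>H. \<forall>g\<in>H. \<forall>h\<in>H. ip (\<lambda>x. f x + g x) h = ip f h + ip g h) \<and>
     (\<forall>c. \<forall>f\<in>H. \<forall>g\<in>H. ip (\<lambda>x. c * f x) g = c * ip f g) \<and>
     (\<forall>f\<in>H. \<forall>g\<in>H. ip g f = cnj (ip f g)) \<and>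
     (\<forall>f\<in>H. 0 \<le> Re (ip f f)) \<and>
     (\<forall>f\<in>H. ip f f = 0 \<longrightarrow> f = (\<lambda>x. 0))"

definition ip_norm :: "(('a \<Rightarrow> complex) \<Rightarrow> ('a \<Rightarrow> complex) \<Rightarrow> complex) \<Rightarrow> ('a \<Rightarrow> complex) \<Rightarrow> real" where
  "ip_norm ip f = sqrt (Re (ip f f))"

definition hilbert_function_space ::
  "'a set \<Rightarrow> ('a \<Rightarrow> complex) set \<Rightarrow> (('a \<Rightarrow> complex) \<Rightarrow> ('a \<Rightarrow> complex) \<Rightarrow> complex) \<Rightarrow> bool" where
  "hilbert_function_space D H ip \<longleftrightarrow>
     function_space_on D H \<and> inner_product_on H ip \<and>
     Metric_space.mcomplete H (\<lambda>f g. ip_norm ip (\<lambda>x. f x - g x))"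

definition kernel_section :: "'a set \<Rightarrow> ('a \<Rightarrow> 'a \<Rightarrow> complex) \<Rightarrow> 'a \<Rightarrow> 'a \<Rightarrow> complex" where
  "kernel_section D K y = (\<lambda>x. if x \<in> D then K x y else 0)"

definition is_rkhs ::
  "'a set \<Rightarrow> ('a \<Rightarrow> 'a \<Rightarrow> complex) \<Rightarrow> ('a \<Rightarrow> complex) set \<Rightarrow>
   (('a \<Rightarrow> complex) \<Rightarrow> ('a \<Rightarrow> complex) \<Rightarrow> complex) \<Rightarrow> bool" where
  "is_rkhs D K H ip \<longleftrightarrow>
     hilbert_function_space D H ip \<and>
     (\<forall>y\<in>D. kernel_section D K y \<in> H) \<and>
     (\<forall>f\<in>H. \<forall>y\<in>D. f y = ip f (kernel_section D K y))"


section \<open>The weighted Korobov kernel\<close>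

text \<open>Points of the cube and frequency vectors are extensional functions on their index sets;
  coordinates are numbered from 1.\<close>

definition unit_cube :: "nat \<Rightarrow> (nat \<Rightarrow> real) set" where
  "unit_cube s = (\<Pi>\<^sub>E j\<in>{1..s}. {0..1})"

definition product_weight :: "(nat \<Rightarrow> real) \<Rightarrow> nat set \<Rightarrow> real" where
  "product_weight \<gamma> u = (\<Prod>j\<in>u. \<gamma> j)"

definition korobov_kernel ::
  "nat \<Rightarrow> real \<Rightarrow> (nat set \<Rightarrow> real) \<Rightarrow> (nat \<Rightarrow> real) \<Rightarrow> (nat \<Rightarrow> real) \<Rightarrow> complex" where
  "korobov_kernel s \<alpha> \<gamma> x y =
     1 + (\<Sum>u\<in>Pow {1..s} - {{}}. of_real (\<gamma> u) *
           (\<Sum>\<^sub>\<infinity>h\<in>(\<Pi>\<^sub>E j\<in>u. UNIV - {0::int}).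
              exp (2 * of_real pi * \<i> * of_real (\<Sum>j\<in>u. of_int (h j) * (x j - y j))) /
              of_real (\<Prod>j\<in>u. \<bar>real_of_int (h j)\<bar> powr \<alpha>)))"


section \<open>Worst-case errors\<close>

text \<open>Point sets are multisets. The real-valued suprema below range over bounded sets for a
  space with bounded kernel on the cube, since then
  \<open>cmod (f x) \<le> ip_norm ip f * sqrt (Re (K x x))\<close>.\<close>

definition cube_integral :: "nat \<Rightarrow> ((nat \<Rightarrow> real) \<Rightarrow> complex) \<Rightarrow> complex" where
  "cube_integral s f = set_lebesgue_integral (\<Pi>\<^sub>M j\<in>{1..s}. lborel) (unit_cube s) f"

definition worst_case_error ::
  "nat \<Rightarrow> ((nat \<Rightarrow> real) \<Rightarrow> complex) set \<Rightarrow>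
   (((nat \<Rightarrow> real) \<Rightarrow> complex) \<Rightarrow> ((nat \<Rightarrow> real) \<Rightarrow> complex) \<Rightarrow> complex) \<Rightarrow>
   (nat \<Rightarrow> real) multiset \<Rightarrow> real" where
  "worst_case_error s H ip P =
     (SUP f\<in>{f\<in>H. ip_norm ip f \<le> 1}.
        cmod (cube_integral s f - (1 / of_nat (size P)) * (\<Sum>x\<in>#P. f x)))"

definition initial_error ::
  "nat \<Rightarrow> ((nat \<Rightarrow> real) \<Rightarrow> complex) set \<Rightarrow>
   (((nat \<Rightarrow> real) \<Rightarrow> complex) \<Rightarrow> ((nat \<Rightarrow> real) \<Rightarrow> complex) \<Rightarrow> complex) \<Rightarrow> real" where
  "initial_error s H ip = (SUP f\<in>{f\<in>H. ip_norm ip f \<le> 1}. cmod (cube_integral s f))"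

definition lattice_points :: "nat \<Rightarrow> nat \<Rightarrow> (nat \<Rightarrow> int) \<Rightarrow> (nat \<Rightarrow> real) multiset" where
  "lattice_points N s z =
     image_mset (\<lambda>k. \<lambda>j\<in>{1..s}. frac (real k / real N * of_int (z j))) (mset_set {0..<N})"


section \<open>Reduced component-by-component construction\<close>

text \<open>From here on \<open>H s\<close> and \<open>ip s\<close> are the space and inner product in dimension \<open>s\<close>.\<close>

definition cbc_search_set :: "nat \<Rightarrow> nat \<Rightarrow> nat \<Rightarrow> nat set" where
  "cbc_search_set b m v =
     (if v < m then {z \<in> {1..b ^ (m - v) - 1}. gcd z (b ^ m) = 1} else {1})"

definition cbc_vector :: "nat \<Rightarrow> (nat \<Rightarrow> nat) \<Rightarrow> (nat \<Rightarrow> nat) \<Rightarrow> nat \<Rightarrow> int" where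
  "cbc_vector b w z = (\<lambda>j. int (b ^ w j * z j))"

definition reduced_cbc ::
  "(nat \<Rightarrow> ((nat \<Rightarrow> real) \<Rightarrow> complex) set) \<Rightarrow>
   (nat \<Rightarrow> ((nat \<Rightarrow> real) \<Rightarrow> complex) \<Rightarrow> ((nat \<Rightarrow> real) \<Rightarrow> complex) \<Rightarrow> complex) \<Rightarrow>
   nat \<Rightarrow> nat \<Rightarrow> (nat \<Rightarrow> nat) \<Rightarrow> nat \<Rightarrow> (nat \<Rightarrow> nat) \<Rightarrow> bool" where
  "reduced_cbc H ip b m w s z \<longleftrightarrow>
     z 1 = 1 \<and>
     (\<forall>d\<in>{1..<s}.
        is_arg_min
          (\<lambda>v. (worst_case_error (d + 1) (H (d + 1)) (ip (d + 1))
                  (lattice_points (b ^ m) (d + 1) (cbc_vector b w (z(d + 1 := v)))))\<^sup>2)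
          (\<lambda>v. v \<in> cbc_search_set b m (w (d + 1)))
          (z (d + 1)))"

definition cbc_constant ::
  "nat \<Rightarrow> real \<Rightarrow> (nat set \<Rightarrow> real) \<Rightarrow> real \<Rightarrow> nat \<Rightarrow> (nat \<Rightarrow> nat) \<Rightarrow> real" where
  "cbc_constant s \<alpha> \<gamma> \<delta> b w =
     (2 * (\<Sum>u\<in>Pow {1..s} - {{}}.
             \<gamma> u powr (1 / (\<alpha> - 2 * \<delta>)) * (2 * zeta (\<alpha> / (\<alpha> - 2 * \<delta>))) ^ card u *
             real b ^ Max (w ` u))) powr (\<alpha> / 2 - \<delta>)"


section \<open>Tractability\<close>

definition minimal_error ::
  "(nat \<Rightarrow> ((nat \<Rightarrow> real) \<Rightarrow> complex) set) \<Rightarrow>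
   (nat \<Rightarrow> ((nat \<Rightarrow> real) \<Rightarrow> complex) \<Rightarrow> ((nat \<Rightarrow> real) \<Rightarrow> complex) \<Rightarrow> complex) \<Rightarrow>
   nat \<Rightarrow> nat \<Rightarrow> real" where
  "minimal_error H ip N s =
     (INF P\<in>{P. size P = N \<and> set_mset P \<subseteq> unit_cube s}. worst_case_error s (H s) (ip s) P)"

definition N_min ::
  "(nat \<Rightarrow> ((nat \<Rightarrow> real) \<Rightarrow> complex) set) \<Rightarrow>
   (nat \<Rightarrow> ((nat \<Rightarrow> real) \<Rightarrow> complex) \<Rightarrow> ((nat \<Rightarrow> real) \<Rightarrow> complex) \<Rightarrow> complex) \<Rightarrow>
   real \<Rightarrow> nat \<Rightarrow> nat" where
  "N_min H ip \<epsilon> s =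
     (LEAST N. 1 \<le> N \<and> minimal_error H ip N s \<le> \<epsilon> * initial_error s (H s) (ip s))"

text \<open>The tractability notions are stated for an arbitrary information complexity
  \<open>n \<epsilon> s\<close>.\<close>

definition weakly_tractable :: "(real \<Rightarrow> nat \<Rightarrow> nat) \<Rightarrow> bool" where
  "weakly_tractable n \<longleftrightarrow>
     ((\<lambda>(\<epsilon>, s). ln (real (n \<epsilon> s)) / (real s + 1 / \<epsilon>)) \<longlongrightarrow> 0)
       (inf (filtercomap (\<lambda>(\<epsilon>, s). real s + 1 / \<epsilon>) at_top) (principal ({0<..<1} \<times> {1..})))"

definition tractability_bound :: "(real \<Rightarrow> nat \<Rightarrow> nat) \<Rightarrow> real \<Rightarrow> real \<Rightarrow> real \<Rightarrow> bool" where
  "tractability_bound n c p q \<longleftrightarrow>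
     (\<forall>\<epsilon>\<in>{0<..<1}. \<forall>s\<ge>1. real (n \<epsilon> s) \<le> c * real s powr q * \<epsilon> powr (- p))"

definition polynomially_tractable :: "(real \<Rightarrow> nat \<Rightarrow> nat) \<Rightarrow> bool" where
  "polynomially_tractable n \<longleftrightarrow> (\<exists>c\<ge>0. \<exists>p\<ge>0. \<exists>q\<ge>0. tractability_bound n c p q)"

definition polynomial_exponents_at_most :: "(real \<Rightarrow> nat \<Rightarrow> nat) \<Rightarrow> real \<Rightarrow> real \<Rightarrow> bool" where
  "polynomial_exponents_at_most n p\<^sub>0 q\<^sub>0 \<longleftrightarrow> (\<forall>p>p\<^sub>0. \<forall>q>q\<^sub>0. \<exists>c\<ge>0. tractability_bound n c p q)"

definition strongly_polynomially_tractable :: "(real \<Rightarrow> nat \<Rightarrow> nat) \<Rightarrow> bool" where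
  "strongly_polynomially_tractable n \<longleftrightarrow> (\<exists>c\<ge>0. \<exists>p\<ge>0. tractability_bound n c p 0)"

definition strong_exponent :: "(real \<Rightarrow> nat \<Rightarrow> nat) \<Rightarrow> real" where
  "strong_exponent n = Inf {p. 0 \<le> p \<and> (\<exists>c\<ge>0. tractability_bound n c p 0)}"

end

theory Submission
  imports Defs "HOL-Number_Theory.Totient"
begin

text \<open>
  The functional "integral minus average over \<open>P\<close>" is represented, in a limiting sense, by the
  function \<open>1 - (1/N) \<Sum>\<^sub>x K(\<cdot>, x)\<close>, because every section of the kernel has integral 1. Hence the
  squared worst-case error is \<open>(1/N\<^sup>2) \<Sum>\<^sub>x \<Sum>\<^sub>y K(x, y) - 1\<close>. For a lattice point set this is
  computed by a finite Fourier transform over the residue classes modulo \<open>N\<close>.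

  Put \<open>q = 1 / (\<alpha> - 2 \<delta>)\<close>. By subadditivity of \<open>x \<mapsto> x\<^sup>q\<close> and averaging over the search set, the
  \<open>q\<close>-th power of the squared error increases in step \<open>d\<close> of the construction by at most \<open>2/N\<close> times
  the terms of the constant belonging to the sets with maximal element \<open>d\<close>; since \<open>w\<close> is monotone,
  these are the terms with \<open>b ^ w d\<close> as power of \<open>b\<close>. The tractability results follow by taking
  for \<open>N\<close> the least power of \<open>b\<close> for which the error bound is at most \<open>\<epsilon>\<close>.
\<close>

section \<open>Reproducing kernels and approximate representers\<close>

text \<open>Only the class \<open>c = 0\<close> enters the error, yet every residue class has to be
  followed: what step d inherits from the earlier components is the sum of q-th powers over all
  classes, and this total is bounded independently of the vector. Adding a coordinate is a
  convolution on the residue classes, and this is used in two ways. The Fourier transform turns it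
  into a factor of the kernel, and total mass turns it into a factor
  \<open>1 + \<gamma> j powr q * (2 * zeta (\<alpha> * q))\<close>. The power \<open>b ^ w d\<close>
  is the price of the smaller search set. That set still has at least half of
  \<open>b ^ (m - w d)\<close> elements, which is the origin of the 2 in front of the sum in
  \<open>cbc_constant\<close>. If \<open>w d \<ge> m\<close>, the only candidate is 0 modulo N, and
  the factor \<open>b ^ w d / N \<ge> 1\<close> makes the same estimate true. The error formula is
  proved for arbitrary multisets. For the empty one \<open>1 / 0 = 0\<close> removes the average, so
  the initial error comes from the same formula.\<close>

locale kernel_space =
  fixes D :: "'a set" and K :: "'a \<Rightarrow> 'a \<Rightarrow> complex"
    and H :: "('a \<Rightarrow> complex) set" and ip :: "('a \<Rightarrow> complex) \<Rightarrow> ('a \<Rightarrow> complex) \<Rightarrow> complex"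
  assumes space: "function_space_on D H" and inner: "inner_product_on H ip"
    and section_in: "y \<in> D \<Longrightarrow> kernel_section D K y \<in> H"
    and reproducing: "f \<in> H \<Longrightarrow> y \<in> D \<Longrightarrow> f y = ip f (kernel_section D K y)"
begin

lemma vanishes: "f \<in> H \<Longrightarrow> x \<notin> D \<Longrightarrow> f x = 0"
  and zero_in: "(\<lambda>x. 0) \<in> H"
  and add_in: "f \<in> H \<Longrightarrow> g \<in> H \<Longrightarrow> (\<lambda>x. f x + g x) \<in> H"
  and scale_in: "f \<in> H \<Longrightarrow> (\<lambda>x. c * f x) \<in> H"
  using space unfolding function_space_on_def by auto

lemma diff_in: "f \<in> H \<Longrightarrow> g \<in> H \<Longrightarrow> (\<lambda>x. f x - g x) \<in> H"
  using add_in[of f "\<lambda>x. (-1) * g x"] scale_in[of g "-1"] by simp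

lemma ip_add: "f \<in> H \<Longrightarrow> g \<in> H \<Longrightarrow> h \<in> H \<Longrightarrow> ip (\<lambda>x. f x + g x) h = ip f h + ip g h"
  and ip_scale: "f \<in> H \<Longrightarrow> g \<in> H \<Longrightarrow> ip (\<lambda>x. c * f x) g = c * ip f g"
  and ip_cnj: "f \<in> H \<Longrightarrow> g \<in> H \<Longrightarrow> ip g f = cnj (ip f g)"
  and ip_nonneg: "f \<in> H \<Longrightarrow> 0 \<le> Re (ip f f)"
  using inner unfolding inner_product_on_def by blast+

lemma ip_add_right: "f \<in> H \<Longrightarrow> g \<in> H \<Longrightarrow> h \<in> H \<Longrightarrow> ip h (\<lambda>x. f x + g x) = ip h f + ip h g"
  using ip_cnj[of "\<lambda>x. f x + g x" h] ip_cnj[of f h] ip_cnj[of g h] by (simp add: add_in ip_add)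

lemma ip_scale_right: "f \<in> H \<Longrightarrow> g \<in> H \<Longrightarrow> ip f (\<lambda>x. c * g x) = cnj c * ip f g"
  using ip_cnj[of "\<lambda>x. c * g x" f] ip_cnj[of g f] by (simp add: scale_in ip_scale)

lemma ip_diff_right:
  assumes "f \<in> H" "g \<in> H" "h \<in> H" shows "ip h (\<lambda>x. f x - g x) = ip h f - ip h g"
  using ip_add_right[of f "\<lambda>x. (-1) * g x" h] ip_scale_right[of h g "-1"] scale_in[of g "-1"] assms
  by simp

lemma ip_diff:
  assumes "f \<in> H" "g \<in> H" "h \<in> H" shows "ip (\<lambda>x. f x - g x) h = ip f h - ip g h"
  using ip_add[of f "\<lambda>x. (-1) * g x" h] ip_scale[of g h "-1"] scale_in[of g "-1"] assms
  by simp

section \<open>Norms and the Cauchy-Schwarz inequality\<close>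

lemma ip_self: "f \<in> H \<Longrightarrow> ip f f = of_real ((ip_norm ip f)\<^sup>2)"
  using arg_cong[OF ip_cnj[of f f], of Im] ip_nonneg[of f] by (simp add: ip_norm_def complex_eq_iff)

lemma ip_norm_nonneg: "f \<in> H \<Longrightarrow> 0 \<le> ip_norm ip f"
  using ip_nonneg by (simp add: ip_norm_def)

lemma ip_norm_scale: "f \<in> H \<Longrightarrow> ip_norm ip (\<lambda>x. c * f x) = cmod c * ip_norm ip f"
proof -
  assume f: "f \<in> H"
  have "ip (\<lambda>x. c * f x) (\<lambda>x. c * f x) = (c * cnj c) * ip f f"
    using f by (simp add: ip_scale ip_scale_right scale_in)
  also have "\<dots> = of_real ((cmod c)\<^sup>2 * (ip_norm ip f)\<^sup>2)"
    by (simp add: ip_self[OF f] complex_norm_square del: of_real_power)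
  finally show ?thesis
    using ip_norm_nonneg[OF f]
    by (simp add: ip_norm_def[of _ "\<lambda>x. c * f x"] power_mult_distrib[symmetric] del: of_real_mult of_real_power)
qed

lemma ip_norm_add_sq:
  assumes "f \<in> H" "g \<in> H"
  shows "(ip_norm ip (\<lambda>x. f x + g x))\<^sup>2 = (ip_norm ip f)\<^sup>2 + 2 * Re (ip g f) + (ip_norm ip g)\<^sup>2"
proof -
  have "complex_of_real ((ip_norm ip (\<lambda>x. f x + g x))\<^sup>2) = ip f f + cnj (ip g f) + ip g f + ip g g"
    using assms by (simp add: ip_self[symmetric] add_in ip_add ip_add_right ip_cnj[of g f] del: of_real_power)
  then show ?thesis
    using ip_self[OF assms(1)] ip_self[OF assms(2)]
    by (simp add: complex_eq_iff)
qed

text \<open>The squared norm of \<open>g + c f\<close> is nonnegative; with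
  \<open>c = - t * cnj z\<close> it becomes a real quadratic in t. If
  \<open>ip_norm ip f = 0\<close>, it degenerates to a linear function of t, which forces
  \<open>z = 0\<close>.\<close>

lemma Cauchy_Schwarz:
  assumes f: "f \<in> H" and g: "g \<in> H"
  shows "cmod (ip f g) \<le> ip_norm ip f * ip_norm ip g"
proof -
  define z where "z = ip f g"
  define p q where "p = ip_norm ip f" and "q = ip_norm ip g"
  have p: "p \<ge> 0" "q \<ge> 0" unfolding p_def q_def using ip_norm_nonneg f g by auto
  have main: "0 \<le> t\<^sup>2 * (cmod z)\<^sup>2 * p\<^sup>2 - 2 * t * (cmod z)\<^sup>2 + q\<^sup>2" for t :: real
  proof -
    define c where "c = - of_real t * cnj z"
    have "0 \<le> (ip_norm ip (\<lambda>x. g x + c * f x))\<^sup>2" by simp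
    also have "\<dots> = q\<^sup>2 + 2 * Re (c * z) + (cmod c * p)\<^sup>2"
      using f g by (subst ip_norm_add_sq) (auto simp: scale_in ip_scale ip_norm_scale z_def p_def q_def)
    also have "Re (c * z) = - t * (cmod z)\<^sup>2"
      unfolding c_def cmod_power2 by (simp add: algebra_simps power2_eq_square)
    also have "(cmod c * p)\<^sup>2 = t\<^sup>2 * (cmod z)\<^sup>2 * p\<^sup>2"
      by (simp add: c_def norm_mult power_mult_distrib)
    finally show ?thesis by (simp add: algebra_simps)
  qed
  have "cmod z \<le> p * q"
  proof (cases "p = 0")
    case True
    have "cmod z = 0"
    proof (rule ccontr)
      assume "cmod z \<noteq> 0"
      \<comment> \<open>At this t the right-hand side of \<open>main\<close> equals -1.\<close>
      with main[of "(q\<^sup>2 + 1) / (2 * (cmod z)\<^sup>2)"] True show False by simp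
    qed
    then show ?thesis using p by simp
  next
    case False
    \<comment> \<open>\<open>t = 1 / p\<^sup>2\<close> minimizes the quadratic.\<close>
    have "(1 / p\<^sup>2)\<^sup>2 * (cmod z)\<^sup>2 * p\<^sup>2 - 2 * (1 / p\<^sup>2) * (cmod z)\<^sup>2 = - ((cmod z)\<^sup>2 / p\<^sup>2)"
      using False by (simp add: divide_simps) (simp add: eval_nat_numeral algebra_simps)
    with main[of "1 / p\<^sup>2"] have "(cmod z)\<^sup>2 / p\<^sup>2 \<le> q\<^sup>2" by linarith
    then have "(cmod z)\<^sup>2 \<le> (p * q)\<^sup>2"
      using False by (simp add: field_simps)
    then show ?thesis using p by (simp add: power2_le_iff_abs_le)
  qed
  then show ?thesis by (simp add: z_def p_def q_def)
qed

text \<open>By the reproducing property the sections at u and v have inner product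
  \<open>K v u\<close>. The right-hand side is thus the squared distance that the kernel induces on
  points; it controls the increments of all functions in H.\<close>

lemma norm_section:
  assumes "x \<in> D" "y \<in> D"
  shows "(ip_norm ip (\<lambda>t. kernel_section D K x t - kernel_section D K y t))\<^sup>2 =
    Re (K x x - K x y - K y x + K y y)"
proof -
  have "ip (kernel_section D K u) (kernel_section D K v) = K v u" if "u \<in> D" "v \<in> D" for u v
    using reproducing[OF section_in[of u], of v] that by (simp add: kernel_section_def)
  moreover have "complex_of_real ((ip_norm ip (\<lambda>t. kernel_section D K x t - kernel_section D K y t))\<^sup>2) =
    ip (kernel_section D K x) (kernel_section D K x) - ip (kernel_section D K x) (kernel_section D K y)
     - ip (kernel_section D K y) (kernel_section D K x) + ip (kernel_section D K y) (kernel_section D K y)"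
    using assms by (simp add: ip_self[symmetric] diff_in ip_diff ip_diff_right section_in del: of_real_power)
  ultimately have "complex_of_real ((ip_norm ip (\<lambda>t. kernel_section D K x t - kernel_section D K y t))\<^sup>2)
     = K x x - K x y - K y x + K y y"
    using assms by (simp del: of_real_power)
  then show ?thesis by (metis Re_complex_of_real)
qed

lemma point_bound:
  assumes f: "f \<in> H" and y: "y \<in> D"
  shows "cmod (f y) \<le> ip_norm ip f * sqrt (Re (K y y))"
proof -
  have "ip (kernel_section D K y) (kernel_section D K y) = K y y"
    using reproducing[OF section_in[OF y] y] y by (simp add: kernel_section_def)
  then have "ip_norm ip (kernel_section D K y) = sqrt (Re (K y y))"
    by (simp add: ip_norm_def)
  then show ?thesis
    using Cauchy_Schwarz[OF f section_in[OF y]] reproducing[OF f y] by simp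
qed

lemma point_diff_bound:
  assumes f: "f \<in> H" and y: "x \<in> D" "y \<in> D"
  shows "cmod (f x - f y) \<le> ip_norm ip f * sqrt (Re (K x x - K x y - K y x + K y y))"
proof -
  let ?d = "\<lambda>t. kernel_section D K x t - kernel_section D K y t"
  have "f x - f y = ip f ?d"
    using f y by (simp add: reproducing ip_diff_right section_in)
  moreover have "ip_norm ip ?d = sqrt (Re (K x x - K x y - K y x + K y y))"
    using norm_section[OF y] ip_norm_nonneg[OF diff_in[OF section_in[OF y(1)] section_in[OF y(2)]]]
    by (metis real_sqrt_abs abs_of_nonneg)
  ultimately show ?thesis
    using Cauchy_Schwarz[OF f diff_in[OF section_in[OF y(1)] section_in[OF y(2)]]] by simp
qed

text \<open>Takes the place of the Riesz representation theorem: \<open>ip\<close> is arbitrary outside \<open>H\<close>, so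
  \<open>ip_norm ip\<close> need not induce a \<open>Metric_space\<close> and the completeness of \<open>H\<close> cannot be unfolded.
  Suitably scaled near-extremal functions form a minimizing sequence of
  \<open>(ip_norm ip f)\<^sup>2 - 2 Re (L f)\<close>, and hence represent \<open>L\<close> in the limit.\<close>

lemma approximate_representer:
  fixes L :: "('a \<Rightarrow> complex) \<Rightarrow> complex" and C :: real
  assumes L_add: "\<And>f g. f \<in> H \<Longrightarrow> g \<in> H \<Longrightarrow> L (\<lambda>x. f x + g x) = L f + L g"
    and L_scale: "\<And>c f. f \<in> H \<Longrightarrow> L (\<lambda>x. c * f x) = c * L f"
    and bounded: "\<And>f. f \<in> H \<Longrightarrow> cmod (L f) \<le> C * ip_norm ip f"
  defines "S \<equiv> (SUP f\<in>{f\<in>H. ip_norm ip f \<le> 1}. cmod (L f))"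
  obtains g where "\<And>n. g n \<in> H" "\<And>n. ip_norm ip (g n) \<le> S" "0 \<le> S"
    "(\<lambda>n. L (g n)) \<longlonglongrightarrow> of_real (S\<^sup>2)"
    "\<And>y. y \<in> D \<Longrightarrow> (\<lambda>n. g n y) \<longlonglongrightarrow> cnj (L (kernel_section D K y))"
proof -
  let ?B = "{f\<in>H. ip_norm ip f \<le> 1}"
  have zB: "(\<lambda>x. 0) \<in> ?B" using zero_in ip_norm_scale[OF zero_in, of 0] by simp
  have L0: "L (\<lambda>x. 0) = 0" using L_scale[OF zero_in, of 0] by simp
  have bdd: "bdd_above ((\<lambda>f. cmod (L f)) ` ?B)"
  proof (rule bdd_aboveI2)
    fix f assume f: "f \<in> ?B"
    have "cmod (L f) \<le> \<bar>C\<bar> * ip_norm ip f"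
      using bounded[of f] f mult_right_mono[OF abs_ge_self[of C] ip_norm_nonneg[of f]] by simp
    also have "\<dots> \<le> \<bar>C\<bar> * 1" using f by (intro mult_left_mono) auto
    finally show "cmod (L f) \<le> \<bar>C\<bar>" by simp
  qed
  have S0: "0 \<le> S"
    using cSUP_upper[OF zB bdd] L0 unfolding S_def by simp
  have LS: "cmod (L f) \<le> S * ip_norm ip f" if f: "f \<in> H" for f
  proof (cases "ip_norm ip f = 0")
    case True
    then show ?thesis using bounded[OF f] by simp
  next
    case False
    then have pos: "ip_norm ip f > 0" using ip_norm_nonneg[OF f] by simp
    let ?h = "\<lambda>x. of_real (1 / ip_norm ip f) * f x"
    have "?h \<in> ?B" using f pos by (simp add: scale_in ip_norm_scale del: of_real_divide)
    from cSUP_upper[OF this bdd] have "cmod (L ?h) \<le> S" unfolding S_def by simp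
    moreover have "L ?h = of_real (1 / ip_norm ip f) * L f" by (rule L_scale[OF f])
    ultimately have "cmod (L f) / ip_norm ip f \<le> S" using pos by (simp add: norm_mult norm_divide)
    then show ?thesis using pos by (simp add: field_simps)
  qed
  have "\<exists>h\<in>?B. L h = of_real (Re (L h)) \<and> S - 1 / real (Suc n) \<le> Re (L h)" for n
  proof -
    have "S - 1 / real (Suc n) < S" by simp
    then obtain f where f: "f \<in> ?B" "S - 1 / real (Suc n) < cmod (L f)"
      using less_cSUP_iff[OF _ bdd] zB unfolding S_def by blast
    show ?thesis
    proof (cases "L f = 0")
      case True
      then show ?thesis using f by (intro bexI[of _ f]) auto
    next
      case False
      \<comment> \<open>A unimodular factor makes \<open>L f\<close> real and nonnegative and leaves
        the norm unchanged.\<close>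
      let ?c = "cnj (L f) / of_real (cmod (L f))"
      have c: "cmod ?c = 1" using False by (simp add: norm_divide)
      have "L (\<lambda>x. ?c * f x) = ?c * L f" using f by (intro L_scale) auto
      also have "\<dots> = of_real (cmod (L f))"
        using False by (simp add: field_simps complex_norm_square[symmetric] power2_eq_square)
      finally have "L (\<lambda>x. ?c * f x) = of_real (cmod (L f))" .
      moreover have "(\<lambda>x. ?c * f x) \<in> ?B"
        using f c ip_norm_scale[of f ?c] scale_in[of f ?c] by simp
      ultimately show ?thesis using f(2) by (intro bexI[of _ "\<lambda>x. ?c * f x"]) auto
    qed
  qed
  then obtain h where h: "\<And>n. h n \<in> ?B" "\<And>n. L (h n) = of_real (Re (L (h n)))"
    "\<And>n. S - 1 / real (Suc n) \<le> Re (L (h n))"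
    by metis
  define g where "g = (\<lambda>n x. of_real S * h n x)"
  have gH: "g n \<in> H" for n using h(1)[of n] by (simp add: g_def scale_in)
  have gn: "ip_norm ip (g n) \<le> S" for n
    using h(1)[of n] S0 by (simp add: g_def ip_norm_scale mult_left_le)
  have Lg: "L (g n) = of_real (S * Re (L (h n)))" for n
    using h(1)[of n] h(2)[of n] by (simp add: g_def L_scale)
  have eps: "(\<lambda>n. 2 * S / real (Suc n)) \<longlonglongrightarrow> 0"
    by (rule LIMSEQ_Suc, rule lim_const_over_n)
  have up: "Re (L (h n)) \<le> S" for n
    using cSUP_upper[OF h(1)[of n] bdd] complex_Re_le_cmod[of "L (h n)"] unfolding S_def by simp
  have "(\<lambda>n. Re (L (h n))) \<longlonglongrightarrow> S"
  proof (rule tendsto_sandwich)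
    show "\<forall>\<^sub>F n in sequentially. S - 1 / real (Suc n) \<le> Re (L (h n))" using h(3) by simp
    show "\<forall>\<^sub>F n in sequentially. Re (L (h n)) \<le> S" using up by simp
    show "(\<lambda>n. S - 1 / real (Suc n)) \<longlonglongrightarrow> S"
      using tendsto_diff[OF tendsto_const[of S], OF LIMSEQ_Suc[OF lim_const_over_n[of 1]]] by simp
  qed simp
  then have LgS: "(\<lambda>n. L (g n)) \<longlonglongrightarrow> of_real (S\<^sup>2)"
    unfolding Lg power2_eq_square by (intro tendsto_intros)
  have conv: "(\<lambda>n. ip f (g n)) \<longlonglongrightarrow> L f" if f: "f \<in> H" for f
  proof -
    \<comment> \<open>Step size of the perturbation of \<open>g n\<close> below. Because
      \<open>\<tau> * (ip_norm ip f)\<^sup>2 \<le> 1\<close>, the quadratic term is at most half of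
      the linear gain; the summand 1 covers functions of norm 0.\<close>
    define \<tau> where "\<tau> = 1 / (1 + (ip_norm ip f)\<^sup>2)"
    have \<tau>: "\<tau> > 0" "\<tau> * (ip_norm ip f)\<^sup>2 \<le> 1"
      unfolding \<tau>_def by (auto simp: add_pos_nonneg divide_simps)
    have bound: "(cmod (ip f (g n) - L f))\<^sup>2 \<le> 2 * S / real (Suc n) / \<tau>" for n
    proof -
      define z where "z = ip f (g n) - L f"
      define c where "c = - of_real \<tau> * cnj z"
      let ?u = "\<lambda>x. g n x + c * f x"
      have uH: "?u \<in> H" using gH f by (simp add: add_in scale_in)
      \<comment> \<open>Completing the square, together with \<open>LS\<close>, bounds
        \<open>(ip_norm ip u)\<^sup>2 - 2 Re (L u)\<close> below by \<open>- S\<^sup>2\<close> for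
        all u in H. At \<open>g n\<close> this bound is missed by at most
        \<open>2 * S / Suc n\<close>, so adding \<open>c * f\<close> cannot gain more than
        that.\<close>
      have "- (S\<^sup>2) \<le> (ip_norm ip ?u)\<^sup>2 - 2 * (S * ip_norm ip ?u)"
        using zero_le_power2[of "ip_norm ip ?u - S"] by (simp add: power2_diff algebra_simps)
      also have "\<dots> \<le> (ip_norm ip ?u)\<^sup>2 - 2 * Re (L ?u)"
        using LS[OF uH] complex_Re_le_cmod[of "L ?u"] by simp
      also have "(ip_norm ip ?u)\<^sup>2 = (ip_norm ip (g n))\<^sup>2 + 2 * Re (c * ip f (g n)) + (cmod c * ip_norm ip f)\<^sup>2"
        using f gH[of n] by (subst ip_norm_add_sq) (auto simp: scale_in ip_scale ip_norm_scale)
      also have "L ?u = L (g n) + c * L f"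
        using f gH[of n] by (subst L_add) (auto simp: scale_in L_scale)
      also have "(ip_norm ip (g n))\<^sup>2 + 2 * Re (c * ip f (g n)) + (cmod c * ip_norm ip f)\<^sup>2 - 2 * Re (L (g n) + c * L f)
        = (ip_norm ip (g n))\<^sup>2 - 2 * Re (L (g n)) + 2 * Re (c * z) + (cmod c * ip_norm ip f)\<^sup>2"
        unfolding z_def by (simp add: algebra_simps)
      also have "Re (c * z) = - \<tau> * (cmod z)\<^sup>2"
        unfolding c_def cmod_power2 by (simp add: algebra_simps power2_eq_square)
      also have "(cmod c * ip_norm ip f)\<^sup>2 = (\<tau> * (cmod z)\<^sup>2) * (\<tau> * (ip_norm ip f)\<^sup>2)"
        by (simp add: c_def norm_mult power_mult_distrib power2_eq_square)
      also have "\<dots> \<le> (\<tau> * (cmod z)\<^sup>2) * 1" using \<tau> by (intro mult_left_mono) auto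
      also have "(ip_norm ip (g n))\<^sup>2 \<le> S\<^sup>2" using gn[of n] ip_norm_nonneg[OF gH] by (simp add: power_mono)
      also have "Re (L (g n)) = S * Re (L (h n))" unfolding Lg by simp
      finally have "\<tau> * (cmod z)\<^sup>2 \<le> 2 * S\<^sup>2 - 2 * (S * Re (L (h n)))" by simp
      also have "\<dots> \<le> 2 * S\<^sup>2 - 2 * (S * (S - 1 / real (Suc n)))"
        using mult_left_mono[OF h(3)[of n] S0] by linarith
      also have "\<dots> = 2 * S / real (Suc n)" by (simp add: algebra_simps power2_eq_square)
      finally show ?thesis
        using \<tau> unfolding z_def by (subst pos_le_divide_eq) (auto simp: mult.commute)
    qed
    have "(\<lambda>n. 2 * S / real (Suc n) / \<tau>) \<longlonglongrightarrow> 0"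
      using tendsto_divide[OF eps tendsto_const[of \<tau>]] \<tau> by simp
    then have "(\<lambda>n. (cmod (ip f (g n) - L f))\<^sup>2) \<longlonglongrightarrow> 0"
      by (rule tendsto_sandwich[OF _ _ tendsto_const, rotated 2]) (use bound in auto)
    then have "(\<lambda>n. sqrt ((cmod (ip f (g n) - L f))\<^sup>2)) \<longlonglongrightarrow> sqrt 0" by (rule tendsto_real_sqrt)
    then show ?thesis by (simp add: LIM_zero_iff tendsto_norm_zero_iff)
  qed
  have "(\<lambda>n. g n y) \<longlonglongrightarrow> cnj (L (kernel_section D K y))" if y: "y \<in> D" for y
  proof -
    have "g n y = cnj (ip (kernel_section D K y) (g n))" for n
      using reproducing[OF gH y] ip_cnj[OF section_in[OF y] gH] by simp
    then show ?thesis using tendsto_cnj[OF conv[OF section_in[OF y]]] by simp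
  qed
  then show thesis using gH gn S0 LgS by (intro that) auto
qed

end

lemma is_rkhs_kernel_space: "is_rkhs D K H ip \<Longrightarrow> kernel_space D K H ip"
  unfolding is_rkhs_def hilbert_function_space_def kernel_space_def by auto

section \<open>The Korobov kernel\<close>

lemma has_sum_nonzero_int_powr:
  assumes "\<beta> > 1"
  shows "((\<lambda>h. \<bar>real_of_int h\<bar> powr (-\<beta>)) has_sum (2 * zeta \<beta>)) (UNIV - {0})"
proof -
  have "summable (\<lambda>n. real n powr (-\<beta>))"
    using assms by (simp add: summable_real_powr_iff)
  then have "summable (\<lambda>n. 1 / real (Suc n) powr \<beta>)"
    unfolding summable_Suc_iff[symmetric, of "\<lambda>n. real n powr (-\<beta>)"]
    by (simp add: powr_minus divide_inverse)
  then have "(\<lambda>n. 1 / real (Suc n) powr \<beta>) sums zeta \<beta>"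
    unfolding zeta_def by (rule summable_sums)
  then have nat: "((\<lambda>n. 1 / real (Suc n) powr \<beta>) has_sum zeta \<beta>) UNIV"
    by (intro sums_nonneg_imp_has_sum) auto
  have "((\<lambda>h. \<bar>real_of_int h\<bar> powr (-\<beta>)) has_sum zeta \<beta>) (range (\<lambda>n. int (Suc n)))"
    by (subst has_sum_reindex) (use nat in \<open>auto simp: inj_on_def o_def powr_minus divide_inverse add.commute\<close>)
  moreover have "((\<lambda>h. \<bar>real_of_int h\<bar> powr (-\<beta>)) has_sum zeta \<beta>) (range (\<lambda>n. - int (Suc n)))"
    by (subst has_sum_reindex)
       (use nat in \<open>auto simp: inj_on_def o_def powr_minus divide_inverse abs_if add.commute\<close>)
  ultimately have "((\<lambda>h. \<bar>real_of_int h\<bar> powr (-\<beta>)) has_sum (zeta \<beta> + zeta \<beta>))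
      (range (\<lambda>n. int (Suc n)) \<union> range (\<lambda>n. - int (Suc n)))"
    by (intro has_sum_Un_disjoint) auto
  also have "range (\<lambda>n. int (Suc n)) \<union> range (\<lambda>n. - int (Suc n)) = UNIV - {0}"
  proof (intro equalityI subsetI)
    fix h :: int assume h: "h \<in> UNIV - {0}"
    show "h \<in> range (\<lambda>n. int (Suc n)) \<union> range (\<lambda>n. - int (Suc n))"
    proof (cases "h > 0")
      case True
      then have "h = int (Suc (nat h - 1))" by simp
      then show ?thesis by blast
    next
      case False
      then have "h = - int (Suc (nat (-h) - 1))" using h by simp
      then show ?thesis by blast
    qed
  qed auto
  finally show ?thesis by simp
qed

lemma infsum_nonzero_int_powr: "\<beta> > 1 \<Longrightarrow> (\<Sum>\<^sub>\<infinity>h\<in>UNIV - {0}. \<bar>real_of_int h\<bar> powr (-\<beta>)) = 2 * zeta \<beta>"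
  using has_sum_nonzero_int_powr by (rule infsumI)

lemma summable_nonzero_int_powr: "\<beta> > 1 \<Longrightarrow> (\<lambda>h. \<bar>real_of_int h\<bar> powr (-\<beta>)) summable_on (UNIV - {0})"
  using has_sum_nonzero_int_powr by (rule has_sum_imp_summable)

lemma zeta_nonneg: "zeta \<beta> \<ge> 0" if "\<beta> > 1"
  using infsum_nonneg[of "UNIV - {0}" "\<lambda>h. \<bar>real_of_int h\<bar> powr (-\<beta>)"] infsum_nonzero_int_powr[OF that]
  by simp

text \<open>The terms \<open>h = 1\<close> and \<open>h = -1\<close> already contribute 2 to
  \<open>2 * zeta \<beta>\<close>.\<close>

lemma zeta_ge_1: "zeta \<beta> \<ge> 1" if "\<beta> > 1"
proof -
  have "(\<Sum>h\<in>{1,-1}. \<bar>real_of_int h\<bar> powr (-\<beta>)) \<le> (\<Sum>\<^sub>\<infinity>h\<in>UNIV - {0}. \<bar>real_of_int h\<bar> powr (-\<beta>))"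
    by (rule finite_sum_le_infsum) (use summable_nonzero_int_powr[OF that] in auto)
  then show ?thesis using infsum_nonzero_int_powr[OF that] by simp
qed

section \<open>Fourier modes and the one-dimensional kernel\<close>

definition korobov_mode :: "real \<Rightarrow> int \<Rightarrow> real \<Rightarrow> complex" where
  "korobov_mode \<alpha> h t = exp (2 * of_real pi * \<i> * of_real (of_int h * t)) / of_real (\<bar>real_of_int h\<bar> powr \<alpha>)"

text \<open>The one-dimensional kernel of weight g is
  \<open>1 + g * korobov1 \<alpha> (x - y)\<close>. For even \<alpha> this function is, on the unit
  interval, a multiple of a Bernoulli polynomial.\<close>

definition korobov1 :: "real \<Rightarrow> real \<Rightarrow> complex" where
  "korobov1 \<alpha> t = (\<Sum>\<^sub>\<infinity>h\<in>UNIV - {0}. korobov_mode \<alpha> h t)"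

text \<open>True at \<open>h = 0\<close> as well: \<open>0 powr \<alpha>\<close> is 0 and so is the
  quotient by it.\<close>

lemma norm_korobov_mode: "norm (korobov_mode \<alpha> h t) = \<bar>real_of_int h\<bar> powr (-\<alpha>)"
proof -
  have "2 * of_real pi * \<i> * of_real (of_int h * t) = \<i> * of_real (2 * pi * of_int h * t)" by simp
  then have "norm (exp (2 * of_real pi * \<i> * of_real (of_int h * t))) = 1"
    by (metis norm_exp_i_times)
  then show ?thesis
    unfolding korobov_mode_def norm_divide by (simp only:) (simp add: powr_minus divide_inverse)
qed

lemma abs_summable_korobov_mode:
  "\<alpha> > 1 \<Longrightarrow> (\<lambda>h. norm (korobov_mode \<alpha> h t)) summable_on (UNIV - {0})"
  using summable_nonzero_int_powr by (simp add: norm_korobov_mode)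

lemma korobov1_0: "\<alpha> > 1 \<Longrightarrow> korobov1 \<alpha> 0 = of_real (2 * zeta \<alpha>)"
proof -
  assume \<alpha>: "\<alpha> > 1"
  have "((\<lambda>h. complex_of_real (\<bar>real_of_int h\<bar> powr (-\<alpha>))) has_sum of_real (2 * zeta \<alpha>)) (UNIV - {0})"
    using has_sum_nonzero_int_powr[OF \<alpha>] by (subst has_sum_of_real_iff)
  moreover have "korobov_mode \<alpha> h 0 = complex_of_real (\<bar>real_of_int h\<bar> powr (-\<alpha>))" for h
    by (simp add: korobov_mode_def powr_minus divide_inverse)
  ultimately show ?thesis by (simp add: korobov1_def infsumI del: of_real_mult)
qed

lemma exp_2pi_i_int: "exp (2 * of_real pi * \<i> * of_real (of_int k)) = 1"
  using exp_integer_2pi[of "of_int k"] by (simp add: mult_ac)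

lemma korobov_mode_periodic: "korobov_mode \<alpha> h (t + of_int k) = korobov_mode \<alpha> h t"
proof -
  have "2 * of_real pi * \<i> * complex_of_real (of_int h * (t + of_int k)) =
    2 * of_real pi * \<i> * of_real (of_int h * t) + 2 * of_real pi * \<i> * of_real (of_int (h * k))"
    by (simp add: algebra_simps)
  then show ?thesis unfolding korobov_mode_def by (simp only: exp_add exp_2pi_i_int mult_1_right)
qed

lemma korobov1_periodic: "korobov1 \<alpha> (t + of_int k) = korobov1 \<alpha> t"
  by (simp add: korobov1_def korobov_mode_periodic)

lemma cnj_korobov1: "cnj (korobov1 \<alpha> t) = korobov1 \<alpha> (-t)"
  by (simp add: korobov1_def flip: infsum_cnj) (simp add: korobov_mode_def exp_cnj)

text \<open>The Weierstrass test with the convergent majorant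
  \<open>\<bar>h\<bar> powr (-\<alpha>)\<close>. Uniformity serves both the continuity of
  \<open>korobov1\<close> and its integration term by term.\<close>

lemma uniform_limit_korobov:
  assumes "\<alpha> > 1"
  shows "uniform_limit Y (\<lambda>X t. \<Sum>h\<in>X. korobov_mode \<alpha> h t) (korobov1 \<alpha>) (finite_subsets_at_top (UNIV - {0}))"
  unfolding korobov1_def[abs_def]
  by (rule Weierstrass_m_test_general[OF _ summable_nonzero_int_powr[OF assms]])
     (simp add: norm_korobov_mode)

lemma continuous_korobov_mode: "continuous_on A (korobov_mode \<alpha> h)"
  unfolding korobov_mode_def[abs_def] divide_inverse by (intro continuous_intros)

lemma continuous_korobov1: "\<alpha> > 1 \<Longrightarrow> continuous_on A (korobov1 \<alpha>)"
  by (rule uniform_limit_theorem[OF _ uniform_limit_korobov])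
     (auto intro!: continuous_intros continuous_korobov_mode always_eventually)

text \<open>A mode divided by 2 pi i h is an antiderivative of that mode and has period 1, so the
  boundary values cancel.\<close>

lemma korobov_mode_has_integral:
  assumes "h \<noteq> 0"
  shows "((\<lambda>t. korobov_mode \<alpha> h (t - y)) has_integral 0) {0..1}"
proof -
  define c where "c = 2 * of_real pi * \<i> * complex_of_int h"
  have c: "c \<noteq> 0" using assms by (simp add: c_def)
  have mode: "korobov_mode \<alpha> h t = exp (c * of_real t) / of_real (\<bar>real_of_int h\<bar> powr \<alpha>)" for t
    by (simp add: korobov_mode_def c_def mult_ac)
  define F where "F = (\<lambda>t. korobov_mode \<alpha> h (t - y) / c)"
  have "(F has_vector_derivative korobov_mode \<alpha> h (t - y)) (at t within {0..1})" for t
  proof -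
    have "((\<lambda>t. exp (c * (of_real t - of_real y)) / of_real (\<bar>real_of_int h\<bar> powr \<alpha>) / c)
       has_vector_derivative exp (c * (of_real t - of_real y)) / of_real (\<bar>real_of_int h\<bar> powr \<alpha>))
       (at t within {0..1})"
      using c assms by (intro has_vector_derivative_real_field) (auto intro!: derivative_eq_intros)
    then show ?thesis by (simp add: F_def mode)
  qed
  then have "((\<lambda>t. korobov_mode \<alpha> h (t - y)) has_integral F 1 - F 0) {0..1}"
    by (intro fundamental_theorem_of_calculus) auto
  moreover have "F 1 = F 0"
    using korobov_mode_periodic[of \<alpha> h "-y" 1] by (simp add: F_def algebra_simps)
  ultimately show ?thesis by simp
qed

lemma korobov1_has_integral:
  assumes "\<alpha> > 1"
  shows "((\<lambda>t. korobov1 \<alpha> (t - y)) has_integral 0) {0..1}"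
proof -
  let ?F = "finite_subsets_at_top (UNIV - {0::int})"
  have u: "uniform_limit {0..1} (\<lambda>X t. \<Sum>h\<in>X. korobov_mode \<alpha> h (t - y)) (\<lambda>t. korobov1 \<alpha> (t - y)) ?F"
    using uniform_limit_compose'[OF uniform_limit_korobov[OF assms, of UNIV], of "\<lambda>t. t - y" "{0..1}"] by simp
  have cont: "continuous_on {0..1} (\<lambda>t. \<Sum>h\<in>X. korobov_mode \<alpha> h (t - y))" for X
    by (intro continuous_on_sum continuous_on_compose2[OF continuous_korobov_mode[of UNIV]] continuous_intros) auto
  obtain I J where IJ: "\<And>X. ((\<lambda>t. \<Sum>h\<in>X. korobov_mode \<alpha> h (t - y)) has_integral I X) {0..1}"
    "((\<lambda>t. korobov1 \<alpha> (t - y)) has_integral J) {0..1}" "(I \<longlongrightarrow> J) ?F"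
    by (rule uniform_limit_integral[OF u cont finite_subsets_at_top_neq_bot]) (rule that)
  have "I X = 0" if "finite X" "X \<subseteq> UNIV - {0}" for X
  proof (rule has_integral_unique[OF IJ(1)])
    show "((\<lambda>t. \<Sum>h\<in>X. korobov_mode \<alpha> h (t - y)) has_integral 0) {0..1}"
    proof (subst sum.neutral_const[of X, symmetric], rule has_integral_sum)
      show "((\<lambda>t. korobov_mode \<alpha> h (t - y)) has_integral 0) {0..1}" if "h \<in> X" for h
        using that \<open>X \<subseteq> UNIV - {0}\<close> by (intro korobov_mode_has_integral) auto
    qed (fact \<open>finite X\<close>)
  qed
  then have "\<forall>\<^sub>F X in ?F. I X = 0"
    by (intro eventually_finite_subsets_at_top_weakI) auto
  with IJ(3) have "((\<lambda>_. 0) \<longlongrightarrow> J) ?F" by (rule Lim_transform_eventually)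
  then have "J = 0" by (rule tendsto_unique[OF finite_subsets_at_top_neq_bot _ tendsto_const])
  with IJ(2) show ?thesis by simp
qed

section \<open>Product form of the multivariate kernel\<close>

lemma infsum_korobov_modes:
  assumes "\<alpha> > 1" "finite u"
  shows "(\<Sum>\<^sub>\<infinity>h\<in>(\<Pi>\<^sub>E j\<in>u. UNIV - {0::int}).
              exp (2 * of_real pi * \<i> * of_real (\<Sum>j\<in>u. of_int (h j) * t j)) /
              of_real (\<Prod>j\<in>u. \<bar>real_of_int (h j)\<bar> powr \<alpha>)) = (\<Prod>j\<in>u. korobov1 \<alpha> (t j))"
proof -
  have "exp (2 * of_real pi * \<i> * of_real (\<Sum>j\<in>u. of_int (h j) * t j)) /
        of_real (\<Prod>j\<in>u. \<bar>real_of_int (h j)\<bar> powr \<alpha>) = (\<Prod>j\<in>u. korobov_mode \<alpha> (h j) (t j))" for h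
    using assms(2)
    by (simp add: korobov_mode_def prod_dividef of_real_prod of_real_sum sum_distrib_left exp_sum del: of_real_mult)
  then show ?thesis
    using infsum_prod_PiE_abs[OF assms(2), of "\<lambda>j h. korobov_mode \<alpha> h (t j)" "\<lambda>_. UNIV - {0}"]
      abs_summable_korobov_mode[OF assms(1)]
    by (simp add: korobov1_def)
qed

text \<open>Product weights make the sum over subsets the expansion of a product of binomials, with
  the leading 1 as the term of the empty set.\<close>

lemma korobov_kernel_prod:
  assumes "\<alpha> > 1"
  shows "korobov_kernel s \<alpha> (product_weight \<gamma>) x y = (\<Prod>j=1..s. 1 + of_real (\<gamma> j) * korobov1 \<alpha> (x j - y j))"
proof -
  have "of_real (product_weight \<gamma> u) *
           (\<Sum>\<^sub>\<infinity>h\<in>(\<Pi>\<^sub>E j\<in>u. UNIV - {0::int}).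
              exp (2 * of_real pi * \<i> * of_real (\<Sum>j\<in>u. of_int (h j) * (x j - y j))) /
              of_real (\<Prod>j\<in>u. \<bar>real_of_int (h j)\<bar> powr \<alpha>)) =
      (\<Prod>j\<in>u. of_real (\<gamma> j) * korobov1 \<alpha> (x j - y j))" if "u \<in> Pow {1..s}" for u
  proof -
    have u: "finite u" using that by (auto intro: finite_subset)
    show ?thesis
      unfolding infsum_korobov_modes[OF assms u] by (simp add: product_weight_def prod.distrib)
  qed
  then have "korobov_kernel s \<alpha> (product_weight \<gamma>) x y =
    1 + (\<Sum>u\<in>Pow {1..s} - {{}}. \<Prod>j\<in>u. of_real (\<gamma> j) * korobov1 \<alpha> (x j - y j))"
    unfolding korobov_kernel_def by (intro arg_cong2[where f = "(+)"] refl sum.cong) auto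
  also have "\<dots> = (\<Sum>u\<in>Pow {1..s}. \<Prod>j\<in>u. of_real (\<gamma> j) * korobov1 \<alpha> (x j - y j))"
    by (subst sum.remove[of "Pow {1..s}" "{}"]) auto
  also have "\<dots> = (\<Prod>j=1..s. of_real (\<gamma> j) * korobov1 \<alpha> (x j - y j) + 1)"
    by (subst prod_add) auto
  finally show ?thesis by (simp add: add.commute)
qed

section \<open>Integration over the cube\<close>

interpretation lborel_product: product_sigma_finite "\<lambda>_::nat. lborel :: real measure"
  by standard

abbreviation cube_measure :: "nat \<Rightarrow> (nat \<Rightarrow> real) measure" where
  "cube_measure s \<equiv> (\<Pi>\<^sub>M j\<in>{1..s}. lborel)"

lemma sets_unit_cube [measurable]: "unit_cube s \<in> sets (cube_measure s)"
  unfolding unit_cube_def by (rule sets_PiM_I_finite) auto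

lemma emeasure_unit_cube: "emeasure (cube_measure s) (unit_cube s) = 1"
  unfolding unit_cube_def by (subst lborel_product.emeasure_PiM) auto

lemma measure_unit_cube: "measure (cube_measure s) (unit_cube s) = 1"
  by (simp add: measure_def emeasure_unit_cube del: One_nat_def)

lemma cube_integral_prod:
  assumes "\<And>j. j \<in> {1..s} \<Longrightarrow> continuous_on {0..1} (f j)"
  shows "cube_integral s (\<lambda>x. \<Prod>j=1..s. f j (x j)) = (\<Prod>j=1..s. integral {0..1} (f j))"
proof -
  have "cube_integral s (\<lambda>x. \<Prod>j=1..s. f j (x j)) =
    (LINT x|cube_measure s. (\<Prod>j\<in>{1..s}. indicator {0..1} (x j) *\<^sub>R f j (x j)))"
    unfolding cube_integral_def set_lebesgue_integral_def
  proof (rule Bochner_Integration.integral_cong[OF refl])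
    fix x assume "x \<in> space (cube_measure s)"
    then have "x \<in> extensional {1..s}" by (simp add: space_PiM PiE_def)
    \<comment> \<open>\<open>unit_cube\<close> contains extensional functions only, so the indicator
      factorizes only on the space of the product measure.\<close>
    then have "indicator (unit_cube s) x = (\<Prod>j\<in>{1..s}. indicator {0..1::real} (x j) :: real)"
      by (auto simp: indicator_def unit_cube_def PiE_def Pi_def)
    then show "indicator (unit_cube s) x *\<^sub>R (\<Prod>j=1..s. f j (x j)) =
      (\<Prod>j\<in>{1..s}. indicator {0..1} (x j) *\<^sub>R f j (x j))"
      by (simp add: scaleR_conv_of_real prod.distrib)
  qed
  also have "\<dots> = (\<Prod>j\<in>{1..s}. LINT t|lborel. indicator {0..1} t *\<^sub>R f j t)"
    using borel_integrable_atLeastAtMost'[OF assms]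
    by (intro lborel_product.product_integral_prod) (auto simp: set_integrable_def)
  also have "\<dots> = (\<Prod>j=1..s. integral {0..1} (f j))"
  proof (rule prod.cong[OF refl])
    fix j assume j: "j \<in> {1..s}"
    show "(LINT t|lborel. indicator {0..1} t *\<^sub>R f j t) = integral {0..1} (f j)"
      using set_borel_integral_eq_integral(2)[OF borel_integrable_atLeastAtMost'[OF assms[OF j]]]
      by (simp add: set_lebesgue_integral_def)
  qed
  finally show ?thesis .
qed

section \<open>Measurability and integral bounds on the cube\<close>

definition clamp_cube :: "nat \<Rightarrow> (nat \<Rightarrow> real) \<Rightarrow> nat \<Rightarrow> real" where
  "clamp_cube s x = (\<lambda>j\<in>{1..s}. max 0 (min 1 (x j)))"

lemma clamp_cube_in: "clamp_cube s x \<in> unit_cube s"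
  by (auto simp: clamp_cube_def unit_cube_def)

lemma clamp_cube_id: "x \<in> unit_cube s \<Longrightarrow> clamp_cube s x = x"
  by (rule ext) (auto simp: clamp_cube_def unit_cube_def PiE_def Pi_def extensional_def)

text \<open>Composition with \<open>clamp_cube\<close> extends a function to all of \<open>nat \<Rightarrow> real\<close>, where the product
  \<open>\<sigma>\<close>-algebra is known to be the Borel \<open>\<sigma>\<close>-algebra.\<close>

lemma measurable_on_cube:
  fixes f :: "(nat \<Rightarrow> real) \<Rightarrow> complex"
  assumes cont: "continuous_on UNIV (\<lambda>x. f (clamp_cube s x))"
    and zero: "\<And>x. x \<notin> unit_cube s \<Longrightarrow> f x = 0"
  shows "f \<in> borel_measurable (cube_measure s)"
proof -
  have "(\<lambda>x. f (clamp_cube s x)) \<in> borel_measurable borel"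
    by (rule borel_measurable_continuous_onI[OF cont])
  then have g: "(\<lambda>x. f (clamp_cube s x)) \<in> borel_measurable (Pi\<^sub>M UNIV (\<lambda>_::nat. borel :: real measure))"
    by (simp cong: measurable_cong_sets add: sets_PiM_equal_borel)
  have id: "(\<lambda>x. x) \<in> measurable (cube_measure s) (Pi\<^sub>M UNIV (\<lambda>_::nat. borel :: real measure))"
  proof (rule measurable_PiM_single')
    fix i :: nat
    show "(\<lambda>x. x i) \<in> measurable (cube_measure s) (borel :: real measure)"
    proof (cases "i \<in> {1..s}")
      case True
      then show ?thesis using measurable_component_singleton[of i "{1..s}" "\<lambda>_. lborel :: real measure"] by simp
    next
      case False
      \<comment> \<open>Outside the index set every point of the space has the value
        \<open>undefined\<close>, so this coordinate is constant.\<close>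
      have "(\<lambda>x. x i) \<in> measurable (cube_measure s) (borel :: real measure) \<longleftrightarrow>
        (\<lambda>x. undefined) \<in> measurable (cube_measure s) (borel :: real measure)"
        using False by (intro measurable_cong) (auto simp: space_PiM PiE_def extensional_def)
      then show ?thesis by simp
    qed
  qed auto
  have "(\<lambda>x. indicator (unit_cube s) x *\<^sub>R f (clamp_cube s x)) \<in> borel_measurable (cube_measure s)"
    using measurable_compose[OF id g] by measurable
  also have "(\<lambda>x. indicator (unit_cube s) x *\<^sub>R f (clamp_cube s x)) = f"
    using zero by (auto simp: fun_eq_iff indicator_def clamp_cube_id)
  finally show ?thesis .
qed

lemma integrable_on_cube:
  fixes f :: "(nat \<Rightarrow> real) \<Rightarrow> complex"
  assumes "f \<in> borel_measurable (cube_measure s)" "\<And>x. x \<in> unit_cube s \<Longrightarrow> cmod (f x) \<le> C"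
    "\<And>x. x \<notin> unit_cube s \<Longrightarrow> f x = 0"
  shows "integrable (cube_measure s) f"
    by (rule integrableI_bounded_set[of "unit_cube s" _ _ C])
      (use assms in \<open>auto simp: emeasure_unit_cube simp del: One_nat_def\<close>)

lemma cube_integral_eq:
  assumes "\<And>x. x \<notin> unit_cube s \<Longrightarrow> f x = 0"
  shows "cube_integral s f = integral\<^sup>L (cube_measure s) f"
  unfolding cube_integral_def set_lebesgue_integral_def
  by (rule Bochner_Integration.integral_cong) (auto simp: indicator_def assms)

lemma norm_cube_integral_le:
  fixes f :: "(nat \<Rightarrow> real) \<Rightarrow> complex"
  assumes f: "f \<in> borel_measurable (cube_measure s)" "\<And>x. x \<in> unit_cube s \<Longrightarrow> cmod (f x) \<le> C"
    "\<And>x. x \<notin> unit_cube s \<Longrightarrow> f x = 0"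
  shows "cmod (cube_integral s f) \<le> C"
proof -
  have "cmod (cube_integral s f) \<le> (LINT x|cube_measure s. cmod (f x))"
    using integral_norm_bound[of "cube_measure s" f] cube_integral_eq[of s f] f(3) by metis
  also have "\<dots> \<le> (LINT x|cube_measure s. indicator (unit_cube s) x * C)"
    using integrable_on_cube[of f s C] f
    by (intro integral_mono integrable_norm integrable_mult_left integrable_real_indicator)
       (auto simp: indicator_def emeasure_unit_cube simp del: One_nat_def)
  also have "\<dots> = C" by (simp add: measure_unit_cube del: One_nat_def)
  finally show ?thesis .
qed

section \<open>Worst-case errors in Korobov spaces\<close>

locale korobov_space =
  fixes s :: nat and \<alpha> :: real and \<gamma> :: "nat \<Rightarrow> real"
    and H :: "((nat \<Rightarrow> real) \<Rightarrow> complex) set"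
    and ip :: "((nat \<Rightarrow> real) \<Rightarrow> complex) \<Rightarrow> ((nat \<Rightarrow> real) \<Rightarrow> complex) \<Rightarrow> complex"
  assumes \<alpha>: "\<alpha> > 1"
    and rkhs: "is_rkhs (unit_cube s) (korobov_kernel s \<alpha> (product_weight \<gamma>)) H ip"
begin

sublocale kernel_space "unit_cube s" "korobov_kernel s \<alpha> (product_weight \<gamma>)" H ip
  by (rule is_rkhs_kernel_space[OF rkhs])

abbreviation K :: "(nat \<Rightarrow> real) \<Rightarrow> (nat \<Rightarrow> real) \<Rightarrow> complex" where
  "K \<equiv> korobov_kernel s \<alpha> (product_weight \<gamma>)"

lemma K_diag: "K x x = (\<Prod>j=1..s. 1 + of_real (\<gamma> j) * of_real (2 * zeta \<alpha>))"
  by (simp add: korobov_kernel_prod[OF \<alpha>] korobov1_0[OF \<alpha>])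

lemma cnj_K: "cnj (K x y) = K y x"
  by (simp add: korobov_kernel_prod[OF \<alpha>] cnj_prod cnj_korobov1)

text \<open>Norm of every point evaluation: the kernel depends on \<open>x - y\<close> only, so its
  diagonal is constant and one constant bounds all functions of norm 1 uniformly on the
  cube.\<close>

definition bound_const :: real where
  "bound_const = sqrt (Re (\<Prod>j=1..s. 1 + of_real (\<gamma> j) * of_real (2 * zeta \<alpha>)))"

lemma norm_point_le:
  assumes "f \<in> H" "x \<in> unit_cube s" shows "cmod (f x) \<le> bound_const * ip_norm ip f"
  using point_bound[OF assms] unfolding K_diag bound_const_def by (simp add: mult.commute)

text \<open>\<open>sqrt\<close> is negative at negative arguments, so the product must be shown to
  be nonnegative; it is the squared norm of a kernel section.\<close>

lemma bound_const_nonneg: "bound_const \<ge> 0"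
proof -
  have "K x x = ip (kernel_section (unit_cube s) K x) (kernel_section (unit_cube s) K x)" if "x \<in> unit_cube s" for x
    using reproducing[OF section_in[OF that] that] that by (simp add: kernel_section_def)
  then have "0 \<le> Re (K (clamp_cube s x) (clamp_cube s x))" for x
    using ip_nonneg[OF section_in[OF clamp_cube_in]] clamp_cube_in by simp
  then show ?thesis unfolding bound_const_def K_diag by simp
qed

text \<open>The increment of f between clamped points is at most its norm times the kernel distance
  of these points. That distance is continuous in the product topology and vanishes at y.\<close>

lemma continuous_clamped:
  assumes f: "f \<in> H"
  shows "continuous_on UNIV (\<lambda>x. f (clamp_cube s x))"
proof -
  let ?c = "clamp_cube s"
  have "((\<lambda>x. f (?c x)) \<longlongrightarrow> f (?c y)) (at y)" for y
  proof -
    define \<phi> where "\<phi> = (\<lambda>x. K (?c x) (?c x) - K (?c x) (?c y) - K (?c y) (?c x) + K (?c y) (?c y))"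
    have coord: "continuous_on UNIV (\<lambda>x::nat \<Rightarrow> real. max 0 (min 1 (x j)))" for j
      by (intro continuous_intros continuous_on_product_coordinates)
    have "continuous_on UNIV \<phi>"
      unfolding \<phi>_def K_diag unfolding korobov_kernel_prod[OF \<alpha>] clamp_cube_def
      by (intro continuous_intros continuous_on_compose2[OF continuous_korobov1[OF \<alpha>, of UNIV]])
         (auto intro!: continuous_intros coord)
    then have "(\<phi> \<longlongrightarrow> \<phi> y) (at y)" by (simp add: continuous_on_def)
    moreover have "\<phi> y = 0" by (simp add: \<phi>_def)
    ultimately have "((\<lambda>x. ip_norm ip f * sqrt (Re (\<phi> x))) \<longlongrightarrow> ip_norm ip f * sqrt (Re 0)) (at y)"
      by (intro tendsto_intros) simp
    then have "((\<lambda>x. ip_norm ip f * sqrt (Re (\<phi> x))) \<longlongrightarrow> 0) (at y)" by simp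
    moreover have "\<forall>\<^sub>F x in at y. cmod (f (?c x) - f (?c y)) \<le> ip_norm ip f * sqrt (Re (\<phi> x))"
      unfolding \<phi>_def by (intro always_eventually allI point_diff_bound f clamp_cube_in)
    ultimately have "((\<lambda>x. f (?c x) - f (?c y)) \<longlongrightarrow> 0) (at y)"
      by (rule Lim_null_comparison[rotated])
    then show ?thesis by (rule LIM_zero_cancel)
  qed
  then show ?thesis by (simp add: continuous_on_def)
qed

lemma measurable_H: "f \<in> H \<Longrightarrow> f \<in> borel_measurable (cube_measure s)"
  using measurable_on_cube[of f s] continuous_clamped[of f] vanishes[of f] by blast

lemma integrable_H: "f \<in> H \<Longrightarrow> integrable (cube_measure s) f"
  using integrable_on_cube[of f s "bound_const * ip_norm ip f"] measurable_H[of f] norm_point_le[of f]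
    vanishes[of f] by blast

lemma cube_integral_H: "f \<in> H \<Longrightarrow> cube_integral s f = integral\<^sup>L (cube_measure s) f"
  using vanishes by (intro cube_integral_eq)

text \<open>The integral factorizes over the coordinates, and each factor has mean 1 because all
  nonconstant modes integrate to 0.\<close>

lemma cube_integral_section:
  assumes "y \<in> unit_cube s"
  shows "cube_integral s (kernel_section (unit_cube s) K y) = 1"
proof -
  have "cube_integral s (kernel_section (unit_cube s) K y) =
     cube_integral s (\<lambda>x. \<Prod>j=1..s. 1 + of_real (\<gamma> j) * korobov1 \<alpha> (x j - y j))"
    unfolding cube_integral_def set_lebesgue_integral_def kernel_section_def korobov_kernel_prod[OF \<alpha>]
    by (rule Bochner_Integration.integral_cong) (auto simp: indicator_def)
  also have "\<dots> = (\<Prod>j=1..s. integral {0..1} (\<lambda>t. 1 + of_real (\<gamma> j) * korobov1 \<alpha> (t - y j)))"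
    by (intro cube_integral_prod continuous_intros continuous_on_compose2[OF continuous_korobov1[OF \<alpha>, of UNIV]]) auto
  also have "\<dots> = (\<Prod>j=1..s. 1)"
  proof (intro prod.cong refl integral_unique)
    fix j
    have "((\<lambda>t. 1 + of_real (\<gamma> j) * korobov1 \<alpha> (t - y j)) has_integral
       measure lborel {0..1::real} *\<^sub>R 1 + of_real (\<gamma> j) * 0) {0..1}"
      by (intro has_integral_add has_integral_mult_right korobov1_has_integral[OF \<alpha>] has_integral_const_real)
    then show "((\<lambda>t. 1 + of_real (\<gamma> j) * korobov1 \<alpha> (t - y j)) has_integral 1) {0..1}" by simp
  qed
  finally show ?thesis by simp
qed

text \<open>The approximate representers \<open>g n\<close> of the error functional L converge
  pointwise on the cube to \<open>r\<close>, the conjugate of L on the kernel sections. By dominated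
  convergence \<open>L (g n)\<close> tends to L applied to \<open>r\<close>; it also tends to the
  squared supremum, which is thereby computed. Leaving \<open>q * size P\<close> uncancelled covers
  the empty multiset, where q is 0.\<close>

lemma worst_case_error_formula:
  assumes P: "set_mset P \<subseteq> unit_cube s"
  defines "q \<equiv> 1 / of_nat (size P) :: complex"
  shows "of_real ((worst_case_error s H ip P)\<^sup>2) =
      1 - 2 * q * of_nat (size P) + q\<^sup>2 * (\<Sum>y\<in>#P. \<Sum>x\<in>#P. K y x)"
    and "0 \<le> worst_case_error s H ip P"
proof -
  define L where "L = (\<lambda>f. cube_integral s f - q * (\<Sum>x\<in>#P. f x))"
  have L_add: "L (\<lambda>x. f x + g x) = L f + L g" if "f \<in> H" "g \<in> H" for f g
    using that integrable_H
    by (simp add: L_def cube_integral_H add_in sum_mset.distrib algebra_simps)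
  have L_scale: "L (\<lambda>x. c * f x) = c * L f" if "f \<in> H" for c f
    using that by (simp add: L_def cube_integral_H scale_in sum_mset_distrib_left[symmetric] algebra_simps)
  have "cmod (\<Sum>x\<in>#P. f x) \<le> of_nat (size P) * (bound_const * ip_norm ip f)" if f: "f \<in> H" for f
    using P
  proof (induction P)
    case (add a P)
    then show ?case
      using norm_triangle_ineq[of "f a" "\<Sum>x\<in>#P. f x"] norm_point_le[OF f, of a] by (simp add: algebra_simps)
  qed simp
  then have sum_bound: "cmod (q * (\<Sum>x\<in>#P. f x)) \<le> cmod q * (of_nat (size P) * (bound_const * ip_norm ip f))"
    if "f \<in> H" for f
    using that by (simp add: norm_mult mult_left_mono)
  have L_bound: "cmod (L f) \<le> (bound_const + cmod q * (of_nat (size P) * bound_const)) * ip_norm ip f"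
    if f: "f \<in> H" for f
  proof -
    have "cmod (cube_integral s f) \<le> bound_const * ip_norm ip f"
      using measurable_H[OF f] norm_point_le[OF f] vanishes[OF f] by (rule norm_cube_integral_le)
    then show ?thesis
      using norm_triangle_ineq4[of "cube_integral s f" "q * (\<Sum>x\<in>#P. f x)"] sum_bound[OF f]
      unfolding L_def by (simp add: algebra_simps)
  qed
  define S where "S = worst_case_error s H ip P"
  have S: "S = (SUP f\<in>{f\<in>H. ip_norm ip f \<le> 1}. cmod (L f))"
    unfolding S_def worst_case_error_def L_def q_def by simp
  obtain g where g: "\<And>n. g n \<in> H" "\<And>n. ip_norm ip (g n) \<le> S" "0 \<le> S"
    "(\<lambda>n. L (g n)) \<longlonglongrightarrow> of_real (S\<^sup>2)"
    "\<And>y. y \<in> unit_cube s \<Longrightarrow> (\<lambda>n. g n y) \<longlonglongrightarrow> cnj (L (kernel_section (unit_cube s) K y))"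
    using approximate_representer[OF L_add L_scale L_bound] unfolding S[symmetric] by metis
  define r where "r = (\<lambda>y. 1 - cnj q * (\<Sum>x\<in>#P. K y x))"
  have cnj_sum: "cnj (\<Sum>x\<in>#M. f x) = (\<Sum>x\<in>#M. cnj (f x))" for M and f :: "(nat \<Rightarrow> real) \<Rightarrow> complex"
    by (induction M) auto
  have r: "(\<lambda>n. g n y) \<longlonglongrightarrow> r y" if y: "y \<in> unit_cube s" for y
  proof -
    have "(\<Sum>x\<in>#P. kernel_section (unit_cube s) K y x) = (\<Sum>x\<in>#P. K x y)"
      using P by (intro arg_cong[where f = sum_mset] image_mset_cong) (auto simp: kernel_section_def)
    then have "L (kernel_section (unit_cube s) K y) = 1 - q * (\<Sum>x\<in>#P. K x y)"
      using cube_integral_section[OF y] by (simp add: L_def)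
    then show ?thesis using g(5)[OF y] by (simp add: r_def cnj_sum cnj_K)
  qed
  \<comment> \<open>All \<open>g n\<close> have norm at most S, so \<open>bound_const * S\<close>
    dominates them on the cube, which has measure 1.\<close>
  have limI: "(\<lambda>n. cube_integral s (g n)) \<longlonglongrightarrow> (LINT y|cube_measure s. indicator (unit_cube s) y *\<^sub>R r y)"
    unfolding cube_integral_H[OF g(1)]
  proof (rule integral_dominated_convergence[where w = "\<lambda>y. indicator (unit_cube s) y * (bound_const * S)"])
    show "integrable (cube_measure s) (\<lambda>y. indicator (unit_cube s) y * (bound_const * S))"
      by (simp add: integrable_real_indicator emeasure_unit_cube del: One_nat_def)
    have lim: "(\<lambda>n. g n y) \<longlonglongrightarrow> indicator (unit_cube s) y *\<^sub>R r y" for y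
      using r[of y] vanishes[OF g(1), of y] by (cases "y \<in> unit_cube s") auto
    then show "AE y in cube_measure s. (\<lambda>n. g n y) \<longlonglongrightarrow> indicator (unit_cube s) y *\<^sub>R r y" by simp
    show "(\<lambda>y. indicator (unit_cube s) y *\<^sub>R r y) \<in> borel_measurable (cube_measure s)"
      by (rule borel_measurable_LIMSEQ_metric[OF measurable_H[OF g(1)] lim])
    show "AE y in cube_measure s. cmod (g n y) \<le> indicator (unit_cube s) y * (bound_const * S)" for n
    proof (intro AE_I2)
      fix y
      show "cmod (g n y) \<le> indicator (unit_cube s) y * (bound_const * S)"
        using norm_point_le[OF g(1), of y n] mult_left_mono[OF g(2)[of n] bound_const_nonneg] vanishes[OF g(1), of y n]
        by (cases "y \<in> unit_cube s") auto
    qed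
  qed (rule measurable_H[OF g(1)])
  have one: "(LINT y|cube_measure s. indicator (unit_cube s) y *\<^sub>R (1::complex)) = 1"
    by (simp add: scaleR_conv_of_real measure_unit_cube emeasure_unit_cube integrable_real_indicator del: One_nat_def)
  have integrable_one: "integrable (cube_measure s) (\<lambda>y. indicator (unit_cube s) y *\<^sub>R (1::complex))"
    by (intro integrable_scaleR_left integrable_real_indicator sets_unit_cube)
       (simp add: emeasure_unit_cube del: One_nat_def)
  have sections: "integrable (cube_measure s) (\<lambda>y. \<Sum>x\<in>#M. kernel_section (unit_cube s) K x y) \<and>
     (LINT y|cube_measure s. (\<Sum>x\<in>#M. kernel_section (unit_cube s) K x y)) = of_nat (size M)"
    if "set_mset M \<subseteq> unit_cube s" for M
    using that
  proof (induction M)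
    case (add a M)
    have "integrable (cube_measure s) (kernel_section (unit_cube s) K a)"
      "(LINT y|cube_measure s. kernel_section (unit_cube s) K a y) = 1"
      using add.prems integrable_H[OF section_in] cube_integral_H[OF section_in] cube_integral_section by auto
    then show ?case using add by simp
  qed simp
  have "(LINT y|cube_measure s. indicator (unit_cube s) y *\<^sub>R r y) =
    (LINT y|cube_measure s. indicator (unit_cube s) y *\<^sub>R (1::complex) - cnj q * (\<Sum>x\<in>#P. kernel_section (unit_cube s) K x y))"
    by (rule Bochner_Integration.integral_cong[OF refl]) (auto simp: r_def kernel_section_def indicator_def)
  also have "\<dots> = 1 - q * of_nat (size P)"
    using sections[OF P] one integrable_one by (subst Bochner_Integration.integral_diff) (auto simp: q_def)
  finally have int_r: "(LINT y|cube_measure s. indicator (unit_cube s) y *\<^sub>R r y) = 1 - q * of_nat (size P)" .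
  have "(\<lambda>n. \<Sum>y\<in>#M. g n y) \<longlonglongrightarrow> (\<Sum>y\<in>#M. r y)" if "set_mset M \<subseteq> unit_cube s" for M
    using that by (induction M) (auto intro!: tendsto_add r)
  then have "(\<lambda>n. L (g n)) \<longlonglongrightarrow> (1 - q * of_nat (size P)) - q * (\<Sum>y\<in>#P. r y)"
    unfolding L_def using limI P unfolding int_r by (intro tendsto_intros) auto
  then have "of_real (S\<^sup>2) = (1 - q * of_nat (size P)) - q * (\<Sum>y\<in>#P. r y)"
    using g(4) LIMSEQ_unique by blast
  also have "(\<Sum>y\<in>#P. r y) = of_nat (size P) - q * (\<Sum>y\<in>#P. \<Sum>x\<in>#P. K y x)"
  proof -
    have "(\<Sum>y\<in>#M. r y) = of_nat (size M) - q * (\<Sum>y\<in>#M. \<Sum>x\<in>#P. K y x)" for M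
      by (induction M) (auto simp: r_def q_def algebra_simps)
    then show ?thesis .
  qed
  finally show "of_real ((worst_case_error s H ip P)\<^sup>2) =
      1 - 2 * q * of_nat (size P) + q\<^sup>2 * (\<Sum>y\<in>#P. \<Sum>x\<in>#P. K y x)"
    unfolding S_def[symmetric] by (simp add: algebra_simps power2_eq_square)
  show "0 \<le> worst_case_error s H ip P" using g(3) unfolding S_def .
qed

text \<open>The initial error is the error of the empty multiset, since \<open>1 / 0 = 0\<close>
  removes the average.\<close>

lemma initial_error_eq_1: "initial_error s H ip = 1"
proof -
  have "initial_error s H ip = worst_case_error s H ip {#}"
    by (simp add: initial_error_def worst_case_error_def)
  moreover have "complex_of_real ((worst_case_error s H ip {#})\<^sup>2) = 1"
    using worst_case_error_formula(1)[of "{#}"] by simp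
  ultimately show ?thesis
    using worst_case_error_formula(2)[of "{#}"] by (simp add: power2_eq_1_iff flip: of_real_power)
qed

end

section \<open>Lattice sums by residue class\<close>

text \<open>On the unit interval \<open>t \<le> t powr q\<close>; this is applied to the fractions
  of \<open>x + y\<close> taken by x and y.\<close>

lemma powr_add_le:
  fixes x y :: real
  assumes "0 \<le> x" "0 \<le> y" "0 < q" "q \<le> 1"
  shows "(x + y) powr q \<le> x powr q + y powr q"
proof (cases "x + y = 0")
  case True
  then show ?thesis by simp
next
  case False
  have part: "t / (x + y) * (x + y) powr q \<le> t powr q" if "0 \<le> t" "t \<le> x + y" for t
  proof -
    have "t / (x + y) \<le> (t / (x + y)) powr q"
    proof (cases "t = 0")
      case False
      then have "(t / (x + y)) powr 1 \<le> (t / (x + y)) powr q"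
        using that assms by (intro powr_mono') (auto simp: divide_simps)
      then show ?thesis using that False by simp
    qed simp
    then have "t / (x + y) * (x + y) powr q \<le> (t / (x + y)) powr q * (x + y) powr q"
      by (intro mult_right_mono) auto
    also have "\<dots> = t powr q"
      using that assms False by (simp add: powr_divide)
    finally show ?thesis .
  qed
  have "(x + y) powr q = x / (x + y) * (x + y) powr q + y / (x + y) * (x + y) powr q"
    using False by (simp add: distrib_right[symmetric] add_divide_distrib[symmetric])
  also have "\<dots> \<le> x powr q + y powr q"
    using assms by (intro add_mono part) auto
  finally show ?thesis .
qed

lemma powr_sum_le:
  fixes a :: "'a \<Rightarrow> real"
  assumes "finite X" "\<And>x. x \<in> X \<Longrightarrow> 0 \<le> a x" "0 < q" "q \<le> 1"
  shows "(\<Sum>x\<in>X. a x) powr q \<le> (\<Sum>x\<in>X. a x powr q)"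
  using assms(1,2)
proof (induction X rule: finite_induct)
  case (insert x X)
  have "(a x + (\<Sum>x\<in>X. a x)) powr q \<le> a x powr q + (\<Sum>x\<in>X. a x) powr q"
    using insert assms by (intro powr_add_le sum_nonneg) auto
  then show ?case using insert by simp
qed simp

text \<open>Jensen's inequality for series. The finite version is inverted by the exponent
  \<open>1 / q\<close>, because in that form it bounds all partial sums and passes to the infinite
  sum.\<close>

lemma powr_infsum_le:
  fixes a :: "'a \<Rightarrow> real"
  assumes "a summable_on X" "(\<lambda>x. a x powr q) summable_on X" "\<And>x. x \<in> X \<Longrightarrow> 0 \<le> a x" "0 < q" "q \<le> 1"
  shows "(\<Sum>\<^sub>\<infinity>x\<in>X. a x) powr q \<le> (\<Sum>\<^sub>\<infinity>x\<in>X. a x powr q)"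
proof -
  let ?R = "\<Sum>\<^sub>\<infinity>x\<in>X. a x powr q"
  have "(\<Sum>\<^sub>\<infinity>x\<in>X. a x) \<le> ?R powr (1 / q)"
  proof (rule infsum_le_finite_sums[OF assms(1)])
    fix F assume F: "finite F" "F \<subseteq> X"
    then have pos: "0 \<le> (\<Sum>x\<in>F. a x)" using assms by (intro sum_nonneg) auto
    have "(\<Sum>x\<in>F. a x) powr q \<le> (\<Sum>x\<in>F. a x powr q)"
      using F assms by (intro powr_sum_le) auto
    also have "\<dots> \<le> ?R"
      using F assms by (intro finite_sum_le_infsum) auto
    finally have "((\<Sum>x\<in>F. a x) powr q) powr (1 / q) \<le> ?R powr (1 / q)"
      using assms by (intro powr_mono2) auto
    then show "(\<Sum>x\<in>F. a x) \<le> ?R powr (1 / q)"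
      using pos assms by (simp add: powr_powr)
  qed
  then have "(\<Sum>\<^sub>\<infinity>x\<in>X. a x) powr q \<le> (?R powr (1 / q)) powr q"
    using assms by (intro powr_mono2 infsum_nonneg) auto
  also have "\<dots> = ?R" using assms by (simp add: powr_powr infsum_nonneg)
  finally show ?thesis .
qed

text \<open>Functions on the residue classes modulo N, kept on \<open>int\<close> so that arguments
  such as \<open>c - h * v\<close> need no reduction.\<close>

definition periodic_mod :: "int \<Rightarrow> (int \<Rightarrow> 'a) \<Rightarrow> bool" where
  "periodic_mod N f \<longleftrightarrow> (\<forall>c. f (c mod N) = f c)"

lemma periodic_modD: "periodic_mod N f \<Longrightarrow> c mod N = d mod N \<Longrightarrow> f c = f d"
  unfolding periodic_mod_def by metis

lemma periodic_mod_bounded: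
  fixes f :: "int \<Rightarrow> real"
  assumes "periodic_mod N f" "N > 0"
  obtains B where "B \<ge> 0" "\<And>c. \<bar>f c\<bar> \<le> B"
proof (rule that)
  show "0 \<le> (\<Sum>c\<in>{0..<N}. \<bar>f c\<bar>)" by (intro sum_nonneg) auto
  show "\<bar>f c\<bar> \<le> (\<Sum>c\<in>{0..<N}. \<bar>f c\<bar>)" for c
    using member_le_sum[of "c mod N" "{0..<N}" "\<lambda>c. \<bar>f c\<bar>"] assms by (simp add: periodic_mod_def)
qed

lemma has_sum_sum_finite:
  fixes f :: "'i \<Rightarrow> 'a \<Rightarrow> 'b::topological_comm_monoid_add"
  assumes "finite I" "\<And>i. i \<in> I \<Longrightarrow> (f i has_sum S i) A"
  shows "((\<lambda>x. \<Sum>i\<in>I. f i x) has_sum (\<Sum>i\<in>I. S i)) A"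
  using assms by (induction I rule: finite_induct) (auto intro: has_sum_add)

lemma summable_periodic:
  fixes f :: "int \<Rightarrow> real"
  assumes "periodic_mod N f" "N > 0" "\<beta> > 1"
  shows "(\<lambda>h. \<bar>real_of_int h\<bar> powr (-\<beta>) * f (g h)) summable_on (UNIV - {0})"
proof -
  obtain B where B: "B \<ge> 0" "\<And>c. \<bar>f c\<bar> \<le> B" using periodic_mod_bounded[OF assms(1,2)] by blast
  have "(\<lambda>h. B * \<bar>real_of_int h\<bar> powr (-\<beta>)) summable_on (UNIV - {0})"
    using summable_nonzero_int_powr[OF assms(3)] by (rule summable_on_cmult_right)
  then have "(\<lambda>h. norm (\<bar>real_of_int h\<bar> powr (-\<beta>) * f (g h))) summable_on (UNIV - {0})"
    using B by (rule_tac Infinite_Sum.abs_summable_on_comparison_test'[rotated])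
      (auto simp: abs_mult mult.commute intro!: mult_right_mono)
  then show ?thesis by (rule Infinite_Sum.abs_summable_summable)
qed

lemma sum_periodic_shift:
  fixes f :: "int \<Rightarrow> 'a::comm_monoid_add"
  assumes "periodic_mod N f" "N > 0"
  shows "(\<Sum>c\<in>{0..<N}. f (c - a)) = (\<Sum>c\<in>{0..<N}. f c)"
proof (rule sum.reindex_bij_witness[of _ "\<lambda>c. (c + a) mod N" "\<lambda>c. (c - a) mod N"])
  fix c assume "c \<in> {0..<N}"
  then show "((c - a) mod N + a) mod N = c" "((c + a) mod N - a) mod N = c"
    by (simp_all add: mod_simps)
  show "f ((c - a) mod N) = f (c - a)" using assms(1) by (simp add: periodic_mod_def)
qed (use assms in auto)

text \<open>Convolution, on the residue classes, of f with the image of the weights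
  \<open>\<bar>h\<bar> powr (-\<alpha>)\<close> under \<open>h \<mapsto> h * v\<close>. A new
  coordinate h with generator component v takes \<open>h * v\<close> from the class c and leaves the
  rest to f.\<close>

definition shifted_sum :: "real \<Rightarrow> (int \<Rightarrow> real) \<Rightarrow> int \<Rightarrow> int \<Rightarrow> real" where
  "shifted_sum \<alpha> f v c = (\<Sum>\<^sub>\<infinity>h\<in>UNIV - {0}. \<bar>real_of_int h\<bar> powr (-\<alpha>) * f (c - h * v))"

text \<open>\<open>lattice_sum N \<alpha> \<gamma> z d c\<close> is the sum of \<open>\<Prod>j\<le>d. r\<^sub>j(h\<^sub>j)\<close> over all \<open>h \<in> \<int>\<^sup>d\<close> with
  \<open>h \<cdot> z \<equiv> c\<close> modulo \<open>N\<close>, where \<open>r\<^sub>j(0) = 1\<close> and \<open>r\<^sub>j(h) = \<gamma>\<^sub>j |h|\<^sup>-\<^sup>\<alpha>\<close> otherwise; the class \<open>c = 0\<close>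
  gives the squared error plus 1.\<close>

primrec lattice_sum :: "int \<Rightarrow> real \<Rightarrow> (nat \<Rightarrow> real) \<Rightarrow> (nat \<Rightarrow> int) \<Rightarrow> nat \<Rightarrow> int \<Rightarrow> real" where
  "lattice_sum N \<alpha> \<gamma> z 0 = (\<lambda>c. of_bool (N dvd c))"
| "lattice_sum N \<alpha> \<gamma> z (Suc d) =
    (\<lambda>c. lattice_sum N \<alpha> \<gamma> z d c + \<gamma> (Suc d) * shifted_sum \<alpha> (lattice_sum N \<alpha> \<gamma> z d) (z (Suc d)) c)"

lemma periodic_shifted_sum:
  assumes "periodic_mod N f"
  shows "periodic_mod N (shifted_sum \<alpha> f v)"
  unfolding periodic_mod_def shifted_sum_def
  by (intro allI infsum_cong arg_cong2[where f = "(*)"] refl periodic_modD[OF assms]) (simp add: mod_simps)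

lemma periodic_lattice_sum: "periodic_mod N (lattice_sum N \<alpha> \<gamma> z d)"
proof (induction d)
  case 0
  show ?case by (simp add: periodic_mod_def dvd_mod_iff)
next
  case (Suc d)
  then show ?case using periodic_shifted_sum[OF Suc] by (simp add: periodic_mod_def)
qed

lemma shifted_sum_nonneg: "(\<And>c. 0 \<le> f c) \<Longrightarrow> 0 \<le> shifted_sum \<alpha> f v c"
  unfolding shifted_sum_def by (intro infsum_nonneg mult_nonneg_nonneg) auto

lemma lattice_sum_nonneg:
  assumes "\<And>j. j \<in> {1..d} \<Longrightarrow> 0 \<le> \<gamma> j"
  shows "0 \<le> lattice_sum N \<alpha> \<gamma> z d c"
  using assms by (induction d arbitrary: c) (auto intro!: add_nonneg_nonneg mult_nonneg_nonneg shifted_sum_nonneg)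

lemma lattice_sum_cong:
  "(\<And>j. j \<in> {1..d} \<Longrightarrow> z j = z' j) \<Longrightarrow> lattice_sum N \<alpha> \<gamma> z d = lattice_sum N \<alpha> \<gamma> z' d"
  by (induction d) auto

lemma shifted_sum_powr_le:
  assumes f: "periodic_mod N f" "N > 0" "\<And>c. 0 \<le> f c" and q: "0 < q" "q \<le> 1" "\<alpha> * q > 1"
  shows "shifted_sum \<alpha> f v c powr q \<le> shifted_sum (\<alpha> * q) (\<lambda>c. f c powr q) v c"
proof -
  have fl: "periodic_mod N (\<lambda>c. f c powr q)" using f(1) by (simp add: periodic_mod_def)
  have "\<alpha> > 1" using q
    by (smt (verit) mult_left_le mult_nonneg_nonneg mult_nonpos_nonneg)
  have eq: "(\<bar>real_of_int h\<bar> powr (-\<alpha>) * f (c - h * v)) powr q =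
     \<bar>real_of_int h\<bar> powr (-(\<alpha> * q)) * f (c - h * v) powr q" for h
    using f(3) by (simp add: powr_mult powr_powr)
  show ?thesis
    unfolding shifted_sum_def eq[symmetric]
    by (rule powr_infsum_le)
       (use summable_periodic[OF f(1,2) \<open>\<alpha> > 1\<close>] summable_periodic[OF fl f(2) q(3)] f(3) q
        in \<open>auto simp: eq\<close>)
qed

text \<open>The total mass of a convolution is the product of the total masses; in particular v
  drops out.\<close>

lemma sum_shifted_sum:
  assumes "periodic_mod N f" "N > 0" "\<beta> > 1"
  shows "(\<Sum>c\<in>{0..<N}. shifted_sum \<beta> f v c) = 2 * zeta \<beta> * (\<Sum>c\<in>{0..<N}. f c)"
proof -
  have "((\<lambda>h. \<Sum>c\<in>{0..<N}. \<bar>real_of_int h\<bar> powr (-\<beta>) * f (c - h * v)) has_sum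
      (\<Sum>c\<in>{0..<N}. shifted_sum \<beta> f v c)) (UNIV - {0})"
    unfolding shifted_sum_def
    by (intro has_sum_sum_finite has_sum_infsum summable_periodic[OF assms]) auto
  also have "(\<lambda>h. \<Sum>c\<in>{0..<N}. \<bar>real_of_int h\<bar> powr (-\<beta>) * f (c - h * v)) =
    (\<lambda>h. \<bar>real_of_int h\<bar> powr (-\<beta>) * (\<Sum>c\<in>{0..<N}. f c))"
    using sum_periodic_shift[OF assms(1,2)] by (simp flip: sum_distrib_left)
  finally have "((\<lambda>h. \<bar>real_of_int h\<bar> powr (-\<beta>) * (\<Sum>c\<in>{0..<N}. f c)) has_sum
      (\<Sum>c\<in>{0..<N}. shifted_sum \<beta> f v c)) (UNIV - {0})" .
  then show ?thesis
    using has_sum_cmult_left[OF has_sum_nonzero_int_powr[OF assms(3)], of "\<Sum>c\<in>{0..<N}. f c"]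
    by (metis has_sum_unique)
qed

text \<open>Each new coordinate costs one application of subadditivity and one of Jensen's
  inequality, after which the total mass of the convolution gives the new factor. No property of z
  is involved, so the bound serves for whatever components were chosen before.\<close>

lemma sum_lattice_sum_powr_le:
  assumes N: "N > 0" and q: "0 < q" "q \<le> 1" "\<alpha> * q > 1" and \<gamma>: "\<And>j. j \<in> {1..d} \<Longrightarrow> 0 \<le> \<gamma> j"
  shows "(\<Sum>c\<in>{0..<N}. lattice_sum N \<alpha> \<gamma> z d c powr q) \<le> (\<Prod>j=1..d. 1 + \<gamma> j powr q * (2 * zeta (\<alpha> * q)))"
  using \<gamma>
proof (induction d)
  case 0
  have "(\<Sum>c\<in>{0..<N}. lattice_sum N \<alpha> \<gamma> z 0 c powr q) = (\<Sum>c\<in>{0..<N}. if c = 0 then 1 else 0)"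
    by (intro sum.cong refl) (auto dest: zdvd_imp_le)
  then show ?case using N by simp
next
  case (Suc d)
  let ?F = "lattice_sum N \<alpha> \<gamma> z d"
  have F0: "0 \<le> ?F c" for c using Suc.prems by (intro lattice_sum_nonneg) auto
  have per: "periodic_mod N (\<lambda>c. ?F c powr q)"
    using periodic_lattice_sum[of N \<alpha> \<gamma> z d] by (simp add: periodic_mod_def)
  have "(\<Sum>c\<in>{0..<N}. lattice_sum N \<alpha> \<gamma> z (Suc d) c powr q) \<le>
     (\<Sum>c\<in>{0..<N}. ?F c powr q + \<gamma> (Suc d) powr q * shifted_sum (\<alpha> * q) (\<lambda>c. ?F c powr q) (z (Suc d)) c)"
  proof (rule sum_mono)
    fix c
    have "lattice_sum N \<alpha> \<gamma> z (Suc d) c powr q \<le>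
      ?F c powr q + (\<gamma> (Suc d) * shifted_sum \<alpha> ?F (z (Suc d)) c) powr q"
      unfolding lattice_sum.simps
      using Suc.prems q F0 by (intro powr_add_le mult_nonneg_nonneg shifted_sum_nonneg) auto
    also have "(\<gamma> (Suc d) * shifted_sum \<alpha> ?F (z (Suc d)) c) powr q =
      \<gamma> (Suc d) powr q * shifted_sum \<alpha> ?F (z (Suc d)) c powr q"
      using Suc.prems F0 by (simp add: powr_mult shifted_sum_nonneg)
    also have "\<dots> \<le> \<gamma> (Suc d) powr q * shifted_sum (\<alpha> * q) (\<lambda>c. ?F c powr q) (z (Suc d)) c"
      by (intro mult_left_mono shifted_sum_powr_le[OF periodic_lattice_sum N F0 q]) auto
    finally show "lattice_sum N \<alpha> \<gamma> z (Suc d) c powr q \<le>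
      ?F c powr q + \<gamma> (Suc d) powr q * shifted_sum (\<alpha> * q) (\<lambda>c. ?F c powr q) (z (Suc d)) c"
      by simp
  qed
  also have "\<dots> = (\<Sum>c\<in>{0..<N}. ?F c powr q) * (1 + \<gamma> (Suc d) powr q * (2 * zeta (\<alpha> * q)))"
    by (simp add: sum.distrib sum_shifted_sum[OF per N q(3)] algebra_simps flip: sum_distrib_left)
  also have "\<dots> \<le> (\<Prod>j=1..d. 1 + \<gamma> j powr q * (2 * zeta (\<alpha> * q))) * (1 + \<gamma> (Suc d) powr q * (2 * zeta (\<alpha> * q)))"
    using Suc zeta_nonneg[OF q(3)] by (intro mult_right_mono add_nonneg_nonneg mult_nonneg_nonneg) auto
  finally show ?case by simp
qed

section \<open>The error of a lattice point set\<close>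

definition unit_root :: "int \<Rightarrow> int \<Rightarrow> complex" where
  "unit_root N k = exp (2 * of_real pi * \<i> * of_real (of_int k / of_int N))"

lemma unit_root_add: "unit_root N (a + b) = unit_root N a * unit_root N b"
  unfolding unit_root_def by (simp add: add_divide_distrib distrib_left exp_add)

lemma unit_root_eq_1_iff: "N > 0 \<Longrightarrow> unit_root N k = 1 \<longleftrightarrow> N dvd k"
proof
  assume N: "N > 0" and "unit_root N k = 1"
  then obtain n :: int where "2 * pi * (of_int k / of_int N) = of_int (2 * n) * pi"
    by (auto simp: unit_root_def exp_eq_1)
  then have "real_of_int k = of_int (n * N)" using N by (simp add: field_simps)
  then have "k = n * N" by (simp only: of_int_eq_iff)
  then show "N dvd k" by simp
next
  assume N: "N > 0" and "N dvd k"
  then obtain n where "k = N * n" by auto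
  then have "real_of_int k / of_int N = of_int n" using N by simp
  then show "unit_root N k = 1" unfolding unit_root_def by (simp only: exp_2pi_i_int)
qed

lemma periodic_unit_root: "N > 0 \<Longrightarrow> periodic_mod N (\<lambda>c. unit_root N (c * t))"
  unfolding periodic_mod_def
proof
  fix c assume N: "N > 0"
  have "c * t = c mod N * t + N * (c div N * t)"
    by (metis (no_types, opaque_lifting) distrib_right mod_mult_div_eq mult.assoc)
  moreover have "unit_root N (N * (c div N * t)) = 1" using N by (subst unit_root_eq_1_iff) auto
  ultimately show "unit_root N (c mod N * t) = unit_root N (c * t)" by (simp add: unit_root_add)
qed

text \<open>The Fourier transform turns each convolution into a product. At frequency t the result
  is the kernel between the point \<open>t z / N\<close> and the origin.\<close>

lemma lattice_sum_Fourier: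
  assumes N: "N > 0" and \<alpha>: "\<alpha> > 1"
  shows "(\<Sum>c\<in>{0..<N}. of_real (lattice_sum N \<alpha> \<gamma> z d c) * unit_root N (c * t)) =
    (\<Prod>j=1..d. 1 + of_real (\<gamma> j) * korobov1 \<alpha> (of_int (t * z j) / of_int N))"
proof (induction d)
  case 0
  have "(\<Sum>c\<in>{0..<N}. of_real (lattice_sum N \<alpha> \<gamma> z 0 c) * unit_root N (c * t)) = (\<Sum>c\<in>{0..<N}. if c = 0 then 1 else 0)"
    by (intro sum.cong refl) (auto dest: zdvd_imp_le simp: unit_root_def)
  then show ?case using N by simp
next
  case (Suc d)
  let ?F = "lattice_sum N \<alpha> \<gamma> z d" and ?v = "z (Suc d)"
  define T where "T = (\<Sum>c\<in>{0..<N}. of_real (?F c) * unit_root N (c * t))"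
  have per: "periodic_mod N (\<lambda>c. of_real (?F c) * unit_root N (c * t))"
    using periodic_lattice_sum[of N \<alpha> \<gamma> z d] periodic_unit_root[OF N, of t] by (simp add: periodic_mod_def)
  have "((\<lambda>h. \<Sum>c\<in>{0..<N}. of_real (\<bar>real_of_int h\<bar> powr (-\<alpha>) * ?F (c - h * ?v)) * unit_root N (c * t)) has_sum
      (\<Sum>c\<in>{0..<N}. of_real (shifted_sum \<alpha> ?F ?v c) * unit_root N (c * t))) (UNIV - {0})"
    unfolding shifted_sum_def
    by (intro has_sum_sum_finite has_sum_cmult_left has_sum_of_real has_sum_infsum
         summable_periodic[OF periodic_lattice_sum N \<alpha>]) auto
  also have "(\<lambda>h. \<Sum>c\<in>{0..<N}. of_real (\<bar>real_of_int h\<bar> powr (-\<alpha>) * ?F (c - h * ?v)) * unit_root N (c * t)) =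
     (\<lambda>h. korobov_mode \<alpha> h (of_int (t * ?v) / of_int N) * T)"
  proof
    fix h
    have mode: "korobov_mode \<alpha> h (of_int (t * ?v) / of_int N) =
        of_real (\<bar>real_of_int h\<bar> powr (-\<alpha>)) * unit_root N (h * ?v * t)"
      by (simp add: korobov_mode_def unit_root_def powr_minus divide_inverse mult_ac)
    \<comment> \<open>Separates the character of the new coordinate from that of the remaining
      class, over which the sum is invariant under shifts.\<close>
    have split: "unit_root N (c * t) = unit_root N (h * ?v * t) * unit_root N ((c - h * ?v) * t)" for c
      by (simp flip: unit_root_add) (simp add: algebra_simps)
    have "(\<Sum>c\<in>{0..<N}. of_real (\<bar>real_of_int h\<bar> powr (-\<alpha>) * ?F (c - h * ?v)) * unit_root N (c * t)) =
      korobov_mode \<alpha> h (of_int (t * ?v) / of_int N) *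
        (\<Sum>c\<in>{0..<N}. of_real (?F (c - h * ?v)) * unit_root N ((c - h * ?v) * t))"
      unfolding mode sum_distrib_left by (intro sum.cong refl, subst split) (simp add: mult_ac)
    also have "(\<Sum>c\<in>{0..<N}. of_real (?F (c - h * ?v)) * unit_root N ((c - h * ?v) * t)) = T"
      unfolding T_def by (rule sum_periodic_shift[OF per N])
    finally show "(\<Sum>c\<in>{0..<N}. of_real (\<bar>real_of_int h\<bar> powr (-\<alpha>) * ?F (c - h * ?v)) * unit_root N (c * t)) =
      korobov_mode \<alpha> h (of_int (t * ?v) / of_int N) * T" .
  qed
  finally have "(\<Sum>c\<in>{0..<N}. of_real (shifted_sum \<alpha> ?F ?v c) * unit_root N (c * t)) =
     (\<Sum>\<^sub>\<infinity>h\<in>UNIV - {0}. korobov_mode \<alpha> h (of_int (t * ?v) / of_int N) * T)"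
    by (simp add: infsumI)
  also have "\<dots> = korobov1 \<alpha> (of_int (t * ?v) / of_int N) * T"
    unfolding korobov1_def
    using Infinite_Sum.abs_summable_summable[OF abs_summable_korobov_mode[OF \<alpha>]] by (intro infsum_cmult_left) auto
  finally have shifted: "(\<Sum>c\<in>{0..<N}. of_real (shifted_sum \<alpha> ?F ?v c) * unit_root N (c * t)) =
     korobov1 \<alpha> (of_int (t * ?v) / of_int N) * T" .
  have "(\<Sum>c\<in>{0..<N}. of_real (lattice_sum N \<alpha> \<gamma> z (Suc d) c) * unit_root N (c * t)) =
    T + of_real (\<gamma> (Suc d)) * (\<Sum>c\<in>{0..<N}. of_real (shifted_sum \<alpha> ?F ?v c) * unit_root N (c * t))"
    by (simp add: T_def sum.distrib distrib_right sum_distrib_left mult.assoc)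
  also have "\<dots> = T * (1 + of_real (\<gamma> (Suc d)) * korobov1 \<alpha> (of_int (t * ?v) / of_int N))"
    unfolding shifted by (simp add: algebra_simps)
  finally show ?case using Suc unfolding T_def by simp
qed

lemma sum_unit_root:
  assumes "N > 0"
  shows "(\<Sum>k<nat N. unit_root N (c * int k)) = (if N dvd c then of_int N else 0)"
proof -
  have pow: "unit_root N (c * int k) = unit_root N c ^ k" for k
  proof (induction k)
    case 0 show ?case by (simp add: unit_root_def)
  next
    case (Suc k)
    have "c * int (Suc k) = c + c * int k" by (simp add: algebra_simps)
    then show ?case using Suc by (simp only: unit_root_add power_Suc)
  qed
  show ?thesis
  proof (cases "N dvd c")
    case True
    then show ?thesis using assms unit_root_eq_1_iff[OF assms, of c] by (simp add: pow)
  next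
    case False
    have "unit_root N c ^ nat N = 1"
      using assms unit_root_eq_1_iff[OF assms, of "c * N"] by (simp flip: pow)
    then show ?thesis
      using False unit_root_eq_1_iff[OF assms, of c] sum_gp_strict[of "unit_root N c" "nat N"] by (simp add: pow)
  qed
qed

lemma lattice_points_in_cube: "set_mset (lattice_points N s z) \<subseteq> unit_cube s"
  by (auto simp: lattice_points_def unit_cube_def less_imp_le[OF frac_lt_1])

lemma size_lattice_points: "size (lattice_points N s z) = N"
  by (simp add: lattice_points_def)

context korobov_space begin

text \<open>The double kernel sum over the lattice points is an inverse Fourier transform at the
  class 0. The subtracted 1 is the contribution of the zero frequency vector, so what remains is the
  sum over the dual lattice.\<close>

lemma worst_case_error_lattice:
  assumes N: "N > 0"
  shows "(worst_case_error s H ip (lattice_points N s z))\<^sup>2 = lattice_sum (int N) \<alpha> \<gamma> z s 0 - 1"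
proof -
  let ?N = "int N" and ?F = "lattice_sum (int N) \<alpha> \<gamma> z s"
  define p where "p = (\<lambda>k. \<lambda>j\<in>{1..s}. frac (real k / real N * of_int (z j)))"
  have K: "K (p k) (p l) = (\<Sum>c\<in>{0..<?N}. of_real (?F c) * unit_root ?N (c * (int k - int l)))" for k l
  proof -
    have "korobov1 \<alpha> (p k j - p l j) = korobov1 \<alpha> (of_int ((int k - int l) * z j) / of_int ?N)" if "j \<in> {1..s}" for j
    proof -
      have "p k j - p l j = of_int ((int k - int l) * z j) / of_int ?N +
        of_int (\<lfloor>real l / real N * of_int (z j)\<rfloor> - \<lfloor>real k / real N * of_int (z j)\<rfloor>)"
        using that by (simp add: p_def frac_def left_diff_distrib diff_divide_distrib)
      then show ?thesis by (simp only: korobov1_periodic)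
    qed
    then show ?thesis
      using N by (subst lattice_sum_Fourier[OF _ \<alpha>]) (auto simp: korobov_kernel_prod[OF \<alpha>])
  qed
  have P: "lattice_points N s z = image_mset p (mset_set {0..<N})"
    by (simp add: lattice_points_def p_def)
  have "(\<Sum>y\<in>#lattice_points N s z. \<Sum>x\<in>#lattice_points N s z. K y x) = (\<Sum>k<N. \<Sum>l<N. K (p k) (p l))"
    unfolding P by (simp add: image_mset.compositionality o_def sum_unfold_sum_mset[symmetric] atLeast0LessThan)
  also have "\<dots> = (\<Sum>c\<in>{0..<?N}. of_real (?F c) * (\<Sum>k<N. \<Sum>l<N. unit_root ?N (c * (int k - int l))))"
    unfolding K
    by (subst sum.swap, subst (2) sum.swap) (simp add: sum_distrib_left sum.swap[of _ _ "{0..<?N}"])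
  also have "\<dots> = (\<Sum>c\<in>{0..<?N}. of_real (?F c) * ((\<Sum>k<N. unit_root ?N (c * int k)) * (\<Sum>l<N. unit_root ?N ((-c) * int l))))"
    by (simp add: sum_product right_diff_distrib flip: unit_root_add)
  \<comment> \<open>Both exponential sums vanish unless N divides c; among the representatives this
    leaves \<open>c = 0\<close>, where each sum is N.\<close>
  also have "\<dots> = (\<Sum>c\<in>{0..<?N}. if c = 0 then of_real (?F 0) * of_nat N ^ 2 else 0)"
    using N sum_unit_root[of ?N]
    by (intro sum.cong refl) (auto dest: zdvd_imp_le simp: power2_eq_square unit_root_def)
  also have "\<dots> = of_real (?F 0) * of_nat N ^ 2" using N by simp
  finally have "complex_of_real ((worst_case_error s H ip (lattice_points N s z))\<^sup>2) = of_real (?F 0 - 1)"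
    using worst_case_error_formula(1)[OF lattice_points_in_cube, of N z] N
    by (simp add: size_lattice_points power_divide)
  then show ?thesis by (simp only: of_real_eq_iff)
qed

end

section \<open>Averaging over the search set\<close>

lemma cbc_search_set_totatives:
  assumes b: "prime b" and w: "w < m"
  shows "cbc_search_set b m w = totatives (b ^ (m - w))"
proof (rule set_eqI)
  fix z
  have "gcd z (b ^ m) = Suc 0 \<longleftrightarrow> coprime z b"
    using w by (simp add: coprime_iff_gcd_eq_1[symmetric] flip: One_nat_def)
  moreover have "coprime z (b ^ (m - w)) \<longleftrightarrow> coprime z b" using w by simp
  moreover have "z \<noteq> b ^ (m - w)" if "coprime z b"
    using that w b by auto
  ultimately show "z \<in> cbc_search_set b m w \<longleftrightarrow> z \<in> totatives (b ^ (m - w))"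
    using w by (auto simp: cbc_search_set_def totatives_def)
qed

text \<open>The totient of a power of b is the fraction \<open>(b - 1) / b\<close> of it, which is
  at least one half. This gives the 2 in \<open>cbc_constant\<close>.\<close>

lemma card_cbc_search_set:
  assumes b: "prime b" and w: "w < m"
  shows "b ^ (m - w) \<le> 2 * card (cbc_search_set b m w)"
proof -
  have "card (cbc_search_set b m w) = b ^ (m - w - 1) * (b - 1)"
    using totient_prime_power[OF b, of "m - w"] w unfolding cbc_search_set_totatives[OF assms] totient_def by simp
  moreover have "b ^ (m - w) = b ^ (m - w - 1) * b"
    using w by (metis Suc_diff_Suc diff_Suc_eq_diff_pred mult.commute power_Suc zero_less_diff diff_Suc_1 Suc_pred)
  moreover have "b \<le> 2 * (b - 1)" using prime_ge_2_nat[OF b] by simp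
  ultimately show ?thesis by (metis mult.left_commute mult_le_mono2)
qed

lemma finite_cbc_search_set: "finite (cbc_search_set b m w)"
  by (simp add: cbc_search_set_def)

section \<open>Counting solutions of linear congruences\<close>

lemma has_sum_multiples_powr:
  assumes "\<beta> > 1" "g > 0"
  shows "((\<lambda>h. if g dvd h then \<bar>real_of_int h\<bar> powr (-\<beta>) else 0) has_sum
    (real_of_int g powr (-\<beta>) * (2 * zeta \<beta>))) (UNIV - {0})"
proof -
  have "((\<lambda>h. real_of_int g powr (-\<beta>) * \<bar>real_of_int h\<bar> powr (-\<beta>)) has_sum
    (real_of_int g powr (-\<beta>) * (2 * zeta \<beta>))) (UNIV - {0})"
    by (intro has_sum_cmult_right has_sum_nonzero_int_powr assms)
  also have "(\<lambda>h. real_of_int g powr (-\<beta>) * \<bar>real_of_int h\<bar> powr (-\<beta>)) =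
     (\<lambda>h. \<bar>real_of_int h\<bar> powr (-\<beta>)) \<circ> (\<lambda>h. g * h)"
    using assms by (auto simp: fun_eq_iff abs_mult powr_mult)
  finally have "((\<lambda>h. \<bar>real_of_int h\<bar> powr (-\<beta>)) has_sum
    (real_of_int g powr (-\<beta>) * (2 * zeta \<beta>))) ((\<lambda>h. g * h) ` (UNIV - {0}))"
    using assms by (subst has_sum_reindex) (auto simp: inj_on_def o_def)
  then show ?thesis
    by (rule has_sum_cong_neutral[THEN iffD1, rotated -1]) (use assms in \<open>auto simp: image_iff elim!: dvdE\<close>)
qed

text \<open>Dividing by the gcd g leaves a congruence modulo \<open>r = b ^ M / g\<close> in which
  the coefficient of v is invertible as soon as a solution exists. All solutions then agree modulo
  r, and below \<open>g * r\<close> there are at most g of them.\<close>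

lemma card_congruence_solutions:
  fixes b M :: nat and c h :: int
  assumes b: "prime b" and h: "gcd c (int b ^ M) dvd h"
  shows "int (card {v. v < b ^ M \<and> int b ^ M dvd h * int v + c}) \<le> gcd c (int b ^ M)"
proof -
  define g where "g = gcd c (int b ^ M)"
  have b0: "int b > 1" using prime_gt_1_nat[OF b] by simp
  have g0: "g > 0" using b0 by (simp add: g_def)
  obtain r where r: "int b ^ M = g * r" unfolding g_def by (meson dvdE gcd_dvd2)
  have r0: "r > 0" using r g0 b0 by (metis zero_less_mult_pos zero_less_power less_trans zero_less_one)
  obtain h' where h': "h = g * h'" using h unfolding g_def by auto
  let ?S = "{v. v < b ^ M \<and> int b ^ M dvd h * int v + c}"
  have cong: "r dvd int v1 - int v2" if v: "v1 \<in> ?S" "v2 \<in> ?S" for v1 v2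
  proof -
    \<comment> \<open>Relies on the solution v1: a common prime p would make \<open>g * p\<close>
      divide c as well, although g is already the full gcd of c and the modulus.\<close>
    have "coprime r h'"
    proof (rule ccontr)
      assume "\<not> coprime r h'"
      then have "gcd r h' \<noteq> 1" by (simp add: coprime_iff_gcd_eq_1)
      moreover have "gcd r h' \<noteq> 0" using r0 by simp
      ultimately obtain p where p: "prime p" "p dvd gcd r h'"
        by (metis abs_gcd_int prime_factor_int zdvd1_eq abs_0_eq)
      then have p': "p dvd r" "p dvd h'" by auto
      have "p dvd int b ^ M" using p' r by simp
      then have "p dvd int b" using p prime_dvd_power by blast
      have "g * p dvd int b ^ M" using p' r by simp
      moreover have "g * p dvd h * int v1" using p' h' by simp
      moreover have "g * p dvd h * int v1 + c"
        using v(1) dvd_trans[OF \<open>g * p dvd int b ^ M\<close>] by simp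
      ultimately have "g * p dvd c" by (metis dvd_add_right_iff)
      with \<open>g * p dvd int b ^ M\<close> have "g * p dvd g" unfolding g_def by simp
      then have "p dvd 1" using g0 by simp
      with p show False using not_prime_unit by blast
    qed
    moreover have "g * r dvd (h * int v1 + c) - (h * int v2 + c)"
      using v r by (intro dvd_diff) auto
    then have "g * r dvd g * (h' * (int v1 - int v2))" by (simp add: h' algebra_simps)
    then have "r dvd h' * (int v1 - int v2)" using g0 by simp
    ultimately show ?thesis by (simp add: coprime_dvd_mult_right_iff)
  qed
  have "inj_on (\<lambda>v. int v div r) ?S"
  proof (rule inj_onI)
    fix v1 v2 assume v: "v1 \<in> ?S" "v2 \<in> ?S" and eq: "int v1 div r = int v2 div r"
    have "int v1 mod r = int v2 mod r" using cong[OF v] by (simp add: mod_eq_dvd_iff)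
    with eq have "int v1 = int v2" by (metis div_mult_mod_eq)
    then show "v1 = v2" by simp
  qed
  moreover have "(\<lambda>v. int v div r) ` ?S \<subseteq> {0..<g}"
  proof (intro image_subsetI)
    fix v assume "v \<in> ?S"
    then have "int v < g * r" unfolding r[symmetric] by (metis (mono_tags) mem_Collect_eq of_nat_less_iff of_nat_power)
    moreover have "(int v div r) * r \<le> int v"
      using div_mult_mod_eq[of "int v" r] pos_mod_sign[OF r0, of "int v"] by linarith
    ultimately have "int v div r < g" using r0 by (meson le_less_trans mult_right_less_imp_less less_imp_le)
    then show "int v div r \<in> {0..<g}" using r0 by (simp add: pos_imp_zdiv_nonneg_iff)
  qed
  ultimately have "card ?S \<le> card {0..<g}" by (intro card_inj_on_le) auto
  then have "int (card ?S) \<le> g" using g0 by simp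
  then show ?thesis unfolding g_def .
qed

text \<open>After cancelling \<open>b ^ w\<close>, let g be the gcd of the class with
  \<open>b ^ M\<close>. Since v is a unit, solutions exist only if g divides h, and then there are
  at most g of them. Summation over the multiples of g loses \<open>g powr (-\<beta>)\<close>, which
  outweighs this count, so the bound is uniform in c.\<close>

lemma infsum_card_solutions_le:
  fixes b m w :: nat and c :: int
  assumes b: "prime b" and w: "w < m" and \<beta>: "\<beta> > 1"
  defines "S \<equiv> \<lambda>h. {v \<in> cbc_search_set b m w. int b ^ m dvd h * int (b ^ w * v) + c}"
  shows "(\<Sum>\<^sub>\<infinity>h\<in>UNIV - {0}. \<bar>real_of_int h\<bar> powr (-\<beta>) * real (card (S h))) \<le> 2 * zeta \<beta>"
proof (cases "int b ^ w dvd c")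
  case False
  have "S h = {}" for h
  proof (rule ccontr)
    assume "S h \<noteq> {}"
    then obtain v where "int b ^ m dvd h * int (b ^ w * v) + c" by (auto simp: S_def)
    moreover have "int b ^ w dvd int b ^ m" using w by (simp add: le_imp_power_dvd)
    ultimately have "int b ^ w dvd h * int (b ^ w * v) + c" by (rule dvd_trans[rotated])
    then show False using False by (simp add: dvd_add_right_iff)
  qed
  then show ?thesis using zeta_nonneg[OF \<beta>] by simp
next
  case True
  then obtain c' where c': "c = int b ^ w * c'" by auto
  define M where "M = m - w"
  have mM: "m = w + M" using w by (simp add: M_def)
  define g where "g = gcd c' (int b ^ M)"
  have b0: "int b > 1" using prime_gt_1_nat[OF b] by simp
  have g0: "g > 0" using b0 by (simp add: g_def)
  have cond: "int b ^ m dvd h * int (b ^ w * v) + c \<longleftrightarrow> int b ^ M dvd h * int v + c'" for h v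
  proof -
    have "h * int (b ^ w * v) + c = int b ^ w * (h * int v + c')" by (simp add: c' algebra_simps)
    then show ?thesis using b0 by (simp add: mM power_add)
  qed
  have S: "S h = {v \<in> cbc_search_set b m w. int b ^ M dvd h * int v + c'}" for h
    unfolding S_def cond ..
  have bound: "real (card (S h)) \<le> (if g dvd h then real_of_int g else 0)" for h
  proof (cases "g dvd h")
    case True
    have "S h \<subseteq> {v. v < b ^ M \<and> int b ^ M dvd h * int v + c'}"
      using w by (auto simp: S cbc_search_set_def M_def)
    then have "card (S h) \<le> card {v. v < b ^ M \<and> int b ^ M dvd h * int v + c'}"
      by (rule card_mono[rotated]) simp
    also have "int \<dots> \<le> g"
      using card_congruence_solutions[OF b, of c' M h] True unfolding g_def by simp
    finally show ?thesis using True by simp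
  next
    case False
    have "S h = {}"
    proof (rule ccontr)
      assume "S h \<noteq> {}"
      then obtain v where v: "v \<in> cbc_search_set b m w" "int b ^ M dvd h * int v + c'"
        by (auto simp: S)
      have "g dvd h * int v + c'" using v(2) unfolding g_def by (meson dvd_trans gcd_dvd2)
      then have "g dvd h * int v" unfolding g_def by (simp add: dvd_add_left_iff)
      moreover have "coprime g (int v)"
      proof -
        have "coprime v (b ^ M)"
          using v(1) unfolding cbc_search_set_totatives[OF b w] M_def by (simp add: totatives_def)
        then have "coprime (int b ^ M) (int v)" by (simp add: coprime_commute flip: of_nat_power)
        then show ?thesis unfolding g_def by (meson coprime_divisors dvd_refl gcd_dvd2)
      qed
      ultimately have "g dvd h" by (simp add: coprime_dvd_mult_left_iff)
      then show False using False by simp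
    qed
    then show ?thesis using False by simp
  qed
  have hs: "((\<lambda>h. real_of_int g * (if g dvd h then \<bar>real_of_int h\<bar> powr (-\<beta>) else 0)) has_sum
      (real_of_int g * (real_of_int g powr (-\<beta>) * (2 * zeta \<beta>)))) (UNIV - {0})"
    by (intro has_sum_cmult_right has_sum_multiples_powr \<beta> g0)
  have le: "\<bar>real_of_int h\<bar> powr (-\<beta>) * real (card (S h)) \<le>
      real_of_int g * (if g dvd h then \<bar>real_of_int h\<bar> powr (-\<beta>) else 0)" for h
    using mult_left_mono[OF bound[of h], of "\<bar>real_of_int h\<bar> powr (-\<beta>)"] by (auto simp: mult.commute split: if_splits)
  have "(\<lambda>h. \<bar>real_of_int h\<bar> powr (-\<beta>) * real (card (S h))) summable_on (UNIV - {0})"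
    using has_sum_imp_summable[OF hs] le by (rule summable_on_comparison_test) auto
  then have "(\<Sum>\<^sub>\<infinity>h\<in>UNIV - {0}. \<bar>real_of_int h\<bar> powr (-\<beta>) * real (card (S h))) \<le>
    real_of_int g * (real_of_int g powr (-\<beta>) * (2 * zeta \<beta>))"
    using le by (intro has_sum_mono[OF has_sum_infsum hs]) auto
  \<comment> \<open>Here \<open>\<beta> > 1\<close> and \<open>g \<ge> 1\<close> make the power of g
    at most 1.\<close>
  also have "\<dots> = real_of_int g powr (1 - \<beta>) * (2 * zeta \<beta>)"
    using g0 by (simp add: powr_diff powr_minus divide_inverse)
  also have "\<dots> \<le> 1 * (2 * zeta \<beta>)"
    using g0 \<beta> zeta_nonneg[OF \<beta>] powr_mono[of "1 - \<beta>" 0 "real_of_int g"] by (intro mult_right_mono) auto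
  finally show ?thesis by simp
qed

text \<open>Isolates the class c, so that the averaging argument can count the admissible v for each
  c separately. The form \<open>0 - x\<close> is the argument that occurs in
  \<open>shifted_sum\<close> at the class 0.\<close>

lemma periodic_expand:
  fixes f :: "int \<Rightarrow> real"
  assumes "periodic_mod N f" "N > 0"
  shows "f (0 - x) = (\<Sum>c\<in>{0..<N}. f c * of_bool (N dvd x + c))"
proof -
  have "(\<Sum>c\<in>{0..<N}. f c * of_bool (N dvd x + c)) = (\<Sum>c\<in>{0..<N}. if c = (- x) mod N then f c else 0)"
  proof (intro sum.cong refl)
    fix c assume c: "c \<in> {0..<N}"
    have "N dvd x + c \<longleftrightarrow> c mod N = (- x) mod N" by (simp add: mod_eq_dvd_iff add.commute)
    then show "f c * of_bool (N dvd x + c) = (if c = (- x) mod N then f c else 0)" using c by simp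
  qed
  also have "\<dots> = f ((- x) mod N)" using assms by (simp add: sum.delta)
  finally show ?thesis using assms by (simp add: periodic_mod_def)
qed

text \<open>A minimizer is at most the mean over the search set, also after taking q-th powers.
  Exchanging the sums gives each class c a weight, the sum over h of the number of matching v, which
  is at most \<open>2 * zeta (\<alpha> * q)\<close>.\<close>

lemma minimal_shifted_sum_le:
  fixes f :: "int \<Rightarrow> real"
  assumes b: "prime b" and f: "periodic_mod (int b ^ m) f" "\<And>c. 0 \<le> f c"
    and q: "0 < q" "q \<le> 1" "\<alpha> * q > 1"
    and v: "v \<in> cbc_search_set b m w"
    and min: "\<And>v'. v' \<in> cbc_search_set b m w \<Longrightarrow>
      shifted_sum \<alpha> f (int (b ^ w * v)) 0 \<le> shifted_sum \<alpha> f (int (b ^ w * v')) 0"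
  shows "shifted_sum \<alpha> f (int (b ^ w * v)) 0 powr q \<le>
    2 * (2 * zeta (\<alpha> * q)) * real b ^ w / real b ^ m * (\<Sum>c\<in>{0..<int b ^ m}. f c powr q)"
proof -
  let ?N = "int b ^ m" and ?\<beta> = "\<alpha> * q" and ?F = "\<lambda>c. f c powr q"
  have b1: "real b > 1" using prime_gt_1_nat[OF b] by simp
  have N: "?N > 0" using b1 by simp
  have perF: "periodic_mod ?N ?F" using f(1) by (simp add: periodic_mod_def)
  have step: "shifted_sum \<alpha> f (int (b ^ w * v)) 0 powr q \<le> shifted_sum ?\<beta> ?F (int (b ^ w * v)) 0" for v
    by (rule shifted_sum_powr_le[OF f(1) N f(2) q])
  have z0: "zeta ?\<beta> \<ge> 0" using zeta_nonneg[OF q(3)] .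
  show ?thesis
  proof (cases "w < m")
    case False
    then have v1: "v = 1" using v by (simp add: cbc_search_set_def)
    \<comment> \<open>The component is a multiple of the modulus, so every h stays in the class 0
      and no averaging is possible.\<close>
    obtain t where t: "int b ^ w = ?N * t" using False by (metis dvdE le_imp_power_dvd not_less)
    have "?F (0 - h * int (b ^ w * v)) = ?F 0" for h
      by (rule periodic_modD[OF perF]) (simp add: v1 t)
    then have "shifted_sum ?\<beta> ?F (int (b ^ w * v)) 0 = 2 * zeta ?\<beta> * ?F 0"
      unfolding shifted_sum_def
      using infsum_cmult_left'[of "\<lambda>h. \<bar>real_of_int h\<bar> powr (-?\<beta>)" "?F 0" "UNIV - {0}"]
      by (simp add: infsum_nonzero_int_powr[OF q(3)])
    moreover have "?F 0 \<le> 2 * (real b ^ w / real b ^ m) * (\<Sum>c\<in>{0..<?N}. ?F c)"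
    proof -
      have "?F 0 \<le> (\<Sum>c\<in>{0..<?N}. ?F c)"
        by (rule member_le_sum) (use N in auto)
      moreover have "1 \<le> real b ^ w / real b ^ m" using False b1 by (simp add: field_simps power_increasing)
      then have "1 * (\<Sum>c\<in>{0..<?N}. ?F c) \<le> 2 * (real b ^ w / real b ^ m) * (\<Sum>c\<in>{0..<?N}. ?F c)"
        by (intro mult_right_mono sum_nonneg) auto
      ultimately show ?thesis by linarith
    qed
    then have "2 * zeta ?\<beta> * ?F 0 \<le> 2 * zeta ?\<beta> * (2 * (real b ^ w / real b ^ m) * (\<Sum>c\<in>{0..<?N}. ?F c))"
      using z0 by (intro mult_left_mono) auto
    ultimately show ?thesis using step[of v] by (simp add: mult_ac)
  next
    case True
    let ?Z = "cbc_search_set b m w"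
    let ?S = "\<lambda>c h. {v \<in> ?Z. ?N dvd h * int (b ^ w * v) + c}"
    have "real (card ?Z) * shifted_sum \<alpha> f (int (b ^ w * v)) 0 powr q \<le>
      (\<Sum>v'\<in>?Z. shifted_sum \<alpha> f (int (b ^ w * v')) 0 powr q)"
      using min q f(2) by (intro sum_bounded_below powr_mono2 shifted_sum_nonneg) auto
    also have "\<dots> \<le> (\<Sum>v'\<in>?Z. shifted_sum ?\<beta> ?F (int (b ^ w * v')) 0)"
      by (intro sum_mono step)
    also have "\<dots> = (\<Sum>c\<in>{0..<?N}. ?F c * (\<Sum>\<^sub>\<infinity>h\<in>UNIV - {0}. \<bar>real_of_int h\<bar> powr (-?\<beta>) * real (card (?S c h))))"
    proof -
      have "((\<lambda>h. \<Sum>v'\<in>?Z. \<bar>real_of_int h\<bar> powr (-?\<beta>) * ?F (0 - h * int (b ^ w * v'))) has_sum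
         (\<Sum>v'\<in>?Z. shifted_sum ?\<beta> ?F (int (b ^ w * v')) 0)) (UNIV - {0})"
        unfolding shifted_sum_def
        by (intro has_sum_sum_finite has_sum_infsum summable_periodic[OF perF N q(3)] finite_cbc_search_set)
      also have "(\<lambda>h. \<Sum>v'\<in>?Z. \<bar>real_of_int h\<bar> powr (-?\<beta>) * ?F (0 - h * int (b ^ w * v'))) =
        (\<lambda>h. \<Sum>c\<in>{0..<?N}. ?F c * (\<bar>real_of_int h\<bar> powr (-?\<beta>) * real (card (?S c h))))"
      proof
        fix h
        \<comment> \<open>Counting the admissible v by indicators allows the sum over v to be
          carried out first.\<close>
        have "real (card (?S c h)) = (\<Sum>v'\<in>?Z. of_bool (?N dvd h * int (b ^ w * v') + c))" for c
          using finite_cbc_search_set[of b m w]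
          by (subst sum_of_bool_eq) (auto simp: Collect_conj_eq)
        then show "(\<Sum>v'\<in>?Z. \<bar>real_of_int h\<bar> powr (-?\<beta>) * ?F (0 - h * int (b ^ w * v'))) =
          (\<Sum>c\<in>{0..<?N}. ?F c * (\<bar>real_of_int h\<bar> powr (-?\<beta>) * real (card (?S c h))))"
          unfolding periodic_expand[OF perF N] by (simp only: sum_distrib_left sum.swap[of _ ?Z]) (simp only: mult_ac)
      qed
      finally have hs: "((\<lambda>h. \<Sum>c\<in>{0..<?N}. ?F c * (\<bar>real_of_int h\<bar> powr (-?\<beta>) * real (card (?S c h)))) has_sum
         (\<Sum>v'\<in>?Z. shifted_sum ?\<beta> ?F (int (b ^ w * v')) 0)) (UNIV - {0})" .
      have summ: "(\<lambda>h. \<bar>real_of_int h\<bar> powr (-?\<beta>) * real (card (?S c h))) summable_on (UNIV - {0})" for c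
      proof (rule summable_on_comparison_test)
        show "(\<lambda>h. \<bar>real_of_int h\<bar> powr (-?\<beta>) * real (card ?Z)) summable_on (UNIV - {0})"
          using summable_nonzero_int_powr[OF q(3)] by (rule summable_on_cmult_left)
        show "\<bar>real_of_int h\<bar> powr (-?\<beta>) * real (card (?S c h)) \<le> \<bar>real_of_int h\<bar> powr (-?\<beta>) * real (card ?Z)" for h
          by (intro mult_left_mono of_nat_mono card_mono finite_cbc_search_set) auto
      qed auto
      have "((\<lambda>h. \<Sum>c\<in>{0..<?N}. ?F c * (\<bar>real_of_int h\<bar> powr (-?\<beta>) * real (card (?S c h)))) has_sum
         (\<Sum>c\<in>{0..<?N}. ?F c * (\<Sum>\<^sub>\<infinity>h\<in>UNIV - {0}. \<bar>real_of_int h\<bar> powr (-?\<beta>) * real (card (?S c h))))) (UNIV - {0})"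
        by (intro has_sum_sum_finite has_sum_cmult_right has_sum_infsum summ) auto
      then show ?thesis using hs has_sum_unique by blast
    qed
    also have "\<dots> \<le> (\<Sum>c\<in>{0..<?N}. ?F c * (2 * zeta ?\<beta>))"
      by (intro sum_mono mult_left_mono infsum_card_solutions_le b True q) auto
    finally have main: "real (card ?Z) * shifted_sum \<alpha> f (int (b ^ w * v)) 0 powr q \<le> 2 * zeta ?\<beta> * (\<Sum>c\<in>{0..<?N}. ?F c)"
      by (simp add: mult.commute flip: sum_distrib_left sum_distrib_right)
    have cardZ: "real b ^ m / real b ^ w \<le> 2 * real (card ?Z)"
    proof -
      have "real b ^ m / real b ^ w = real (b ^ (m - w))" using True b1 unfolding of_nat_power by (subst power_diff) auto
      also have "\<dots> \<le> real (2 * card ?Z)" using card_cbc_search_set[OF b True] by (rule of_nat_mono)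
      finally show ?thesis by simp
    qed
    have "real b ^ m / real b ^ w * shifted_sum \<alpha> f (int (b ^ w * v)) 0 powr q \<le>
        2 * (real (card ?Z) * shifted_sum \<alpha> f (int (b ^ w * v)) 0 powr q)"
      using mult_right_mono[OF cardZ, of "shifted_sum \<alpha> f (int (b ^ w * v)) 0 powr q"] by simp
    also have "\<dots> \<le> 2 * (2 * zeta ?\<beta> * (\<Sum>c\<in>{0..<?N}. ?F c))" using main by simp
    finally show ?thesis using b1 by (simp add: field_simps)
  qed
qed

section \<open>The reduced component-by-component construction\<close>

lemma lattice_points_cong:
  "(\<And>j. j \<in> {1..s} \<Longrightarrow> z j = z' j) \<Longrightarrow> lattice_points N s z = lattice_points N s z'"
  unfolding lattice_points_def by (intro arg_cong2[where f = image_mset] refl ext restrict_ext) simp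

lemma one_in_cbc_search_set:
  assumes "prime b" shows "1 \<in> cbc_search_set b m w"
proof (cases "w < m")
  case True
  have "1 < b ^ (m - w)" using True prime_gt_1_nat[OF assms] by (intro one_less_power) auto
  then show ?thesis using True by (simp add: cbc_search_set_def)
qed (simp add: cbc_search_set_def)

text \<open>The zero frequency vector contributes 1. Hence the base of the powers in the later
  induction, where 1 is subtracted, is nonnegative.\<close>

lemma lattice_sum_0_ge_1:
  assumes "\<And>j. j \<in> {1..d} \<Longrightarrow> 0 \<le> \<gamma> j"
  shows "1 \<le> lattice_sum N \<alpha> \<gamma> z d 0"
  using assms
proof (induction d)
  case (Suc d)
  have "0 \<le> \<gamma> (Suc d) * shifted_sum \<alpha> (lattice_sum N \<alpha> \<gamma> z d) (z (Suc d)) 0"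
    using Suc.prems by (intro mult_nonneg_nonneg shifted_sum_nonneg lattice_sum_nonneg) auto
  then show ?case using Suc by simp
qed simp

text \<open>The contribution to \<open>cbc_constant\<close> of the subsets with maximal element \<open>d\<close>.\<close>

definition max_weight :: "(nat \<Rightarrow> real) \<Rightarrow> real \<Rightarrow> real \<Rightarrow> real \<Rightarrow> (nat \<Rightarrow> nat) \<Rightarrow> nat \<Rightarrow> real" where
  "max_weight \<gamma> q c b w d = \<gamma> d powr q * c * b ^ w d * (\<Prod>j=1..<d. 1 + \<gamma> j powr q * c)"

section \<open>Regrouping the constant by maximal elements\<close>

lemma Pow_Suc_nonempty:
  "Pow {1..Suc s} - {{}} = (Pow {1..s} - {{}}) \<union> insert (Suc s) ` Pow {1..s}"
  by (simp add: atLeastAtMostSuc_conv Pow_insert) auto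

text \<open>A set with maximal element d is d together with an arbitrary subset of
  \<open>{1..<d}\<close>; summation over the latter yields the product in
  \<open>max_weight\<close>.\<close>

lemma sum_subsets_max_weight:
  assumes w: "mono_on {1..} w" and \<gamma>: "\<And>j. j \<ge> 1 \<Longrightarrow> \<gamma> j > 0"
  shows "(\<Sum>u\<in>Pow {1..s} - {{}}. product_weight \<gamma> u powr q * c ^ card u * b ^ Max (w ` u)) =
    (\<Sum>d=1..s. max_weight \<gamma> q c b w d)"
proof (induction s)
  case (Suc s)
  let ?g = "\<lambda>u. product_weight \<gamma> u powr q * c ^ card u * b ^ Max (w ` u)"
  have ins: "?g (insert (Suc s) u) = \<gamma> (Suc s) powr q * c * b ^ w (Suc s) * (\<Prod>j\<in>u. \<gamma> j powr q * c)"
    if u: "u \<in> Pow {1..s}" for u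
  proof -
    have fin: "finite u" and notin: "Suc s \<notin> u" using u by (auto intro: finite_subset)
    have "Max (w ` insert (Suc s) u) = w (Suc s)"
    proof (rule Max_eqI)
      fix y assume "y \<in> w ` insert (Suc s) u"
      then obtain j where "j \<in> insert (Suc s) u" "y = w j" by auto
      moreover from this u have "1 \<le> j" "j \<le> Suc s" by auto
      ultimately show "y \<le> w (Suc s)" using w by (auto simp: mono_on_def)
    qed (use fin in auto)
    moreover have "product_weight \<gamma> (insert (Suc s) u) powr q = \<gamma> (Suc s) powr q * (\<Prod>j\<in>u. \<gamma> j powr q)"
    proof -
      have "(\<Prod>j\<in>u. \<gamma> j) powr q = (\<Prod>j\<in>u. \<gamma> j powr q)" by (rule prod_powr_distrib)
      then show ?thesis using fin notin by (simp add: product_weight_def powr_mult)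
    qed
    ultimately show ?thesis using fin notin by (simp add: prod.distrib)
  qed
  have "(\<Sum>u\<in>Pow {1..Suc s} - {{}}. ?g u) = (\<Sum>u\<in>Pow {1..s} - {{}}. ?g u) + (\<Sum>u\<in>insert (Suc s) ` Pow {1..s}. ?g u)"
    unfolding Pow_Suc_nonempty by (rule sum.union_disjoint) auto
  also have "(\<Sum>u\<in>insert (Suc s) ` Pow {1..s}. ?g u) = (\<Sum>u\<in>Pow {1..s}. ?g (insert (Suc s) u))"
  proof (rule sum.reindex[unfolded o_def])
    show "inj_on (insert (Suc s)) (Pow {1..s})"
    proof (rule inj_onI)
      fix u v assume uv: "u \<in> Pow {1..s}" "v \<in> Pow {1..s}" and eq: "insert (Suc s) u = insert (Suc s) v"
      from uv have "Suc s \<notin> u" "Suc s \<notin> v" by auto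
      with eq show "u = v" by (simp add: insert_ident)
    qed
  qed
  also have "\<dots> = \<gamma> (Suc s) powr q * c * b ^ w (Suc s) * (\<Sum>u\<in>Pow {1..s}. \<Prod>j\<in>u. \<gamma> j powr q * c)"
    using ins by (simp add: sum_distrib_left)
  also have "(\<Sum>u\<in>Pow {1..s}. \<Prod>j\<in>u. \<gamma> j powr q * c) = (\<Prod>j=1..s. \<gamma> j powr q * c + 1)"
    by (subst prod_add) auto
  also have "\<gamma> (Suc s) powr q * c * b ^ w (Suc s) * (\<Prod>j=1..s. \<gamma> j powr q * c + 1) = max_weight \<gamma> q c b w (Suc s)"
    by (simp add: max_weight_def add.commute atLeastLessThanSuc_atLeastAtMost)
  finally show ?case using Suc by simp
qed simp

lemma max_weight_nonneg: "0 \<le> c \<Longrightarrow> 0 \<le> b \<Longrightarrow> 0 \<le> max_weight \<gamma> q c b w d"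
  unfolding max_weight_def by (intro mult_nonneg_nonneg prod_nonneg) auto

text \<open>The product on the right telescopes: its increment at d is the term
  \<open>max_weight\<close> with each earlier factor enlarged by \<open>b ^ w j\<close>. The 1 on
  the left is the empty product.\<close>

lemma sum_max_weight_le:
  assumes "0 \<le> c" "1 \<le> b"
  shows "1 + (\<Sum>d=1..s. max_weight \<gamma> q c b w d) \<le> (\<Prod>j=1..s. 1 + \<gamma> j powr q * c * b ^ w j)"
proof (induction s)
  case (Suc s)
  have "(\<Prod>j=1..s. 1 + \<gamma> j powr q * c) \<le> (\<Prod>j=1..s. 1 + \<gamma> j powr q * c * b ^ w j)"
  proof (intro prod_mono conjI)
    fix j
    have "\<gamma> j powr q * c * 1 \<le> \<gamma> j powr q * c * b ^ w j"
      using assms by (intro mult_left_mono) auto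
    then show "1 + \<gamma> j powr q * c \<le> 1 + \<gamma> j powr q * c * b ^ w j" by simp
  qed (use assms in auto)
  then have "max_weight \<gamma> q c b w (Suc s) \<le>
      \<gamma> (Suc s) powr q * c * b ^ w (Suc s) * (\<Prod>j=1..s. 1 + \<gamma> j powr q * c * b ^ w j)"
    unfolding max_weight_def atLeastLessThanSuc_atLeastAtMost using assms
    by (intro mult_left_mono) auto
  then show ?case using Suc by (simp add: algebra_simps)
qed simp

section \<open>Induction along the construction\<close>

locale reduced_cbc_setting =
  fixes b :: nat and \<alpha> :: real and \<gamma> :: "nat \<Rightarrow> real" and w :: "nat \<Rightarrow> nat"
    and H :: "nat \<Rightarrow> ((nat \<Rightarrow> real) \<Rightarrow> complex) set"
    and ip :: "nat \<Rightarrow> ((nat \<Rightarrow> real) \<Rightarrow> complex) \<Rightarrow> ((nat \<Rightarrow> real) \<Rightarrow> complex) \<Rightarrow> complex"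
  assumes prime_b: "prime b" and \<alpha>: "\<alpha> > 1" and \<gamma>: "\<And>j. j \<ge> 1 \<Longrightarrow> \<gamma> j > 0"
    and mono_w: "mono_on {1..} w"
    and rkhs: "\<And>s. s \<ge> 1 \<Longrightarrow> is_rkhs (unit_cube s) (korobov_kernel s \<alpha> (product_weight \<gamma>)) (H s) (ip s)"
begin

lemma korobov_space: "s \<ge> 1 \<Longrightarrow> korobov_space s \<alpha> \<gamma> (H s) (ip s)"
  using rkhs \<alpha> by unfold_locales

lemma b_gt_1: "real b > 1"
  using prime_gt_1_nat[OF prime_b] by simp

lemma worst_case_error_sq:
  assumes "s \<ge> 1"
  shows "(worst_case_error s (H s) (ip s) (lattice_points (b ^ m) s z))\<^sup>2 = lattice_sum (int b ^ m) \<alpha> \<gamma> z s 0 - 1"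
  using korobov_space.worst_case_error_lattice[OF korobov_space[OF assms], of "b ^ m" z] b_gt_1 by simp

lemma lattice_sum_powr_le:
  assumes z: "reduced_cbc H ip b m w s z" and q: "0 < q" "q \<le> 1" "\<alpha> * q > 1" and "d \<le> s"
  shows "(lattice_sum (int b ^ m) \<alpha> \<gamma> (cbc_vector b w z) d 0 - 1) powr q \<le>
    2 / real b ^ m * (\<Sum>d=1..d. max_weight \<gamma> q (2 * zeta (\<alpha> * q)) b w d)"
  using \<open>d \<le> s\<close>
proof (induction d)
  case (Suc d)
  let ?N = "int b ^ m" and ?c = "2 * zeta (\<alpha> * q)"
  let ?F = "lattice_sum ?N \<alpha> \<gamma> (cbc_vector b w z) d"
  let ?\<theta> = "\<lambda>v. shifted_sum \<alpha> ?F (int (b ^ w (Suc d) * v)) 0"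
  have \<gamma>0: "0 \<le> \<gamma> j" if "j \<ge> 1" for j using \<gamma>[OF that] by simp
  have F0: "0 \<le> ?F c" for c using \<gamma>0 by (intro lattice_sum_nonneg) auto
  have N0: "?N > 0" using b_gt_1 by simp
  have "z (Suc d) \<in> cbc_search_set b m (w (Suc d)) \<and>
    (\<forall>v\<in>cbc_search_set b m (w (Suc d)). ?\<theta> (z (Suc d)) \<le> ?\<theta> v)"
  proof (cases "d = 0")
    case True
    have z1: "z (Suc d) = 1" using z True by (simp add: reduced_cbc_def)
    \<comment> \<open>The first component is prescribed, not minimized. For \<open>d = 0\<close> the
      lattice sum is the indicator of the multiples of N, which a factor v coprime to N does not
      change; all candidates tie, and 1 is a minimizer too.\<close>
    have "?\<theta> v = ?\<theta> 1" if v: "v \<in> cbc_search_set b m (w (Suc d))" for v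
    proof (cases "w (Suc d) < m")
      case True
      then have "coprime v (b ^ m)" using v by (simp add: cbc_search_set_def coprime_iff_gcd_eq_1)
      then have "coprime ?N (int v)" by (simp add: coprime_commute flip: of_nat_power)
      then have "?N dvd 0 - h * int (b ^ w (Suc d) * v) \<longleftrightarrow> ?N dvd 0 - h * int (b ^ w (Suc d) * 1)" for h
        using coprime_dvd_mult_left_iff[of ?N "int v" "h * int (b ^ w (Suc d))"] by (simp add: mult_ac)
      then show ?thesis using \<open>d = 0\<close> by (simp add: shifted_sum_def)
    next
      case False
      then show ?thesis using v by (simp add: cbc_search_set_def)
    qed
    then show ?thesis using one_in_cbc_search_set[OF prime_b] z1 by simp
  next
    case False
    \<comment> \<open>Only the last convolution depends on v, and its weight is positive, so
      minimizing the squared error means minimizing \<open>?\<theta>\<close>.\<close>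
    have err: "(worst_case_error (d + 1) (H (d + 1)) (ip (d + 1))
                  (lattice_points (b ^ m) (d + 1) (cbc_vector b w (z(d + 1 := v)))))\<^sup>2 =
        ?F 0 + \<gamma> (Suc d) * ?\<theta> v - 1" for v
    proof -
      have "lattice_sum ?N \<alpha> \<gamma> (cbc_vector b w (z(d + 1 := v))) d = ?F"
        by (rule lattice_sum_cong) (auto simp: cbc_vector_def)
      then show ?thesis
        by (subst worst_case_error_sq) (simp_all add: cbc_vector_def)
    qed
    have "d \<in> {1..<s}" using False Suc.prems by auto
    then have "is_arg_min (\<lambda>v. (worst_case_error (d + 1) (H (d + 1)) (ip (d + 1))
                  (lattice_points (b ^ m) (d + 1) (cbc_vector b w (z(d + 1 := v)))))\<^sup>2)
        (\<lambda>v. v \<in> cbc_search_set b m (w (d + 1))) (z (d + 1))"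
      using z unfolding reduced_cbc_def by blast
    then have "z (Suc d) \<in> cbc_search_set b m (w (Suc d))"
      "\<And>v. v \<in> cbc_search_set b m (w (Suc d)) \<Longrightarrow> \<not> \<gamma> (Suc d) * ?\<theta> v < \<gamma> (Suc d) * ?\<theta> (z (Suc d))"
      unfolding err by (auto simp: is_arg_min_def)
    then show ?thesis using \<gamma>[of "Suc d"] by (auto simp: not_less)
  qed
  then have "?\<theta> (z (Suc d)) powr q \<le> 2 * ?c * real b ^ w (Suc d) / real b ^ m * (\<Sum>c\<in>{0..<?N}. ?F c powr q)"
    by (intro minimal_shifted_sum_le[OF prime_b periodic_lattice_sum F0 q]) auto
  also have "\<dots> \<le> 2 * ?c * real b ^ w (Suc d) / real b ^ m * (\<Prod>j=1..d. 1 + \<gamma> j powr q * ?c)"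
    using zeta_nonneg[OF q(3)] \<gamma>0 by (intro mult_left_mono sum_lattice_sum_powr_le[OF N0 q]) auto
  finally have "\<gamma> (Suc d) powr q * ?\<theta> (z (Suc d)) powr q \<le>
    \<gamma> (Suc d) powr q * (2 * ?c * real b ^ w (Suc d) / real b ^ m * (\<Prod>j=1..d. 1 + \<gamma> j powr q * ?c))"
    by (rule mult_left_mono) simp
  also have "\<dots> = 2 / real b ^ m * max_weight \<gamma> q ?c b w (Suc d)"
    by (simp add: max_weight_def atLeastLessThanSuc_atLeastAtMost)
  finally have \<theta>: "\<gamma> (Suc d) powr q * ?\<theta> (z (Suc d)) powr q \<le> 2 / real b ^ m * max_weight \<gamma> q ?c b w (Suc d)" .
  have \<theta>0: "0 \<le> ?\<theta> v" for v using F0 by (intro shifted_sum_nonneg)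
  have eq: "lattice_sum ?N \<alpha> \<gamma> (cbc_vector b w z) (Suc d) 0 - 1 = (?F 0 - 1) + \<gamma> (Suc d) * ?\<theta> (z (Suc d))"
    by (simp add: cbc_vector_def)
  have "((?F 0 - 1) + \<gamma> (Suc d) * ?\<theta> (z (Suc d))) powr q \<le> (?F 0 - 1) powr q + (\<gamma> (Suc d) * ?\<theta> (z (Suc d))) powr q"
    using lattice_sum_0_ge_1[of d \<gamma> ?N \<alpha> "cbc_vector b w z"] \<gamma>0 \<theta>0 q by (intro powr_add_le) auto
  also have "(\<gamma> (Suc d) * ?\<theta> (z (Suc d))) powr q = \<gamma> (Suc d) powr q * ?\<theta> (z (Suc d)) powr q"
    by (rule powr_mult)
  also have "(?F 0 - 1) powr q + \<dots> \<le> 2 / real b ^ m * (\<Sum>d=1..d. max_weight \<gamma> q ?c b w d) +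
      2 / real b ^ m * max_weight \<gamma> q ?c b w (Suc d)"
    using Suc \<theta> by (intro add_mono) auto
  finally show ?case unfolding eq by (simp add: distrib_left)
qed simp

text \<open>Supplies the point sets behind the tractability bounds. Each search set is finite and
  contains 1, so a minimizer exists, and earlier choices stay minimal because their errors do not
  see coordinate \<open>s + 1\<close>.\<close>

lemma ex_reduced_cbc: "s \<ge> 1 \<Longrightarrow> \<exists>z. reduced_cbc H ip b m w s z"
proof (induction s rule: dec_induct)
  case base
  show ?case by (rule exI[of _ "\<lambda>_. 1"]) (simp add: reduced_cbc_def)
next
  case (step s)
  then obtain z where z: "reduced_cbc H ip b m w s z" by blast
  let ?e = "\<lambda>z d v. (worst_case_error (d + 1) (H (d + 1)) (ip (d + 1))
                  (lattice_points (b ^ m) (d + 1) (cbc_vector b w (z(d + 1 := v)))))\<^sup>2"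
  obtain v where v: "is_arg_min (?e z s) (\<lambda>v. v \<in> cbc_search_set b m (w (s + 1))) v"
    using ex_is_arg_min_if_finite[OF finite_cbc_search_set, of b m "w (s + 1)" "?e z s"]
      one_in_cbc_search_set[OF prime_b] by blast
  have same: "?e (z(s + 1 := v)) d = ?e z d" if "d \<le> s" for d
    using that by (intro ext arg_cong[where f = "\<lambda>P. (worst_case_error _ _ _ P)\<^sup>2"] lattice_points_cong)
      (auto simp: cbc_vector_def)
  have "reduced_cbc H ip b m w (Suc s) (z(s + 1 := v))"
    unfolding reduced_cbc_def
  proof (intro conjI ballI)
    show "(z(s + 1 := v)) 1 = 1" using z step.hyps by (simp add: reduced_cbc_def)
    fix d assume d: "d \<in> {1..<Suc s}"
    then have "is_arg_min (?e z d) (\<lambda>v. v \<in> cbc_search_set b m (w (d + 1))) ((z(s + 1 := v)) (d + 1))"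
      using v z by (cases "d = s") (auto simp: reduced_cbc_def)
    then show "is_arg_min (?e (z(s + 1 := v)) d) (\<lambda>v. v \<in> cbc_search_set b m (w (d + 1))) ((z(s + 1 := v)) (d + 1))"
      using same[of d] d by simp
  qed
  then show ?case by blast
qed

end

section \<open>Error bound and estimates of the constant\<close>

locale reduced_cbc_exponent = reduced_cbc_setting +
  fixes \<delta> :: real
  assumes \<delta>: "\<delta> > 0" "\<delta> \<le> (\<alpha> - 1) / 2"
begin

abbreviation c :: "nat \<Rightarrow> real" where "c s \<equiv> cbc_constant s \<alpha> (product_weight \<gamma>) \<delta> b w"
abbreviation \<zeta> :: real where "\<zeta> \<equiv> zeta (\<alpha> / (\<alpha> - 2 * \<delta>))"
abbreviation a :: "nat \<Rightarrow> real" where "a j \<equiv> \<gamma> j powr (1 / (\<alpha> - 2 * \<delta>)) * real b ^ w j"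

text \<open>The range of \<delta> in terms of \<open>q = 1 / (\<alpha> - 2 * \<delta>)\<close>:
  positivity makes the series for \<open>zeta (\<alpha> * q)\<close> converge, and the upper limit
  gives \<open>q \<le> 1\<close>, as subadditivity requires.\<close>

lemma exponent: "0 < 1 / (\<alpha> - 2 * \<delta>)" "1 / (\<alpha> - 2 * \<delta>) \<le> 1" "\<alpha> * (1 / (\<alpha> - 2 * \<delta>)) > 1" "\<alpha> - 2 * \<delta> \<ge> 1"
  using \<alpha> \<delta> by (auto simp: field_simps)

lemma zeta_pos: "\<zeta> > 0"
  using zeta_ge_1[OF exponent(3)] by simp

lemma cbc_constant_eq:
  "c s = (2 * (\<Sum>d=1..s. max_weight \<gamma> (1 / (\<alpha> - 2 * \<delta>)) (2 * \<zeta>) b w d)) powr (\<alpha> / 2 - \<delta>)"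
  unfolding cbc_constant_def
  using sum_subsets_max_weight[OF mono_w \<gamma>, where q = "1 / (\<alpha> - 2 * \<delta>)" and c = "2 * \<zeta>" and b = "real b" and s = s] by simp

lemma cbc_constant_le_prod:
  "c s \<le> (2 * (\<Prod>j=1..s. 1 + \<gamma> j powr (1 / (\<alpha> - 2 * \<delta>)) * (2 * \<zeta>) * real b ^ w j)) powr (\<alpha> / 2 - \<delta>)"
  unfolding cbc_constant_eq
  using sum_max_weight_le[where c = "2 * \<zeta>" and b = "real b" and \<gamma> = \<gamma> and q = "1 / (\<alpha> - 2 * \<delta>)" and w = w and s = s] zeta_pos b_gt_1 exponent(4)
  by (intro powr_mono2 mult_nonneg_nonneg sum_nonneg max_weight_nonneg) auto

text \<open>From \<open>1 + x \<le> exp x\<close>. All growth statements use this form, in which the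
  weights enter only through the sum of the \<open>a j\<close>.\<close>

lemma cbc_constant_le_exp: "c s \<le> (2 * exp (2 * \<zeta> * (\<Sum>j=1..s. a j))) powr (\<alpha> / 2 - \<delta>)"
proof -
  have "(\<Prod>j=1..s. 1 + \<gamma> j powr (1 / (\<alpha> - 2 * \<delta>)) * (2 * \<zeta>) * real b ^ w j) \<le> (\<Prod>j=1..s. exp (2 * \<zeta> * a j))"
  proof (intro prod_mono conjI)
    fix j
    show "1 + \<gamma> j powr (1 / (\<alpha> - 2 * \<delta>)) * (2 * \<zeta>) * real b ^ w j \<le> exp (2 * \<zeta> * a j)"
      using exp_ge_add_one_self[of "2 * \<zeta> * a j"] by (simp add: mult_ac)
  qed (use zeta_pos b_gt_1 in auto)
  also have "\<dots> = exp (2 * \<zeta> * (\<Sum>j=1..s. a j))" by (simp add: exp_sum sum_distrib_left)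
  finally show ?thesis
    using zeta_pos b_gt_1 exponent(4)
    by (intro order_trans[OF cbc_constant_le_prod] powr_mono2 mult_nonneg_nonneg prod_nonneg) auto
qed

text \<open>The exponent \<open>\<alpha> / 2 - \<delta>\<close> is \<open>1 / (2 * q)\<close>, which
  turns the q-th power of the squared error back into the error.\<close>

lemma cbc_error_bound:
  assumes "s \<ge> 1" "reduced_cbc H ip b m w s z"
  shows "worst_case_error s (H s) (ip s) (lattice_points (b ^ m) s (cbc_vector b w z))
          \<le> c s * real (b ^ m) powr (- \<alpha> / 2 + \<delta>)"
proof -
  let ?e = "worst_case_error s (H s) (ip s) (lattice_points (b ^ m) s (cbc_vector b w z))"
  let ?S = "\<Sum>d=1..s. max_weight \<gamma> (1 / (\<alpha> - 2 * \<delta>)) (2 * \<zeta>) b w d"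
  interpret korobov_space s \<alpha> \<gamma> "H s" "ip s" by (rule korobov_space[OF assms(1)])
  have e0: "0 \<le> ?e" by (rule worst_case_error_formula(2)[OF lattice_points_in_cube])
  have "(?e\<^sup>2) powr (1 / (\<alpha> - 2 * \<delta>)) \<le> 2 / real b ^ m * ?S"
    using lattice_sum_powr_le[OF assms(2) exponent(1-3) order_refl] unfolding worst_case_error_sq[OF assms(1)] by simp
  then have "((?e\<^sup>2) powr (1 / (\<alpha> - 2 * \<delta>))) powr (\<alpha> / 2 - \<delta>) \<le> (2 / real b ^ m * ?S) powr (\<alpha> / 2 - \<delta>)"
    using exponent(4) by (intro powr_mono2) auto
  also have "((?e\<^sup>2) powr (1 / (\<alpha> - 2 * \<delta>))) powr (\<alpha> / 2 - \<delta>) = ?e"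
  proof -
    have "1 / (\<alpha> - 2 * \<delta>) * (\<alpha> / 2 - \<delta>) = 1 / 2" using exponent(4) by (simp add: field_simps)
    then have "((?e\<^sup>2) powr (1 / (\<alpha> - 2 * \<delta>))) powr (\<alpha> / 2 - \<delta>) = (?e\<^sup>2) powr (1 / 2)" by (simp only: powr_powr)
    also have "\<dots> = ?e" using e0 by (simp add: powr_half_sqrt)
    finally show ?thesis .
  qed
  also have "(2 / real b ^ m * ?S) powr (\<alpha> / 2 - \<delta>) = (2 * ?S / real (b ^ m)) powr (\<alpha> / 2 - \<delta>)" by simp
  also have "\<dots> = c s / real (b ^ m) powr (\<alpha> / 2 - \<delta>)"
    unfolding cbc_constant_eq by (rule powr_divide)
  also have "\<dots> = c s * real (b ^ m) powr (- (\<alpha> / 2 - \<delta>))" by (simp only: powr_minus divide_inverse)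
  finally show ?thesis by simp
qed

end

section \<open>Tractability\<close>

context reduced_cbc_setting begin

text \<open>Initial error 1 makes the relative criterion absolute. The given point set also shows
  that some N is admissible, without which \<open>LEAST\<close> would say nothing, not even the
  lower bound 1.\<close>

lemma N_min_le:
  assumes s: "s \<ge> 1" and N: "N \<ge> 1" and P: "size P = N" "set_mset P \<subseteq> unit_cube s"
    and err: "worst_case_error s (H s) (ip s) P \<le> \<epsilon>"
  shows "1 \<le> N_min H ip \<epsilon> s" "N_min H ip \<epsilon> s \<le> N"
proof -
  interpret korobov_space s \<alpha> \<gamma> "H s" "ip s" by (rule korobov_space[OF s])
  have "minimal_error H ip N s \<le> worst_case_error s (H s) (ip s) P"
    unfolding minimal_error_def
  proof (rule cINF_lower)
    show "bdd_below (worst_case_error s (H s) (ip s) ` {P. size P = N \<and> set_mset P \<subseteq> unit_cube s})"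
      by (rule bdd_belowI2[of _ 0]) (use worst_case_error_formula(2) in auto)
  qed (use P in auto)
  then have N': "1 \<le> N \<and> minimal_error H ip N s \<le> \<epsilon> * initial_error s (H s) (ip s)"
    using N err by (simp add: initial_error_eq_1)
  show "1 \<le> N_min H ip \<epsilon> s"
    unfolding N_min_def using LeastI[of "\<lambda>N. 1 \<le> N \<and> minimal_error H ip N s \<le> \<epsilon> * initial_error s (H s) (ip s)", OF N']
    by blast
  show "N_min H ip \<epsilon> s \<le> N"
    unfolding N_min_def
    using Least_le[of "\<lambda>N. 1 \<le> N \<and> minimal_error H ip N s \<le> \<epsilon> * initial_error s (H s) (ip s)", OF N'] .
qed

end

text \<open>The construction only provides powers of b; the least one above X overshoots by at most
  the factor b. The maximum covers \<open>X \<le> 1\<close>, where the exponent is 0.\<close>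

lemma ex_power_between:
  fixes b X :: real
  assumes "b > 1"
  obtains m where "X \<le> b ^ m" "b ^ m \<le> b * max 1 X"
proof -
  define m where "m = (LEAST m. X \<le> b ^ m)"
  obtain n where "X < b ^ n" using real_arch_pow[OF assms] by blast
  then have m: "X \<le> b ^ m" unfolding m_def by (intro LeastI[of "\<lambda>m. X \<le> b ^ m" n]) simp
  moreover have "b ^ m \<le> b * max 1 X"
  proof (cases m)
    case 0
    have "1 * 1 \<le> b * max 1 X" using assms by (intro mult_mono) auto
    then show ?thesis using 0 by simp
  next
    case (Suc k)
    then have "\<not> X \<le> b ^ k" unfolding m_def by (intro not_less_Least) simp
    then have "b * b ^ k \<le> b * max 1 X" using assms by (intro mult_left_mono) auto
    then show ?thesis using Suc by simp
  qed
  ultimately show thesis by (rule that)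
qed

context reduced_cbc_exponent begin

lemma N_min_bound:
  assumes s: "s \<ge> 1" and \<epsilon>: "\<epsilon> \<in> {0<..<1}"
  shows "1 \<le> N_min H ip \<epsilon> s"
    and "real (N_min H ip \<epsilon> s) \<le> 2 * real b * exp (2 * \<zeta> * (\<Sum>j=1..s. a j)) * \<epsilon> powr (- (2 / (\<alpha> - 2 * \<delta>)))"
proof -
  define \<kappa> where "\<kappa> = \<alpha> / 2 - \<delta>"
  have \<kappa>: "\<kappa> > 0" "1 / \<kappa> = 2 / (\<alpha> - 2 * \<delta>)" using exponent(4) by (auto simp: \<kappa>_def field_simps)
  define Y where "Y = 2 * exp (2 * \<zeta> * (\<Sum>j=1..s. a j))"
  \<comment> \<open>Solves \<open>Y powr \<kappa> * X powr (- \<kappa>) = \<epsilon>\<close>, the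
    error bound at X points.\<close>
  define X where "X = Y * \<epsilon> powr (- (1 / \<kappa>))"
  have a0: "0 \<le> (\<Sum>j=1..s. a j)" using b_gt_1 by (intro sum_nonneg) auto
  have Y: "Y \<ge> 1"
  proof -
    have "1 \<le> exp (2 * \<zeta> * (\<Sum>j=1..s. a j))"
      using zeta_pos a0 unfolding one_le_exp_iff by (intro mult_nonneg_nonneg) auto
    then show ?thesis unfolding Y_def by linarith
  qed
  have e1: "\<epsilon> powr (- (1 / \<kappa>)) \<ge> 1"
  proof -
    have "- (1 / \<kappa>) \<le> 0" using \<kappa>(1) by simp
    then have "\<epsilon> powr 0 \<le> \<epsilon> powr (- (1 / \<kappa>))" using \<epsilon> by (intro powr_mono') auto
    then show ?thesis using \<epsilon> by simp
  qed
  have X: "X \<ge> 1" unfolding X_def using mult_mono[OF Y e1] Y by simp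
  obtain m where m: "X \<le> real b ^ m" "real b ^ m \<le> real b * max 1 X"
    using ex_power_between[OF b_gt_1] by blast
  obtain z where z: "reduced_cbc H ip b m w s z" using ex_reduced_cbc[OF s] by blast
  have "worst_case_error s (H s) (ip s) (lattice_points (b ^ m) s (cbc_vector b w z))
       \<le> c s * real (b ^ m) powr (- \<alpha> / 2 + \<delta>)"
    by (rule cbc_error_bound[OF s z])
  also have "- \<alpha> / 2 + \<delta> = - \<kappa>" by (simp add: \<kappa>_def)
  also have "c s * real (b ^ m) powr (- \<kappa>) \<le> Y powr \<kappa> * X powr (- \<kappa>)"
    using cbc_constant_le_exp[of s] X m \<kappa> unfolding Y_def \<kappa>_def[symmetric]
    by (intro mult_mono powr_mono2') auto
  also have "\<dots> = \<epsilon>"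
  proof -
    have "X powr (- \<kappa>) = Y powr (- \<kappa>) * \<epsilon>"
      using \<epsilon> \<kappa>(1) by (simp add: X_def powr_mult powr_powr)
    moreover have "Y powr \<kappa> * Y powr (- \<kappa>) = 1" using Y by (simp flip: powr_add)
    ultimately show ?thesis by (simp flip: mult.assoc)
  qed
  finally have err: "worst_case_error s (H s) (ip s) (lattice_points (b ^ m) s (cbc_vector b w z)) \<le> \<epsilon>" .
  have "1 \<le> b ^ m" using b_gt_1 by simp
  note N = N_min_le[OF s this size_lattice_points lattice_points_in_cube err]
  show "1 \<le> N_min H ip \<epsilon> s" by (rule N(1))
  have "real (N_min H ip \<epsilon> s) \<le> real b ^ m" using N(2) by (metis of_nat_mono of_nat_power)
  also have "\<dots> \<le> real b * X" using m X by simp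
  finally show "real (N_min H ip \<epsilon> s) \<le> 2 * real b * exp (2 * \<zeta> * (\<Sum>j=1..s. a j)) * \<epsilon> powr (- (2 / (\<alpha> - 2 * \<delta>)))"
    by (simp add: X_def Y_def \<kappa>(2) mult_ac)
qed

section \<open>From growth of the weight sums to tractability\<close>

lemma cbc_constant_le:
  assumes "(\<Sum>j=1..s. a j) \<le> T"
  shows "c s \<le> 2 powr (\<alpha> / 2 - \<delta>) * exp ((\<alpha> - 2 * \<delta>) * \<zeta> * T)"
proof -
  have "c s \<le> (2 * exp (2 * \<zeta> * T)) powr (\<alpha> / 2 - \<delta>)"
    using assms zeta_pos exponent(4)
    by (intro order_trans[OF cbc_constant_le_exp] powr_mono2) auto
  also have "\<dots> = 2 powr (\<alpha> / 2 - \<delta>) * exp ((\<alpha> - 2 * \<delta>) * \<zeta> * T)"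
    by (simp add: powr_mult powr_def[of "exp _"] algebra_simps)
  finally show ?thesis .
qed

text \<open>Covers both polynomial cases: logarithmic growth exponentiates to a power of s, and
  \<open>r = 0\<close> is the strong one.\<close>

lemma tractability_bound_of_growth:
  assumes T: "\<And>s. s \<ge> 1 \<Longrightarrow> (\<Sum>j=1..s. a j) \<le> R + r * ln (real s)"
    and p: "p \<ge> 2 / (\<alpha> - 2 * \<delta>)"
  shows "tractability_bound (N_min H ip) (2 * real b * exp (2 * \<zeta> * R)) p (2 * \<zeta> * r)"
  unfolding tractability_bound_def
proof (intro ballI allI impI)
  fix \<epsilon> :: real and s :: nat
  assume \<epsilon>: "\<epsilon> \<in> {0<..<1}" and s: "s \<ge> 1"
  have "exp (2 * \<zeta> * (\<Sum>j=1..s. a j)) \<le> exp (2 * \<zeta> * (R + r * ln (real s)))"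
    using T[OF s] zeta_pos by simp
  also have "\<dots> = exp (2 * \<zeta> * R) * real s powr (2 * \<zeta> * r)"
    using s by (simp add: powr_def algebra_simps flip: exp_add)
  finally have e: "exp (2 * \<zeta> * (\<Sum>j=1..s. a j)) \<le> exp (2 * \<zeta> * R) * real s powr (2 * \<zeta> * r)" .
  have "real (N_min H ip \<epsilon> s) \<le> 2 * real b * exp (2 * \<zeta> * (\<Sum>j=1..s. a j)) * \<epsilon> powr (- (2 / (\<alpha> - 2 * \<delta>)))"
    by (rule N_min_bound(2)[OF s \<epsilon>])
  also have "\<dots> \<le> 2 * real b * (exp (2 * \<zeta> * R) * real s powr (2 * \<zeta> * r)) * \<epsilon> powr (- p)"
    using e \<epsilon> p by (intro mult_mono powr_mono') auto
  finally show "real (N_min H ip \<epsilon> s) \<le> 2 * real b * exp (2 * \<zeta> * R) * real s powr (2 * \<zeta> * r) * \<epsilon> powr (- p)"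
    by (simp add: mult_ac)
qed

text \<open>The limit superior controls only large s. The finitely many others, including
  \<open>s = 1\<close> with its vanishing logarithm, go into the additive constant R.\<close>

lemma limsup_growth:
  assumes A: "limsup (\<lambda>s. ereal ((\<Sum>j=1..s. a j) / ln (real s))) < \<infinity>"
  defines "r \<equiv> real_of_ereal (limsup (\<lambda>s. ereal ((\<Sum>j=1..s. a j) / ln (real s))))"
  shows "0 \<le> r" and "\<And>\<eta>. \<eta> > 0 \<Longrightarrow> \<exists>R. \<forall>s\<ge>1. (\<Sum>j=1..s. a j) \<le> R + (r + \<eta>) * ln (real s)"
proof -
  let ?A = "limsup (\<lambda>s. ereal ((\<Sum>j=1..s. a j) / ln (real s)))"
  have a0: "0 \<le> a j" for j by simp
  have S0: "0 \<le> (\<Sum>j=1..s. a j)" for s by (intro sum_nonneg a0)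
  have "\<forall>\<^sub>F s in sequentially. 0 \<le> ereal ((\<Sum>j=1..s. a j) / ln (real s))"
    using eventually_ge_at_top[of 1] by eventually_elim (use S0 in auto)
  then have "0 \<le> ?A" by (intro le_Limsup) auto
  then have r: "?A = ereal r" using A unfolding r_def by (cases ?A) auto
  show "0 \<le> r" using \<open>0 \<le> ?A\<close> unfolding r by simp
  fix \<eta> :: real assume \<eta>: "\<eta> > 0"
  have "\<forall>\<^sub>F s in sequentially. ereal ((\<Sum>j=1..s. a j) / ln (real s)) < ereal (r + \<eta>)"
  proof (rule Limsup_lessD)
    show "?A < ereal (r + \<eta>)" using \<eta> unfolding r by simp
  qed
  then obtain n where n: "\<And>s. s \<ge> n \<Longrightarrow> (\<Sum>j=1..s. a j) / ln (real s) < r + \<eta>"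
    by (auto simp: eventually_sequentially)
  show "\<exists>R. \<forall>s\<ge>1. (\<Sum>j=1..s. a j) \<le> R + (r + \<eta>) * ln (real s)"
  proof (intro exI allI impI)
    fix s :: nat assume s: "s \<ge> 1"
    have ln0: "0 \<le> (r + \<eta>) * ln (real s)" using s \<open>0 \<le> r\<close> \<eta> by simp
    \<comment> \<open>The offset 2 ensures \<open>ln (real s) > 0\<close> beyond the initial
      segment, so the quotient may be cleared.\<close>
    show "(\<Sum>j=1..s. a j) \<le> (\<Sum>j=1..n + 2. a j) + (r + \<eta>) * ln (real s)"
    proof (cases "s \<le> n + 2")
      case True
      then have "(\<Sum>j=1..s. a j) \<le> (\<Sum>j=1..n + 2. a j)" by (intro sum_mono2 a0) auto
      then show ?thesis using ln0 by simp
    next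
      case False
      then have "ln (real s) > 0" by simp
      moreover have "(\<Sum>j=1..s. a j) / ln (real s) < r + \<eta>" using False by (intro n) simp
      ultimately have "(\<Sum>j=1..s. a j) \<le> (r + \<eta>) * ln (real s)" by (simp add: field_simps)
      then show ?thesis using S0[of "n + 2"] by simp
    qed
  qed
qed

lemma polynomial_tractability:
  assumes "limsup (\<lambda>s. ereal ((\<Sum>j=1..s. a j) / ln (real s))) < \<infinity>"
  defines "r \<equiv> real_of_ereal (limsup (\<lambda>s. ereal ((\<Sum>j=1..s. a j) / ln (real s))))"
  shows "\<forall>\<eta>>0. \<exists>c\<^sub>\<eta>>0. \<forall>s\<ge>1. c s \<le> c\<^sub>\<eta> * 2 powr (\<alpha> / 2 - \<delta>) * real s powr (\<zeta> * (r + \<eta>) * (\<alpha> - 2 * \<delta>))"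
    and "polynomially_tractable (N_min H ip)"
    and "polynomial_exponents_at_most (N_min H ip) (2 / (\<alpha> - 2 * \<delta>)) (2 * \<zeta> * r)"
proof -
  note growth = limsup_growth[OF assms(1), folded r_def]
  show "\<forall>\<eta>>0. \<exists>c\<^sub>\<eta>>0. \<forall>s\<ge>1. c s \<le> c\<^sub>\<eta> * 2 powr (\<alpha> / 2 - \<delta>) * real s powr (\<zeta> * (r + \<eta>) * (\<alpha> - 2 * \<delta>))"
  proof (intro allI impI)
    fix \<eta> :: real assume "\<eta> > 0"
    then obtain R where R: "\<And>s. s \<ge> 1 \<Longrightarrow> (\<Sum>j=1..s. a j) \<le> R + (r + \<eta>) * ln (real s)"
      using growth(2) by blast
    have "c s \<le> exp ((\<alpha> - 2 * \<delta>) * \<zeta> * R) * 2 powr (\<alpha> / 2 - \<delta>) * real s powr (\<zeta> * (r + \<eta>) * (\<alpha> - 2 * \<delta>))"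
      if s: "s \<ge> 1" for s
    proof -
      have "exp ((\<alpha> - 2 * \<delta>) * \<zeta> * (R + (r + \<eta>) * ln (real s))) =
        exp ((\<alpha> - 2 * \<delta>) * \<zeta> * R) * real s powr (\<zeta> * (r + \<eta>) * (\<alpha> - 2 * \<delta>))"
        using s by (simp add: powr_def algebra_simps flip: exp_add)
      then show ?thesis using cbc_constant_le[OF R[OF s]] by (simp add: mult_ac)
    qed
    then show "\<exists>c\<^sub>\<eta>>0. \<forall>s\<ge>1. c s \<le> c\<^sub>\<eta> * 2 powr (\<alpha> / 2 - \<delta>) * real s powr (\<zeta> * (r + \<eta>) * (\<alpha> - 2 * \<delta>))"
      by (intro exI[of _ "exp ((\<alpha> - 2 * \<delta>) * \<zeta> * R)"]) auto
  qed
  have bound: "\<exists>c\<ge>0. tractability_bound (N_min H ip) c p q" if p: "p > 2 / (\<alpha> - 2 * \<delta>)" and q: "q > 2 * \<zeta> * r" for p q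
  proof -
    \<comment> \<open>Chosen so that \<open>2 * \<zeta> * (r + \<eta>) = q\<close>.\<close>
    define \<eta> where "\<eta> = (q - 2 * \<zeta> * r) / (2 * \<zeta>)"
    have "\<eta> > 0" using q zeta_pos by (simp add: \<eta>_def)
    then obtain R where R: "\<And>s. s \<ge> 1 \<Longrightarrow> (\<Sum>j=1..s. a j) \<le> R + (r + \<eta>) * ln (real s)"
      using growth(2) by blast
    have "2 * \<zeta> * (r + \<eta>) = q" using zeta_pos by (simp add: \<eta>_def field_simps)
    with tractability_bound_of_growth[OF R, of p] p
    have "tractability_bound (N_min H ip) (2 * real b * exp (2 * \<zeta> * R)) p q" by simp
    then show ?thesis by (intro exI[of _ "2 * real b * exp (2 * \<zeta> * R)"]) simp
  qed
  then show "polynomial_exponents_at_most (N_min H ip) (2 / (\<alpha> - 2 * \<delta>)) (2 * \<zeta> * r)"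
    by (simp add: polynomial_exponents_at_most_def)
  have "0 \<le> 2 / (\<alpha> - 2 * \<delta>)" "0 \<le> 2 * \<zeta> * r" using exponent(4) zeta_pos growth(1) by auto
  then show "polynomially_tractable (N_min H ip)"
    \<comment> \<open>Any admissible pair of exponents will do here; adding 1 meets the strict
      inequalities of \<open>bound\<close>.\<close>
    using bound[of "2 / (\<alpha> - 2 * \<delta>) + 1" "2 * \<zeta> * r + 1"] unfolding polynomially_tractable_def
    by (metis add_nonneg_nonneg less_add_one zero_le_one)
qed

lemma strong_tractability:
  assumes "summable (\<lambda>j. a (Suc j))"
  shows "c s \<le> 2 powr (\<alpha> / 2 - \<delta>) * exp ((\<alpha> - 2 * \<delta>) * \<zeta> * (\<Sum>j. a (Suc j)))"
    and "strongly_polynomially_tractable (N_min H ip)"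
    and "strong_exponent (N_min H ip) \<le> 2 / (\<alpha> - 2 * \<delta>)"
proof -
  have sum_le: "(\<Sum>j=1..s. a j) \<le> (\<Sum>j. a (Suc j))" for s
  proof -
    have "(\<Sum>j=1..s. a j) = (\<Sum>j<s. a (Suc j))"
      by (simp add: sum.atLeast1_atMost_eq)
    also have "\<dots> \<le> (\<Sum>j. a (Suc j))" by (rule sum_le_suminf[OF assms]) auto
    finally show ?thesis .
  qed
  show "c s \<le> 2 powr (\<alpha> / 2 - \<delta>) * exp ((\<alpha> - 2 * \<delta>) * \<zeta> * (\<Sum>j. a (Suc j)))"
    by (rule cbc_constant_le[OF sum_le])
  let ?p = "2 / (\<alpha> - 2 * \<delta>)" and ?c = "2 * real b * exp (2 * \<zeta> * (\<Sum>j. a (Suc j)))"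
  have tb: "tractability_bound (N_min H ip) ?c ?p 0"
    using tractability_bound_of_growth[of "\<Sum>j. a (Suc j)" 0 ?p] sum_le by simp
  have p: "0 \<le> ?p" and c: "0 \<le> ?c" using exponent(4) by auto
  show "strongly_polynomially_tractable (N_min H ip)"
    unfolding strongly_polynomially_tractable_def using tb p c by blast
  show "strong_exponent (N_min H ip) \<le> ?p"
    unfolding strong_exponent_def
  proof (rule cInf_lower)
    show "?p \<in> {p. 0 \<le> p \<and> (\<exists>c\<ge>0. tractability_bound (N_min H ip) c p 0)}" using tb p c by blast
    show "bdd_below {p. 0 \<le> p \<and> (\<exists>c\<ge>0. tractability_bound (N_min H ip) c p 0)}"
      by (rule bdd_belowI[of _ 0]) simp
  qed
qed

text \<open>In the logarithm of the bound for \<open>N_min\<close>, the weight sum is o(s) by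
  hypothesis and the power of \<epsilon> becomes a logarithm of \<open>1 / \<epsilon>\<close>. Both
  are dominated by small multiples of s and of \<open>1 / \<epsilon>\<close> up to
  constants.\<close>

lemma weak_tractability:
  assumes lim: "(\<lambda>s. (1 / real s) * (\<Sum>j=1..s. a j)) \<longlonglongrightarrow> 0"
  shows "weakly_tractable (N_min H ip)"
proof -
  let ?p = "2 / (\<alpha> - 2 * \<delta>)"
  have a0: "0 \<le> a j" for j by simp
  have p: "?p > 0" using exponent(4) by simp
  have lin: "\<exists>R. \<forall>s\<ge>1. (\<Sum>j=1..s. a j) \<le> R + \<eta> * real s" if \<eta>: "\<eta> > 0" for \<eta>
  proof -
    obtain n where n: "\<And>s. s \<ge> n \<Longrightarrow> \<bar>(1 / real s) * (\<Sum>j=1..s. a j)\<bar> < \<eta>"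
      using LIMSEQ_D[OF lim \<eta>] by auto
    show ?thesis
    proof (intro exI allI impI)
      fix s :: nat assume s: "s \<ge> 1"
      show "(\<Sum>j=1..s. a j) \<le> (\<Sum>j=1..n. a j) + \<eta> * real s"
      proof (cases "s \<le> n")
        case True
        then have "(\<Sum>j=1..s. a j) \<le> (\<Sum>j=1..n. a j)" by (intro sum_mono2 a0) auto
        moreover have "0 \<le> \<eta> * real s" using \<eta> by simp
        ultimately show ?thesis by linarith
      next
        case False
        then have "(1 / real s) * (\<Sum>j=1..s. a j) < \<eta>" using n[of s] by linarith
        then have "(\<Sum>j=1..s. a j) \<le> \<eta> * real s" using s by (simp add: field_simps)
        then show ?thesis using sum_nonneg[of "{1..n}" a] a0 by fastforce
      qed
    qed
  qed
  have ln_lin: "\<exists>R. \<forall>x\<ge>1. ?p * ln x \<le> R + \<eta> * x" if \<eta>: "\<eta> > 0" for \<eta> :: real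
  proof (intro exI allI impI)
    fix x :: real assume x: "x \<ge> 1"
    \<comment> \<open>Rescaling the argument before using \<open>ln y \<le> y - 1\<close> produces
      exactly the slope \<eta>.\<close>
    have "ln (\<eta> / ?p * x) \<le> \<eta> / ?p * x - 1" using x \<eta> p by (intro ln_le_minus_one) simp
    moreover have "ln (\<eta> / ?p * x) = ln (\<eta> / ?p) + ln x" using x \<eta> p by (intro ln_mult_pos) auto
    ultimately have "ln x \<le> - ln (\<eta> / ?p) + \<eta> / ?p * x" by simp
    then have "?p * ln x \<le> ?p * (- ln (\<eta> / ?p) + \<eta> / ?p * x)" using p by (intro mult_left_mono) auto
    also have "\<dots> = ?p * (- ln (\<eta> / ?p)) + \<eta> * x" using p by (simp only: distrib_left) simp
    finally show "?p * ln x \<le> ?p * (- ln (\<eta> / ?p)) + \<eta> * x" .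
  qed
  have threshold: "\<exists>T. \<forall>\<epsilon>\<in>{0<..<1}. \<forall>s\<ge>1. T \<le> real s + 1 / \<epsilon> \<longrightarrow>
      \<bar>ln (real (N_min H ip \<epsilon> s)) / (real s + 1 / \<epsilon>)\<bar> < e" if e: "e > 0" for e :: real
  proof -
    \<comment> \<open>The tolerance \<open>e / (4 * \<zeta>)\<close> anticipates the factor
      \<open>2 * \<zeta>\<close>, so that s and \<open>1 / \<epsilon>\<close> each receive the
      coefficient \<open>e / 2\<close>.\<close>
    obtain R1 where R1: "\<And>s. s \<ge> 1 \<Longrightarrow> (\<Sum>j=1..s. a j) \<le> R1 + e / (4 * \<zeta>) * real s"
      using lin[of "e / (4 * \<zeta>)"] e zeta_pos by auto
    obtain R2 where R2: "\<And>x. x \<ge> 1 \<Longrightarrow> ?p * ln x \<le> R2 + e / 2 * x"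
      using ln_lin[of "e / 2"] e by auto
    define R where "R = ln (2 * real b) + 2 * \<zeta> * R1 + R2"
    show ?thesis
    proof (intro exI ballI allI impI)
      fix \<epsilon> :: real and s :: nat
      \<comment> \<open>Beyond this threshold the other half of e absorbs the constant R; the
        summand 1 makes the inequality strict.\<close>
      assume \<epsilon>: "\<epsilon> \<in> {0<..<1}" and s: "s \<ge> 1" and T: "2 * \<bar>R\<bar> / e + 1 \<le> real s + 1 / \<epsilon>"
      note N = N_min_bound[OF s \<epsilon>]
      have "ln (real (N_min H ip \<epsilon> s)) \<le> ln (2 * real b * exp (2 * \<zeta> * (\<Sum>j=1..s. a j)) * \<epsilon> powr (- ?p))"
        using N by (intro ln_mono) auto
      also have "\<dots> = ln (2 * real b) + 2 * \<zeta> * (\<Sum>j=1..s. a j) + ?p * ln (1 / \<epsilon>)"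
        using b_gt_1 \<epsilon> by (simp add: ln_mult ln_powr ln_div)
      also have "\<dots> \<le> ln (2 * real b) + 2 * \<zeta> * (R1 + e / (4 * \<zeta>) * real s) + (R2 + e / 2 * (1 / \<epsilon>))"
        using R1[OF s] R2[of "1 / \<epsilon>"] \<epsilon> zeta_pos by (intro add_mono mult_left_mono) auto
      also have "\<dots> = R + e / 2 * (real s + 1 / \<epsilon>)"
        using zeta_pos by (simp add: R_def field_simps)
      also have "\<dots> < e * (real s + 1 / \<epsilon>)"
      proof -
        have "2 * \<bar>R\<bar> / e < real s + 1 / \<epsilon>" using T by simp
        then have "2 * \<bar>R\<bar> < e * (real s + 1 / \<epsilon>)" using e by (simp add: divide_less_eq mult.commute)
        then show ?thesis by linarith
      qed
      finally have up: "ln (real (N_min H ip \<epsilon> s)) < e * (real s + 1 / \<epsilon>)" .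
      have pos: "real s + 1 / \<epsilon> > 0" using \<epsilon> s by (intro add_pos_pos) auto
      have "0 \<le> ln (real (N_min H ip \<epsilon> s))" using N(1) by simp
      then show "\<bar>ln (real (N_min H ip \<epsilon> s)) / (real s + 1 / \<epsilon>)\<bar> < e"
        using up pos by (simp add: divide_less_eq)
    qed
  qed
  show ?thesis
    unfolding weakly_tractable_def tendsto_iff eventually_inf_principal eventually_filtercomap
  proof (intro allI impI)
    fix e :: real assume "e > 0"
    then obtain T where T: "\<And>\<epsilon> s. \<epsilon> \<in> {0<..<1} \<Longrightarrow> s \<ge> 1 \<Longrightarrow> T \<le> real s + 1 / \<epsilon> \<Longrightarrow>
      \<bar>ln (real (N_min H ip \<epsilon> s)) / (real s + 1 / \<epsilon>)\<bar> < e"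
      using threshold by blast
    show "\<exists>Q. eventually Q at_top \<and> (\<forall>x. Q (case x of (\<epsilon>, s) \<Rightarrow> real s + 1 / \<epsilon>) \<longrightarrow>
        x \<in> {0<..<1} \<times> {1..} \<longrightarrow>
        dist (case x of (\<epsilon>, s) \<Rightarrow> ln (real (N_min H ip \<epsilon> s)) / (real s + 1 / \<epsilon>)) 0 < e)"
      using T by (intro exI[of _ "\<lambda>x. T \<le> x"]) (auto simp: dist_real_def eventually_ge_at_top)
  qed
qed

end

theorem corollary2:
  fixes b :: nat and \<alpha> \<delta> :: real and \<gamma> :: "nat \<Rightarrow> real" and w :: "nat \<Rightarrow> nat"
    and H :: "nat \<Rightarrow> ((nat \<Rightarrow> real) \<Rightarrow> complex) set"
    and ip :: "nat \<Rightarrow> ((nat \<Rightarrow> real) \<Rightarrow> complex) \<Rightarrow> ((nat \<Rightarrow> real) \<Rightarrow> complex) \<Rightarrow> complex"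
  assumes "prime b"
    and "\<alpha> > 1"
    and "\<And>j. j \<ge> 1 \<Longrightarrow> \<gamma> j > 0"
    and "mono_on {1..} w"
    and "\<And>s. s \<ge> 1 \<Longrightarrow>
           is_rkhs (unit_cube s) (korobov_kernel s \<alpha> (product_weight \<gamma>)) (H s) (ip s)"
    and "\<delta> > 0" and "\<delta> \<le> (\<alpha> - 1) / 2"
  defines "c \<equiv> (\<lambda>s. cbc_constant s \<alpha> (product_weight \<gamma>) \<delta> b w)"
    and "\<zeta> \<equiv> zeta (\<alpha> / (\<alpha> - 2 * \<delta>))"
    and "a \<equiv> (\<lambda>j. \<gamma> j powr (1 / (\<alpha> - 2 * \<delta>)) * real b ^ w j)"
  defines "A \<equiv> limsup (\<lambda>s. ereal ((\<Sum>j=1..s. a j) / ln (real s)))"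
    and "B \<equiv> (\<Sum>j. a (Suc j))"
  shows
    "(\<forall>s\<ge>1. \<forall>m\<ge>1. \<forall>z. reduced_cbc H ip b m w s z \<longrightarrow>
        worst_case_error s (H s) (ip s) (lattice_points (b ^ m) s (cbc_vector b w z))
          \<le> c s * real (b ^ m) powr (- \<alpha> / 2 + \<delta>)) \<and>
     (\<forall>s\<ge>1. c s \<le> (2 * (\<Prod>j=1..s. 1 + \<gamma> j powr (1 / (\<alpha> - 2 * \<delta>)) * (2 * \<zeta>) * real b ^ w j))
                      powr (\<alpha> / 2 - \<delta>)) \<and>
     (A < \<infinity> \<longrightarrow>
        (\<forall>\<eta>>0. \<exists>c\<^sub>\<eta>>0. \<forall>s\<ge>1.
           c s \<le> c\<^sub>\<eta> * 2 powr (\<alpha> / 2 - \<delta>) *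
                  real s powr (\<zeta> * (real_of_ereal A + \<eta>) * (\<alpha> - 2 * \<delta>))) \<and>
        polynomially_tractable (N_min H ip) \<and>
        polynomial_exponents_at_most (N_min H ip) (2 / (\<alpha> - 2 * \<delta>)) (2 * \<zeta> * real_of_ereal A)) \<and>
     (summable (\<lambda>j. a (Suc j)) \<longrightarrow>
        (\<forall>s\<ge>1. c s \<le> 2 powr (\<alpha> / 2 - \<delta>) * exp ((\<alpha> - 2 * \<delta>) * \<zeta> * B)) \<and>
        strongly_polynomially_tractable (N_min H ip) \<and>
        strong_exponent (N_min H ip) \<le> 2 / (\<alpha> - 2 * \<delta>)) \<and>
     ((\<lambda>s. (1 / real s) * (\<Sum>j=1..s. \<gamma> j * real b ^ w j)) \<longlonglongrightarrow> 0 \<longrightarrow>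
        weakly_tractable (N_min H ip))"
proof -
  interpret R: reduced_cbc_exponent b \<alpha> \<gamma> w H ip \<delta>
    using assms(1-7) by unfold_locales
  text \<open>Weak tractability uses the largest admissible \<open>\<delta>\<close>, for which the exponent
    \<open>1 / (\<alpha> - 2 \<delta>)\<close> is 1.\<close>
  interpret W: reduced_cbc_exponent b \<alpha> \<gamma> w H ip "(\<alpha> - 1) / 2"
    using assms(1-7) by unfold_locales auto
  have W: "\<alpha> - 2 * ((\<alpha> - 1) / 2) = 1" by (simp add: field_simps)
  have weak: "weakly_tractable (N_min H ip)"
    if "(\<lambda>s. (1 / real s) * (\<Sum>j=1..s. \<gamma> j * real b ^ w j)) \<longlonglongrightarrow> 0"
  proof (rule W.weak_tractability)
    have "(\<Sum>j=1..s. \<gamma> j powr (1 / (\<alpha> - 2 * ((\<alpha> - 1) / 2))) * real b ^ w j) = (\<Sum>j=1..s. \<gamma> j * real b ^ w j)" for s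
      unfolding W using assms(3) by (intro sum.cong) (auto simp: less_imp_le)
    then show "(\<lambda>s. (1 / real s) * (\<Sum>j=1..s. \<gamma> j powr (1 / (\<alpha> - 2 * ((\<alpha> - 1) / 2))) * real b ^ w j)) \<longlonglongrightarrow> 0"
      using that by simp
  qed
  show ?thesis
    unfolding c_def \<zeta>_def A_def B_def a_def
  proof (intro conjI impI, goal_cases)
    case 1
    then show ?case using R.cbc_error_bound by blast
  next
    case 2
    then show ?case using R.cbc_constant_le_prod by blast
  next
    case 3
    then show ?case by (rule R.polynomial_tractability(1))
  next
    case 4
    then show ?case by (rule R.polynomial_tractability(2))
  next
    case 5
    then show ?case by (rule R.polynomial_tractability(3))
  next
    case 6
    then show ?case using R.strong_tractability(1) by blast
  next
    case 7
    then show ?case by (rule R.strong_tractability(2))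
  next
    case 8
    then show ?case by (rule R.strong_tractability(3))
  next
    case 9
    then show ?case by (rule weak)
  qed
qed

end
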